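(* Let $\alpha\in(1,2)$, $\sigma\in\mathbb{R}\setminus\{0\}$, let $(L^\alpha_t)_{t\in\mathbb{R}}$ be either the truncated or the non-truncated $\alpha$-stable process on $\mathbb{R}$, let $\varphi_\beta$ be the random dynamical system generated by $$\mathrm{d}X_t=(\beta X_t-X_t^3)\,\mathrm{d}t+\sigma\,\mathrm{d}L^\alpha_t,\qquad X_0\in\mathbb{R},$$ let $\{a_\beta(\omega)\}_{\omega\in\Omega}$ be its unique attracting random equilibrium, and let $\Phi_\beta(t,\omega):=\frac{\partial\varphi_\beta}{\partial x}(t,\omega,a_\beta(\omega))$ be the linearized random dynamical system along $a_\beta$. Then the dichotomy spectrum $\Sigma_\beta$ of $\Phi_\beta$ is $$\Sigma_\beta=(-\infty,\beta]\qquad\text{for all }\beta\in\mathbb{R}.$$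
   Context: Noise. For $\alpha\in(0,2)$ let $\nu_\alpha(\mathrm{d}z)=c_\alpha|z|^{-1-\alpha}\,\mathrm{d}z$ on $\mathbb{R}\setminus\{0\}$, $c_\alpha=\frac{\alpha}{2^{1-\alpha}\pi^{1/2}}\frac{\Gamma((1+\alpha)/2)}{\Gamma(1-\alpha/2)}$. Let $N$ be the Poisson random measure of jumps and $\widetilde N(t,\mathrm{d}z)=N(t,\mathrm{d}z)-t\nu(\mathrm{d}z)$. The non-truncated process is the two-sided symmetric $\alpha$-stable Lévy process, with $\nu=\nu_\alpha$ and $L_t=\int_{|z|<1}z\,\widetilde N(t,\mathrm{d}z)+\int_{|z|\ge1}z\,N(t,\mathrm{d}z)$. The truncated process is the two-sided Lévy process with $\nu=\nu_\alpha|_{\{|z|<1\}}$ and $L_t=\int_{|z|<1}z\,\widetilde N(t,\mathrm{d}z)$. Random dynamical system. $(\Omega,\mathcal F,\mathbb P)$ is the canonical space of two-sided càdlàg paths with $L_t(\omega)=\omega(t)$, $\omega(0)=0$, and $\theta_t\omega(\cdot)=\omega(t+\cdot)-\omega(t)$. The equation generates a random dynamical system (cocycle) $\varphi=\varphi_\beta$ over $\theta$: $\varphi(t,\omega,x)$ is the solution at time $t\ge0$ started at $x$ at time $0$. Random equilibrium. The system has a (pullback) random attractor consisting of a single point $\{a_\beta(\omega)\}$: $a_\beta:\Omega\to\mathbb{R}$ is measurable and, $\mathbb P$-a.s., $\varphi(t,\omega,a_\beta(\omega))=a_\beta(\theta_t\omega)$ for all $t\ge0$ and $\lim_{t\to\infty}\sup_{x\in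 B}|\varphi(t,\theta_{-t}\omega,x)-a_\beta(\omega)|=0$ for every bounded $B\subset\mathbb{R}$. The linearization is given, for all $t\in\mathbb{R}$, by $\Phi_\beta(t,\omega)=\exp\big(\int_0^t(\beta-3a_\beta(\theta_s\omega)^2)\,\mathrm{d}s\big)$. Dichotomy spectrum. Let $(\theta,\Phi)$ be a linear random dynamical system on $\mathbb{R}^d$ with two-sided time, $\Phi:\mathbb{R}\times\Omega\to\mathbb{R}^{d\times d}$ (here $d=1$). An invariant projector is a measurable $P:\Omega\to\mathbb{R}^{d\times d}$ with $P(\omega)=P(\omega)^2$ and $P(\theta_t\omega)\Phi(t,\omega)=\Phi(t,\omega)P(\omega)$ for all $t\in\mathbb{R}$, $\omega\in\Omega$. $(\theta,\Phi)$ admits an exponential dichotomy with growth rate $\gamma\in\mathbb{R}$ if there are constants $\kappa>0$, $K\ge1$ and an invariant projector $P_\gamma$ such that for almost all $\omega$: $\|\Phi(t,\omega)P_\gamma(\omega)\|\le Ke^{(\gamma-\kappa)t}$ for all $t\ge0$ and $\|\Phi(t,\omega)(1-P_\gamma(\omega))\|\le Ke^{(\gamma+\kappa)t}$ for all $t\le0$. The dichotomy spectrum is $\Sigma:=\{\gamma\in\mathbb{R}:(\theta,\Phi)\text{ does not admit an exponential dichotomy with growth rate }\gamma\}$. *)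

theory Defs
  imports "HOL-Probability.Probability"
begin

section \<open>The canonical space of two-sided cadlag paths\<close>

definition cadlag_on :: "real set \<Rightarrow> (real \<Rightarrow> real) \<Rightarrow> bool" where
  "cadlag_on T f \<longleftrightarrow>
     (\<forall>t\<in>T. continuous (at t within (T \<inter> {t..})) f \<and>
            (\<exists>l. (f \<longlongrightarrow> l) (at t within (T \<inter> {..<t}))))"

definition cadlag_paths :: "(real \<Rightarrow> real) set" where
  "cadlag_paths = {\<omega>. \<omega> 0 = 0 \<and> cadlag_on UNIV \<omega>}"

text \<open>The \<open>\<sigma>\<close>-algebra is the one generated by the evaluations \<open>\<omega> \<mapsto> \<omega> t\<close> (it is the
  Borel \<open>\<sigma>\<close>-algebra of the Skorokhod topology), without completion. The measure carried by
  \<open>path_space\<close> itself is irrelevant.\<close>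

definition path_space :: "(real \<Rightarrow> real) measure" where
  "path_space = restrict_space (\<Pi>\<^sub>M t\<in>UNIV. borel) cadlag_paths"

definition path_shift :: "real \<Rightarrow> (real \<Rightarrow> real) \<Rightarrow> (real \<Rightarrow> real)" where
  "path_shift t \<omega> = (\<lambda>s. \<omega> (t + s) - \<omega> t)"


section \<open>Stable Levy processes\<close>

definition stable_const :: "real \<Rightarrow> real" where
  "stable_const \<alpha> =
     \<alpha> / (2 powr (1 - \<alpha>) * pi powr (1 / 2)) * (Gamma ((1 + \<alpha>) / 2) / Gamma (1 - \<alpha> / 2))"

text \<open>Both measures live on all of \<open>\<real>\<close> and do not charge \<open>{0}\<close>.\<close>

definition stable_levy_measure :: "real \<Rightarrow> real measure" where
  "stable_levy_measure \<alpha> =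
     density lborel (\<lambda>z. ennreal (stable_const \<alpha> * \<bar>z\<bar> powr (- 1 - \<alpha>)))"

definition truncated_levy_measure :: "real \<Rightarrow> real measure" where
  "truncated_levy_measure \<alpha> =
     density (stable_levy_measure \<alpha>) (indicator {z. \<bar>z\<bar> < 1})"

definition jump :: "(real \<Rightarrow> real) \<Rightarrow> real \<Rightarrow> real" where
  "jump \<omega> s = \<omega> s - Lim (at_left s) \<omega>"

text \<open>The random measure \<open>N\<close> on time \<open>\<times>\<close> jump size: the sum of the Dirac masses at \<open>(s, jump \<omega> s)\<close>
  over the jump times \<open>s\<close>. In the usual notation \<open>N (t, B)\<close> is its value on \<open>{0<..t} \<times> B\<close>.\<close>

definition jump_measure :: "(real \<Rightarrow> real) \<Rightarrow> (real \<times> real) measure" where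
  "jump_measure \<omega> =
     distr (count_space {s. jump \<omega> s \<noteq> 0}) (borel \<Otimes>\<^sub>M borel) (\<lambda>s. (s, jump \<omega> s))"

definition poisson_random_measure ::
  "'w measure \<Rightarrow> ('w \<Rightarrow> 'b measure) \<Rightarrow> 'b measure \<Rightarrow> bool" where
  "poisson_random_measure M N \<mu> \<longleftrightarrow>
     (\<forall>\<omega>\<in>space M. sets (N \<omega>) = sets \<mu>) \<and>
     (\<forall>A\<in>sets \<mu>. (\<lambda>\<omega>. emeasure (N \<omega>) A) \<in> borel_measurable M) \<and>
     (\<forall>A\<in>sets \<mu>. emeasure \<mu> A < \<infinity> \<longrightarrow>
        (\<forall>k::nat. measure M {\<omega>\<in>space M. emeasure (N \<omega>) A = of_nat k} =
                  measure \<mu> A ^ k / fact k * exp (- measure \<mu> A))) \<and>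
     (\<forall>A\<in>sets \<mu>. emeasure \<mu> A = \<infinity> \<longrightarrow> (AE \<omega> in M. emeasure (N \<omega>) A = \<infinity>)) \<and>
     (\<forall>(n::nat) A. (\<forall>i<n. A i \<in> sets \<mu>) \<and> disjoint_family_on A {..<n} \<longrightarrow>
        prob_space.indep_vars M (\<lambda>_. borel) (\<lambda>i \<omega>. emeasure (N \<omega>) (A i)) {..<n})"

definition two_sided_levy_process :: "(real \<Rightarrow> real) measure \<Rightarrow> bool" where
  "two_sided_levy_process M \<longleftrightarrow>
     prob_space M \<and> space M = cadlag_paths \<and> sets M = sets path_space \<and>
     (\<forall>(n::nat) t. (\<forall>i<n. t i \<le> t (Suc i)) \<longrightarrow>
        prob_space.indep_vars M (\<lambda>_. borel) (\<lambda>i \<omega>. \<omega> (t (Suc i)) - \<omega> (t i)) {..<n}) \<and>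
     (\<forall>s t h. distr M borel (\<lambda>\<omega>. \<omega> (t + h) - \<omega> (s + h)) = distr M borel (\<lambda>\<omega>. \<omega> t - \<omega> s))"

definition levy_process_with_measure :: "real measure \<Rightarrow> (real \<Rightarrow> real) measure \<Rightarrow> bool" where
  "levy_process_with_measure \<nu> M \<longleftrightarrow>
     two_sided_levy_process M \<and> poisson_random_measure M jump_measure (lborel \<Otimes>\<^sub>M \<nu>)"

text \<open>\<open>\<integral> z N(dr,dz)\<close> over \<open>r \<in> {s<..t}\<close> and \<open>\<bar>z\<bar> \<ge> 1\<close>.\<close>

definition big_jump_integral :: "real \<Rightarrow> real \<Rightarrow> (real \<Rightarrow> real) \<Rightarrow> real" where
  "big_jump_integral s t \<omega> = (LINT p:({s<..t} \<times> {z. \<bar>z\<bar> \<ge> 1})|jump_measure \<omega>. snd p)"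

text \<open>The integral of \<open>z\<close> against the compensated measure \<open>N(dr,dz) - dr \<nu>(dz)\<close> over \<open>{s<..t}\<close>:
  since \<open>\<bar>z\<bar>\<close> need not be integrable near \<open>0\<close>, it is the \<open>L\<^sup>2\<close>-limit, as \<open>\<epsilon> \<rightarrow> 0\<close>, of the
  integrals over \<open>\<epsilon> \<le> \<bar>z\<bar> < 1\<close>, hence determined up to a null set.\<close>

definition compensated_integral_from ::
  "real measure \<Rightarrow> real \<Rightarrow> real \<Rightarrow> real \<Rightarrow> (real \<Rightarrow> real) \<Rightarrow> real" where
  "compensated_integral_from \<nu> \<epsilon> s t \<omega> =
     (LINT p:({s<..t} \<times> {z. \<epsilon> \<le> \<bar>z\<bar> \<and> \<bar>z\<bar> < 1})|jump_measure \<omega>. snd p) -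
     (t - s) * (LINT z:{z. \<epsilon> \<le> \<bar>z\<bar> \<and> \<bar>z\<bar> < 1}|\<nu>. z)"

definition is_compensated_integral ::
  "(real \<Rightarrow> real) measure \<Rightarrow> real measure \<Rightarrow> real \<Rightarrow> real \<Rightarrow> ((real \<Rightarrow> real) \<Rightarrow> real) \<Rightarrow> bool" where
  "is_compensated_integral M \<nu> s t J \<longleftrightarrow>
     J \<in> borel_measurable M \<and>
     ((\<lambda>\<epsilon>. \<integral>\<^sup>+\<omega>. ennreal ((compensated_integral_from \<nu> \<epsilon> s t \<omega> - J \<omega>)\<^sup>2) \<partial>M) \<longlongrightarrow> 0) (at_right 0)"

text \<open>\<open>M\<close> is the law of the process on the canonical space. Writing the Levy-Ito representation for
  the increments over all \<open>{s<..t}\<close>, together with \<open>\<omega> 0 = 0\<close>, covers positive and negative times.\<close>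

definition stable_process_law :: "real \<Rightarrow> (real \<Rightarrow> real) measure \<Rightarrow> bool" where
  "stable_process_law \<alpha> M \<longleftrightarrow>
     levy_process_with_measure (stable_levy_measure \<alpha>) M \<and>
     (\<forall>s t. s \<le> t \<longrightarrow> (\<exists>J. is_compensated_integral M (stable_levy_measure \<alpha>) s t J \<and>
        (AE \<omega> in M. \<omega> t - \<omega> s = J \<omega> + big_jump_integral s t \<omega>)))"

definition truncated_stable_process_law :: "real \<Rightarrow> (real \<Rightarrow> real) measure \<Rightarrow> bool" where
  "truncated_stable_process_law \<alpha> M \<longleftrightarrow>
     levy_process_with_measure (truncated_levy_measure \<alpha>) M \<and>
     (\<forall>s t. s \<le> t \<longrightarrow> (\<exists>J. is_compensated_integral M (truncated_levy_measure \<alpha>) s t J \<and>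
        (AE \<omega> in M. \<omega> t - \<omega> s = J \<omega>)))"


section \<open>Random dynamical systems\<close>

definition metric_dynamical_system :: "'w measure \<Rightarrow> (real \<Rightarrow> 'w \<Rightarrow> 'w) \<Rightarrow> bool" where
  "metric_dynamical_system M \<theta> \<longleftrightarrow>
     prob_space M \<and>
     (\<lambda>(t, \<omega>). \<theta> t \<omega>) \<in> borel \<Otimes>\<^sub>M M \<rightarrow>\<^sub>M M \<and>
     (\<forall>\<omega>\<in>space M. \<theta> 0 \<omega> = \<omega>) \<and>
     (\<forall>s t. \<forall>\<omega>\<in>space M. \<theta> (s + t) \<omega> = \<theta> s (\<theta> t \<omega>)) \<and>
     (\<forall>t. distr M M (\<theta> t) = M)"

definition random_dynamical_system ::
  "'w measure \<Rightarrow> (real \<Rightarrow> 'w \<Rightarrow> 'w) \<Rightarrow> (real \<Rightarrow> 'w \<Rightarrow> real \<Rightarrow> real) \<Rightarrow> bool" where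
  "random_dynamical_system M \<theta> \<phi> \<longleftrightarrow>
     metric_dynamical_system M \<theta> \<and>
     (\<lambda>(t, \<omega>, x). \<phi> t \<omega> x) \<in> borel_measurable (restrict_space borel {0..} \<Otimes>\<^sub>M M \<Otimes>\<^sub>M borel) \<and>
     (\<forall>\<omega>\<in>space M. \<forall>x. \<phi> 0 \<omega> x = x) \<and>
     (\<forall>s\<ge>0. \<forall>t\<ge>0. \<forall>\<omega>\<in>space M. \<forall>x. \<phi> (t + s) \<omega> x = \<phi> t (\<theta> s \<omega>) (\<phi> s \<omega> x))"

text \<open>Pathwise meaning of \<open>dX = f X dt + \<sigma> d\<omega>\<close>, \<open>X 0 = x\<close>: the noise is additive, so that no
  stochastic integral is needed. For continuous \<open>f\<close> the integrand is bounded on \<open>{0..t}\<close> with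
  countably many discontinuities.\<close>

definition solves_sde ::
  "(real \<Rightarrow> real) \<Rightarrow> real \<Rightarrow> (real \<Rightarrow> real) \<Rightarrow> real \<Rightarrow> (real \<Rightarrow> real) \<Rightarrow> bool" where
  "solves_sde f \<sigma> \<omega> x X \<longleftrightarrow>
     cadlag_on {0..} X \<and> (\<forall>t\<ge>0. X t = x + integral {0..t} (\<lambda>s. f (X s)) + \<sigma> * \<omega> t)"

definition rds_generated_by ::
  "(real \<Rightarrow> real) measure \<Rightarrow> (real \<Rightarrow> real) \<Rightarrow> real \<Rightarrow>
   (real \<Rightarrow> (real \<Rightarrow> real) \<Rightarrow> real \<Rightarrow> real) \<Rightarrow> bool" where
  "rds_generated_by M f \<sigma> \<phi> \<longleftrightarrow>
     random_dynamical_system M path_shift \<phi> \<and>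
     (\<forall>\<omega>\<in>space M. \<forall>x. solves_sde f \<sigma> \<omega> x (\<lambda>t. \<phi> t \<omega> x))"

definition attracting_random_equilibrium ::
  "'w measure \<Rightarrow> (real \<Rightarrow> 'w \<Rightarrow> 'w) \<Rightarrow> (real \<Rightarrow> 'w \<Rightarrow> real \<Rightarrow> real) \<Rightarrow> ('w \<Rightarrow> real) \<Rightarrow> bool" where
  "attracting_random_equilibrium M \<theta> \<phi> a \<longleftrightarrow>
     a \<in> borel_measurable M \<and>
     (AE \<omega> in M.
        (\<forall>t\<ge>0. \<phi> t \<omega> (a \<omega>) = a (\<theta> t \<omega>)) \<and>
        (\<forall>B. bounded B \<longrightarrow>
           ((\<lambda>t. SUP x\<in>B. ennreal \<bar>\<phi> t (\<theta> (- t) \<omega>) x - a \<omega>\<bar>) \<longlongrightarrow> 0) at_top))"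

text \<open>The space derivative of the cocycle along \<open>a\<close>, extended to \<open>t < 0\<close> by the cocycle property
  \<open>\<Phi>(t, \<omega>) = \<Phi>(-t, \<theta>\<^sub>t \<omega>)\<^sup>-\<^sup>1\<close> of a linear random dynamical system with two-sided time.\<close>

definition linearization ::
  "(real \<Rightarrow> 'w \<Rightarrow> 'w) \<Rightarrow> (real \<Rightarrow> 'w \<Rightarrow> real \<Rightarrow> real) \<Rightarrow> ('w \<Rightarrow> real) \<Rightarrow> real \<Rightarrow> 'w \<Rightarrow> real" where
  "linearization \<theta> \<phi> a t \<omega> =
     (if 0 \<le> t then deriv (\<phi> t \<omega>) (a \<omega>)
      else inverse (deriv (\<phi> (- t) (\<theta> t \<omega>)) (a (\<theta> t \<omega>))))"


section \<open>Dichotomy spectrum\<close>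

text \<open>For linear random dynamical systems on \<open>\<real>\<close>; \<open>1 \<times> 1\<close> matrices are identified with reals.\<close>

definition invariant_projector ::
  "'w measure \<Rightarrow> (real \<Rightarrow> 'w \<Rightarrow> 'w) \<Rightarrow> (real \<Rightarrow> 'w \<Rightarrow> real) \<Rightarrow> ('w \<Rightarrow> real) \<Rightarrow> bool" where
  "invariant_projector M \<theta> \<Phi> P \<longleftrightarrow>
     P \<in> borel_measurable M \<and>
     (\<forall>\<omega>\<in>space M. P \<omega> = (P \<omega>)\<^sup>2) \<and>
     (\<forall>t. \<forall>\<omega>\<in>space M. P (\<theta> t \<omega>) * \<Phi> t \<omega> = \<Phi> t \<omega> * P \<omega>)"

definition exponential_dichotomy ::
  "'w measure \<Rightarrow> (real \<Rightarrow> 'w \<Rightarrow> 'w) \<Rightarrow> (real \<Rightarrow> 'w \<Rightarrow> real) \<Rightarrow> real \<Rightarrow> bool" where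
  "exponential_dichotomy M \<theta> \<Phi> \<gamma> \<longleftrightarrow>
     (\<exists>\<kappa>>0. \<exists>K\<ge>1. \<exists>P. invariant_projector M \<theta> \<Phi> P \<and>
        (AE \<omega> in M.
           (\<forall>t\<ge>0. norm (\<Phi> t \<omega> * P \<omega>) \<le> K * exp ((\<gamma> - \<kappa>) * t)) \<and>
           (\<forall>t\<le>0. norm (\<Phi> t \<omega> * (1 - P \<omega>)) \<le> K * exp ((\<gamma> + \<kappa>) * t))))"

definition dichotomy_spectrum ::
  "'w measure \<Rightarrow> (real \<Rightarrow> 'w \<Rightarrow> 'w) \<Rightarrow> (real \<Rightarrow> 'w \<Rightarrow> real) \<Rightarrow> real set" where
  "dichotomy_spectrum M \<theta> \<Phi> = {\<gamma>. \<not> exponential_dichotomy M \<theta> \<Phi> \<gamma>}"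

end

theory Submission
  imports Defs
begin

text \<open>Along a solution the linearization is \<open>exp (\<integral> \<beta> - 3 X\<^sup>2)\<close>, so growth rates above \<open>\<beta>\<close> admit a
  dichotomy with trivial projector. For \<open>\<gamma> \<le> \<beta>\<close> an invariant projector is almost surely constant,
  as the shift is ergodic. The projector \<open>1\<close> is excluded because, with positive probability, \<open>a\<close> starts
  near \<open>0\<close> and the noise stays small for as long as we like, so that \<open>X\<close> remains near \<open>0\<close>. The projector
  \<open>0\<close> is excluded because \<open>a\<close> is unbounded and a start far away from \<open>0\<close> makes \<open>\<integral>\<^sub>0\<^sup>1 X\<^sup>2\<close> large.
  Both facts on \<open>a\<close> follow by stationarity: \<open>a\<close> depends on the past of the noise only, and since
  jumps of both signs and of every size in \<open>(0, 1)\<close> occur, the noise can be pushed up or down by a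
  small amount in arbitrarily short time, so that the drift is negligible.\<close>

section \<open>Cadlag functions\<close>

text \<open>The constant \<open>K\<close> of a dichotomy is the same for almost all paths, so one
  event of positive probability at one finite time refutes the bound, whatever the typical long-time
  growth is. The obstacle is to show that \<open>a\<close> comes near 0 and far out with positive
  probability, without a formula for its law: all that is known of the noise is that jumps occur,
  and the duration of a move can be bounded but not prescribed. Both facts are therefore proved by
  contradiction. If \<open>a\<close> were almost surely bounded, or away from 0, then by
  stationarity so would be the whole trajectory from \<open>a\<close>. In the first case the drift
  is bounded; in the second the sign cannot change and the drift away from 0 is bounded. Hence a
  short move shifts the position by a fixed amount with positive probability, and finitely many
  moves give a contradiction. Uniqueness, non-anticipation and the space derivative of the flow all
  come from one formula: additive noise cancels in the difference of two solutions, which is thus an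
  explicit exponential.\<close>

lemma cadlag_onD_right:
  assumes "cadlag_on {0..} f" "0 \<le> t"
  shows "continuous (at t within {t..}) f"
proof -
  have "{0..} \<inter> {t..} = {t..}" using assms(2) by auto
  then show ?thesis using assms unfolding cadlag_on_def by (metis atLeast_iff)
qed

lemma cadlag_on_mono:
  assumes "cadlag_on S f" "T \<subseteq> S"
  shows "cadlag_on T f"
  unfolding cadlag_on_def
proof (intro ballI conjI)
  fix t assume t: "t \<in> T"
  then have c: "continuous (at t within (S \<inter> {t..})) f"
    and l: "\<exists>l. (f \<longlongrightarrow> l) (at t within (S \<inter> {..<t}))"
    using assms unfolding cadlag_on_def by auto
  show "continuous (at t within (T \<inter> {t..})) f"
    using c by (rule continuous_within_subset) (use assms(2) in auto)
  show "\<exists>l. (f \<longlongrightarrow> l) (at t within (T \<inter> {..<t}))"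
    using l by (meson assms(2) Int_mono order_refl tendsto_within_subset)
qed

lemma cadlag_on_const: "cadlag_on T (\<lambda>t. c)"
  by (auto simp: cadlag_on_def)

lemma cadlag_on_add:
  assumes "cadlag_on T f" "cadlag_on T g" shows "cadlag_on T (\<lambda>t. f t + g t)"
  using assms unfolding cadlag_on_def by (blast intro: continuous_add tendsto_add)

lemma cadlag_on_mult:
  assumes "cadlag_on T f" "cadlag_on T g" shows "cadlag_on T (\<lambda>t. f t * g t)"
  using assms unfolding cadlag_on_def by (blast intro: continuous_mult tendsto_mult)

lemma cadlag_on_diff:
  assumes "cadlag_on T f" "cadlag_on T g" shows "cadlag_on T (\<lambda>t. f t - g t)"
  using assms unfolding cadlag_on_def by (blast intro: continuous_diff tendsto_diff)

lemma cadlag_on_power: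
  assumes "cadlag_on T f" shows "cadlag_on T (\<lambda>t. f t ^ n)"
  using assms unfolding cadlag_on_def by (blast intro: continuous_power tendsto_power)

lemmas cadlag_on_intros =
  cadlag_on_const cadlag_on_add cadlag_on_mult cadlag_on_diff cadlag_on_power

text \<open>Near each point the value controls the right side and the left limit the left side;
  \<open>Bolzano\<close> glues these local bounds.\<close>

lemma cadlag_on_bounded:
  assumes f: "cadlag_on {0..} f"
  obtains B where "\<And>t. 0 \<le> t \<Longrightarrow> t \<le> b \<Longrightarrow> \<bar>f t\<bar> \<le> B"
proof (cases "0 \<le> b")
  case True
  \<comment> \<open>The restriction \<open>0 \<le> t\<close> matters because \<open>Bolzano\<close>
    tests \<open>P\<close> also on intervals around 0 that reach negative times, where nothing is
    known about \<open>f\<close>.\<close>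
  define P where "P u v \<longleftrightarrow> (\<exists>B. \<forall>t. 0 \<le> t \<and> u \<le> t \<and> t \<le> v \<longrightarrow> \<bar>f t\<bar> \<le> B)" for u v
  have "P 0 b"
  proof (rule Bolzano[OF True])
    fix u v w assume trans: "P u v" "P v w"
    then obtain B C where "\<forall>t. 0 \<le> t \<and> u \<le> t \<and> t \<le> v \<longrightarrow> \<bar>f t\<bar> \<le> B"
      "\<forall>t. 0 \<le> t \<and> v \<le> t \<and> t \<le> w \<longrightarrow> \<bar>f t\<bar> \<le> C" unfolding P_def by blast
    then have "\<forall>t. 0 \<le> t \<and> u \<le> t \<and> t \<le> w \<longrightarrow> \<bar>f t\<bar> \<le> max B C"
      by (metis linear max.coboundedI1 max.coboundedI2)
    then show "P u w" unfolding P_def by blast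
  next
    fix x assume local: "0 \<le> x" "x \<le> b"
    have c: "(f \<longlongrightarrow> f x) (at x within {x..})"
      using cadlag_onD_right[OF f, of x] local by (simp add: continuous_within)
    obtain l where l: "(f \<longlongrightarrow> l) (at x within ({0..} \<inter> {..<x}))"
      using f local unfolding cadlag_on_def by auto
    obtain d1 where d1: "d1 > 0" "\<And>t. x \<le> t \<Longrightarrow> t \<noteq> x \<Longrightarrow> dist t x < d1 \<Longrightarrow> dist (f t) (f x) < 1"
      using tendstoD[OF c zero_less_one] unfolding eventually_at by auto
    obtain d2 where d2: "d2 > 0" "\<And>t. 0 \<le> t \<Longrightarrow> t < x \<Longrightarrow> dist t x < d2 \<Longrightarrow> dist (f t) l < 1"
      using tendstoD[OF l zero_less_one] unfolding eventually_at by auto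
    have "P u v" if "u \<le> x" "x \<le> v" "v - u < min d1 d2" for u v
    proof -
      have "\<bar>f t\<bar> \<le> \<bar>f x\<bar> + \<bar>l\<bar> + 1" if "0 \<le> t" "u \<le> t" "t \<le> v" for t
      proof (cases "t < x")
        case True
        then show ?thesis using d2(2)[of t] that \<open>v - u < min d1 d2\<close> \<open>x \<le> v\<close>
          by (auto simp: dist_real_def)
      next
        case False
        then show ?thesis using d1(2)[of t] that \<open>v - u < min d1 d2\<close> \<open>u \<le> x\<close>
          by (cases "t = x") (auto simp: dist_real_def)
      qed
      then show ?thesis unfolding P_def by blast
    qed
    then show "\<exists>d>0. \<forall>u v. u \<le> x \<and> x \<le> v \<and> v - u < d \<longrightarrow> P u v"
      using d1(1) d2(1) by (intro exI[of _ "min d1 d2"]) auto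
  qed
  then show ?thesis using that unfolding P_def by blast
next
  case False
  then show ?thesis using that[of 0] by auto
qed

text \<open>A right-continuous function is the limit of its step functions sampled at the right end
  points of a grid.\<close>

lemma right_continuous_borel_measurable:
  fixes f :: "real \<Rightarrow> real"
  assumes "\<And>t. continuous (at t within {t..}) f"
  shows "f \<in> borel_measurable borel"
proof (rule borel_measurable_LIMSEQ_real)
  define g where "g n t = (of_int \<lfloor>real (Suc n) * t\<rfloor> + 1) / real (Suc n)" for n and t :: real
  show "(\<lambda>t. f (g n t)) \<in> borel_measurable borel" for n
  proof -
    have "(\<lambda>k::int. f ((of_int k + 1) / real (Suc n))) \<in> borel_measurable (count_space UNIV)"
      by simp
    moreover have "(\<lambda>t. \<lfloor>real (Suc n) * t\<rfloor>) \<in> borel \<rightarrow>\<^sub>M count_space UNIV"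
      by measurable
    ultimately show ?thesis
      unfolding g_def using measurable_compose by blast
  qed
  fix t :: real
  have gt: "t \<le> g n t" "g n t \<le> t + 1 / real (Suc n)" for n
  proof -
    have "real (Suc n) * t \<le> of_int \<lfloor>real (Suc n) * t\<rfloor> + 1"
      "of_int \<lfloor>real (Suc n) * t\<rfloor> + 1 \<le> real (Suc n) * t + 1" by linarith+
    then have "real (Suc n) * t / real (Suc n) \<le> g n t"
      "g n t \<le> (real (Suc n) * t + 1) / real (Suc n)"
      unfolding g_def by (intro divide_right_mono; simp)+
    then show "t \<le> g n t" "g n t \<le> t + 1 / real (Suc n)"
      by (simp_all add: add_divide_distrib)
  qed
  have "(\<lambda>n. t + 1 / real (Suc n)) \<longlonglongrightarrow> t"
    using tendsto_add[OF tendsto_const LIMSEQ_Suc[OF lim_inverse_n'], of t] by simp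
  then have lim: "(\<lambda>n. g n t) \<longlonglongrightarrow> t"
    by (rule tendsto_sandwich[OF _ _ tendsto_const, rotated -1]) (use gt in auto)
  show "(\<lambda>n. f (g n t)) \<longlonglongrightarrow> f t"
    using assms[of t] lim gt(1) unfolding continuous_within_sequentially by (auto simp: o_def)
qed

section \<open>Integrals of cadlag functions and their right derivatives\<close>

lemma cadlag_on_integrable:
  assumes f: "cadlag_on {0..} f" and a: "0 \<le> a"
  shows "f integrable_on {a..b}"
proof -
  obtain B where B: "\<And>t. 0 \<le> t \<Longrightarrow> t \<le> b \<Longrightarrow> \<bar>f t\<bar> \<le> B"
    using cadlag_on_bounded[OF f] by blast
  \<comment> \<open>Freezing the value at 0 for negative times gives a function that is
    right-continuous on the whole line, as the measurability lemma demands, and that equals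
    \<open>f\<close> on \<open>{a..b}\<close>.\<close>
  define g where "g t = f (max 0 t)" for t
  have "continuous (at t within {t..}) g" for t
  proof (cases "0 \<le> t")
    case True
    then have "continuous (at t within {t..}) f" using cadlag_onD_right[OF f] by simp
    then show ?thesis
      by (rule continuous_transform_within[where \<delta> = 1]) (use True in \<open>auto simp: g_def\<close>)
  next
    case False
    have "continuous (at t within {t..}) (\<lambda>t. f 0)" by simp
    then show ?thesis
      by (rule continuous_transform_within[where \<delta> = "- t"])
        (use False in \<open>auto simp: g_def dist_real_def max_def\<close>)
  qed
  then have [measurable]: "g \<in> borel_measurable borel" by (rule right_continuous_borel_measurable)
  have "set_integrable lborel {a..b} g"
    unfolding set_integrable_def
  proof (rule integrableI_bounded_set_indicator[where B = B])
    show "emeasure lborel {a..b} < \<infinity>"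
      by (simp add: emeasure_lborel_Icc_eq)
    show "AE x in lborel. x \<in> {a..b} \<longrightarrow> norm (g x) \<le> B"
      using a B by (auto simp: g_def)
  qed auto
  then have "g integrable_on {a..b}" by (rule set_borel_integral_eq_integral)
  then show ?thesis
    by (rule integrable_eq) (use a in \<open>auto simp: g_def\<close>)
qed

lemma cadlag_on_integral_right_derivative:
  assumes f: "cadlag_on {0..} f" and t: "0 \<le> t"
  shows "((\<lambda>x. integral {0..x} f) has_real_derivative f t) (at t within {t..})"
proof -
  have "((\<lambda>x. integral {t..x} f) has_vector_derivative f t) (at t within ({t..t+1} - {}))"
    by (rule integral_has_vector_derivative_continuous_at[OF cadlag_on_integrable[OF f t]])
      (use continuous_within_subset[OF cadlag_onD_right[OF f t]] in auto)
  then have "((\<lambda>x. integral {0..t} f + integral {t..x} f) has_real_derivative f t)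
      (at t within {t..t+1})"
    by (auto simp: has_real_derivative_iff_has_vector_derivative intro!: derivative_eq_intros)
  then have "((\<lambda>x. integral {0..x} f) has_real_derivative f t) (at t within {t..t+1})"
    by (rule has_field_derivative_transform_within[where d = 1])
      (use t in \<open>auto intro!: Henstock_Kurzweil_Integration.integral_combine
        cadlag_on_integrable[OF f]\<close>)
  moreover have "at t within {t..t+1} = at t within {t..}"
    by (rule at_within_nhd[of _ "{..<t+1}"]) auto
  ultimately show ?thesis by simp
qed

lemma cadlag_on_integral_continuous:
  assumes "cadlag_on {0..} f"
  shows "continuous_on {0..T} (\<lambda>x. integral {0..x} f)"
  by (rule indefinite_integral_continuous_1[OF cadlag_on_integrable[OF assms]]) simp

text \<open>Dini: only right derivatives are needed, so that jumps of the integrands do no harm.\<close>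

lemma right_derivative_nonpos_imp_le:
  fixes G :: "real \<Rightarrow> real"
  assumes ab: "a \<le> b" and cont: "continuous_on {a..b} G"
    and der: "\<And>t. a \<le> t \<Longrightarrow> t < b \<Longrightarrow> \<exists>D\<le>0. (G has_real_derivative D) (at t within {t..})"
  shows "G b \<le> G a"
proof (rule field_le_epsilon)
  fix e :: real assume e: "0 < e"
  \<comment> \<open>The slope \<open>k\<close> makes the derivative bound strict; the
    \<open>+ 1\<close> covers \<open>a = b\<close> and still leaves
    \<open>k * (b - a) \<le> e\<close>.\<close>
  define k where "k = e / (b - a + 1)"
  have k: "0 < k" using e ab by (auto simp: k_def)
  \<comment> \<open>Continuity carries the bound up to the supremum \<open>s\<close> of
    \<open>S\<close>, and a right derivative below \<open>k\<close> carries it past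
    \<open>s\<close>; hence \<open>s = b\<close>.\<close>
  define S where "S = {t \<in> {a..b}. \<forall>u\<in>{a..t}. G u - G a \<le> k * (u - a)}"
  have aS: "a \<in> S" using ab by (auto simp: S_def)
  have bdd: "bdd_above S" by (rule bdd_aboveI[of _ b]) (auto simp: S_def)
  define s where "s = Sup S"
  have s: "a \<le> s" "s \<le> b" unfolding s_def
    using aS bdd by (auto intro!: cSup_upper cSup_least simp: S_def)
  have less: "G u - G a \<le> k * (u - a)" if "a \<le> u" and us: "u < s" for u
  proof -
    obtain t where "t \<in> S" "u < t" using us aS unfolding s_def
      using less_cSupD by blast
    then show ?thesis using that by (auto simp: S_def)
  qed
  have ss: "G s - G a \<le> k * (s - a)"
  proof (cases "s = a")
    case False
    then have "a < s" using s by simp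
    have "(G \<longlongrightarrow> G s) (at s within {a..b})"
      using cont s by (auto simp: continuous_on_def)
    then have "(G \<longlongrightarrow> G s) (at s within {a..<s})"
      by (rule tendsto_within_subset) (use s in auto)
    then have l: "((\<lambda>u. k * (u - a) - (G u - G a)) \<longlongrightarrow> k * (s - a) - (G s - G a))
        (at s within {a..<s})" by (intro tendsto_intros)
    have "0 \<le> k * (s - a) - (G s - G a)"
    proof (rule tendsto_lowerbound[OF l])
      show "\<forall>\<^sub>F u in at s within {a..<s}. 0 \<le> k * (u - a) - (G u - G a)"
        unfolding eventually_at using less by (intro exI[of _ 1]) auto
      show "at s within {a..<s} \<noteq> bot"
        using \<open>a < s\<close> by (simp add: at_within_eq_bot_iff)
    qed
    then show ?thesis by simp
  qed simp
  have "s = b"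
  proof (rule ccontr)
    assume "s \<noteq> b"
    then have "s < b" using s by simp
    obtain D where D: "D \<le> 0" "(G has_real_derivative D) (at s within {s..})"
      using der[OF s(1) \<open>s < b\<close>] by blast
    then have "((\<lambda>y. (G y - G s) / (y - s)) \<longlongrightarrow> D) (at s within {s..})"
      by (simp add: has_field_derivative_iff)
    then have "\<forall>\<^sub>F y in at s within {s..}. (G y - G s) / (y - s) < k"
      by (rule order_tendstoD) (use D k in auto)
    then obtain d where "d > 0" and d:
      "\<And>y. y \<ge> s \<Longrightarrow> y \<noteq> s \<Longrightarrow> dist y s < d \<Longrightarrow> (G y - G s) / (y - s) < k"
      unfolding eventually_at by auto
    define t where "t = min b (s + d / 2)"
    have t: "s < t" "t \<le> b" using \<open>d > 0\<close> \<open>s < b\<close> by (auto simp: t_def)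
    have "G u - G a \<le> k * (u - a)" if "a \<le> u" "u \<le> t" for u
    proof -
      consider "u < s" | "u = s" | "s < u" by linarith
      then show ?thesis
      proof cases
        case 3
        then have "(G u - G s) / (u - s) < k"
          using d[of u] \<open>d > 0\<close> \<open>u \<le> t\<close> by (auto simp: t_def dist_real_def)
        then have "G u - G s < k * (u - s)" using 3 by (simp add: field_simps)
        then show ?thesis using ss by (simp add: algebra_simps)
      qed (use less ss that in auto)
    qed
    then have "t \<in> S" using t s by (auto simp: S_def)
    then have "t \<le> s" unfolding s_def using bdd by (rule cSup_upper)
    then show False using t by simp
  qed
  then have "G b - G a \<le> k * (b - a)" using ss by simp
  also have "\<dots> \<le> e" using e ab by (auto simp: k_def field_simps)
  finally show "G b \<le> G a + e" by simp
qed

lemma right_derivative_zero_imp_eq: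
  fixes G :: "real \<Rightarrow> real"
  assumes "a \<le> b" "continuous_on {a..b} G"
    and der: "\<And>t. a \<le> t \<Longrightarrow> t < b \<Longrightarrow> (G has_real_derivative 0) (at t within {t..})"
  shows "G b = G a"
proof (rule antisym)
  show "G b \<le> G a"
    by (rule right_derivative_nonpos_imp_le) (use assms in auto)
  have "- G b \<le> - G a"
    by (rule right_derivative_nonpos_imp_le[OF assms(1)])
      (use assms(2) der in \<open>auto intro!: continuous_intros exI[of _ 0] derivative_eq_intros\<close>)
  then show "G a \<le> G b" by simp
qed

section \<open>The cubic equation with additive noise\<close>

lemma solves_sde_cadlag: "solves_sde f \<sigma> \<omega> x X \<Longrightarrow> cadlag_on {0..} X"
  by (simp add: solves_sde_def)

lemma solves_sde_eq:
  "solves_sde f \<sigma> \<omega> x X \<Longrightarrow> 0 \<le> t \<Longrightarrow> X t = x + integral {0..t} (\<lambda>s. f (X s)) + \<sigma> * \<omega> t"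
  by (simp add: solves_sde_def)

text \<open>The noise cancels in \<open>X - Y\<close>, and factoring \<open>x - y\<close> out of the
  difference of cubes turns the drift into a linear rate. With the integrating factor the product
  has right derivative 0. Two paths agreeing up to \<open>T\<close> are allowed, so that the case
  \<open>x = y\<close> yields both uniqueness and non-anticipation.\<close>

lemma cubic_sde_difference:
  fixes X Y :: "real \<Rightarrow> real" and \<beta> \<sigma> :: real
  assumes X: "solves_sde (\<lambda>x. \<beta> * x - x ^ 3) \<sigma> \<omega> x X"
    and Y: "solves_sde (\<lambda>x. \<beta> * x - x ^ 3) \<sigma> \<omega>' y Y"
    and eq: "\<And>t. 0 \<le> t \<Longrightarrow> t \<le> T \<Longrightarrow> \<omega> t = \<omega>' t" and T: "0 \<le> T"
  shows "X T - Y T = (x - y) * exp (integral {0..T} (\<lambda>s. \<beta> - ((X s)\<^sup>2 + X s * Y s + (Y s)\<^sup>2)))"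
proof -
  note [intro] = solves_sde_cadlag[OF X] solves_sde_cadlag[OF Y]
  define f where "f x = \<beta> * x - x ^ 3" for x
  define k where "k s = f (X s) - f (Y s)" for s
  define c where "c s = \<beta> - ((X s)\<^sup>2 + X s * Y s + (Y s)\<^sup>2)" for s
  have fX: "cadlag_on {0..} (\<lambda>s. f (X s))" and fY: "cadlag_on {0..} (\<lambda>s. f (Y s))"
    unfolding f_def by (intro cadlag_on_intros; blast)+
  have kc: "cadlag_on {0..} k" unfolding k_def by (intro cadlag_on_intros fX fY)
  have cc: "cadlag_on {0..} c" unfolding c_def by (intro cadlag_on_intros; blast)
  define D where "D t = (x - y) + integral {0..t} k" for t
  define E where "E t = exp (- integral {0..t} c)" for t
  have D: "X t - Y t = D t" if "0 \<le> t" "t \<le> T" for t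
    using solves_sde_eq[OF X \<open>0 \<le> t\<close>] solves_sde_eq[OF Y \<open>0 \<le> t\<close>] eq[OF that]
      cadlag_on_integrable[OF fX, of 0 t] cadlag_on_integrable[OF fY, of 0 t]
    unfolding D_def k_def
    by (simp add: Henstock_Kurzweil_Integration.integral_diff flip: f_def)
  have "D T * E T = D 0 * E 0"
  proof (rule right_derivative_zero_imp_eq[OF T])
    show "continuous_on {0..T} (\<lambda>t. D t * E t)"
      unfolding D_def E_def
      by (intro continuous_intros cadlag_on_integral_continuous kc cc)
    fix t assume t: "0 \<le> t" "t < T"
    have "(D has_real_derivative k t) (at t within {t..})"
      unfolding D_def
      by (auto intro!: derivative_eq_intros cadlag_on_integral_right_derivative[OF kc t(1)])
    moreover have "(E has_real_derivative (E t * - c t)) (at t within {t..})"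
      unfolding E_def
      by (auto intro!: derivative_eq_intros cadlag_on_integral_right_derivative[OF cc t(1)])
    ultimately have "((\<lambda>t. D t * E t) has_real_derivative (D t * (E t * - c t) + k t * E t))
        (at t within {t..})"
      by (rule DERIV_mult')
    moreover have "k t = D t * c t"
      using D[of t] t unfolding k_def c_def f_def
      by (simp flip: D) (simp add: algebra_simps power2_eq_square power3_eq_cube)
    ultimately show "((\<lambda>t. D t * E t) has_real_derivative 0) (at t within {t..})"
      by (simp add: algebra_simps)
  qed
  then have "D T = (x - y) * exp (integral {0..T} c)"
    unfolding E_def by (simp add: D_def[of 0] exp_minus field_simps)
  then show ?thesis using D[of T] T unfolding c_def by simp
qed

section \<open>Dependence of solutions on the starting point\<close>

lemma square_sum_ge_zero: "0 \<le> (x::real)\<^sup>2 + x * y + y\<^sup>2"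
proof -
  have "x\<^sup>2 + x * y + y\<^sup>2 = (x + y / 2)\<^sup>2 + 3 / 4 * y\<^sup>2"
    by (simp add: power2_eq_square algebra_simps)
  then show ?thesis by simp
qed

text \<open>The quadratic part of the rate in \<open>cubic_sde_difference\<close> only contracts,
  which leaves \<open>\<beta>\<close>. This is the a priori continuity needed to differentiate the
  flow.\<close>

lemma cubic_sde_lipschitz:
  assumes X: "solves_sde (\<lambda>x. \<beta> * x - x ^ 3) \<sigma> \<omega> x X"
    and Y: "solves_sde (\<lambda>x. \<beta> * x - x ^ 3) \<sigma> \<omega> y Y" and T: "0 \<le> T"
  shows "\<bar>X T - Y T\<bar> \<le> \<bar>x - y\<bar> * exp (\<bar>\<beta>\<bar> * T)"
proof -
  note [intro] = solves_sde_cadlag[OF X] solves_sde_cadlag[OF Y]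
  define c where "c s = \<beta> - ((X s)\<^sup>2 + X s * Y s + (Y s)\<^sup>2)" for s
  have cc: "cadlag_on {0..} c" unfolding c_def by (intro cadlag_on_intros; blast)
  have "integral {0..T} c \<le> integral {0..T} (\<lambda>s. \<bar>\<beta>\<bar>)"
  proof (rule integral_le)
    show "c s \<le> \<bar>\<beta>\<bar>" for s
      unfolding c_def using square_sum_ge_zero[of "X s" "Y s"] by linarith
  qed (intro cadlag_on_integrable cc cadlag_on_const; simp)+
  also have "\<dots> = \<bar>\<beta>\<bar> * T" using T by simp
  finally show ?thesis
    using cubic_sde_difference[OF X Y refl T] unfolding c_def
    by (simp add: abs_mult mult_left_mono)
qed

text \<open>The difference quotient is itself the exponential of an integral, by
  \<open>cubic_sde_difference\<close>, so no variational equation has to be solved; it remains to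
  let \<open>y\<close> tend to \<open>x\<close> in the exponent.\<close>

lemma cubic_flow_has_derivative:
  fixes F :: "real \<Rightarrow> real \<Rightarrow> real"
  assumes sol: "\<And>x. solves_sde (\<lambda>x. \<beta> * x - x ^ 3) \<sigma> \<omega> x (\<lambda>t. F t x)" and T: "0 \<le> T"
  shows "(F T has_real_derivative exp (integral {0..T} (\<lambda>s. \<beta> - 3 * (F s x)\<^sup>2))) (at x)"
proof -
  note [intro] = solves_sde_cadlag[OF sol]
  define c where "c y s = \<beta> - ((F s y)\<^sup>2 + F s y * F s x + (F s x)\<^sup>2)" for y s
  have cc: "cadlag_on {0..} (c y)" for y unfolding c_def by (intro cadlag_on_intros; blast)
  obtain B where B: "\<And>s. 0 \<le> s \<Longrightarrow> s \<le> T \<Longrightarrow> \<bar>F s x\<bar> \<le> B"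
    using cadlag_on_bounded[OF solves_sde_cadlag[OF sol]] by blast
  define E where "E = exp (\<bar>\<beta>\<bar> * T)"
  \<comment> \<open>With \<open>d = F s y - F s x\<close> the integrands differ by
    \<open>- (3 * F s x * d + d\<^sup>2)\<close>; \<open>r\<close> inserts the bounds
    \<open>B\<close> for \<open>F s x\<close> and \<open>E * \<bar>y - x\<bar>\<close> for
    \<open>d\<close>.\<close>
  define r where "r y = T * (3 * B * (E * \<bar>y - x\<bar>) + (E * \<bar>y - x\<bar>)\<^sup>2)" for y
  have bound: "\<bar>integral {0..T} (c y) - integral {0..T} (c x)\<bar> \<le> r y" for y
  proof -
    have "\<bar>c y s - c x s\<bar> \<le> 3 * B * (E * \<bar>y - x\<bar>) + (E * \<bar>y - x\<bar>)\<^sup>2" if s: "s \<in> {0..T}" for s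
    proof -
      define d where "d = F s y - F s x"
      have "\<bar>d\<bar> \<le> \<bar>y - x\<bar> * exp (\<bar>\<beta>\<bar> * s)"
        unfolding d_def using cubic_sde_lipschitz[OF sol sol] s by simp
      also have "\<dots> \<le> \<bar>y - x\<bar> * E"
        unfolding E_def using s by (intro mult_left_mono) (auto intro: mult_left_mono)
      finally have d: "\<bar>d\<bar> \<le> E * \<bar>y - x\<bar>" by (simp add: mult.commute)
      have "c y s - c x s = - (3 * F s x * d + d\<^sup>2)"
        unfolding c_def d_def by (simp add: power2_eq_square algebra_simps)
      then have "\<bar>c y s - c x s\<bar> \<le> 3 * \<bar>F s x\<bar> * \<bar>d\<bar> + \<bar>d\<bar>\<^sup>2"
        using abs_triangle_ineq[of "3 * F s x * d" "d\<^sup>2"] by (simp add: abs_mult)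
      also have "\<dots> \<le> 3 * B * (E * \<bar>y - x\<bar>) + (E * \<bar>y - x\<bar>)\<^sup>2"
        using B[of s] s d
        by (intro add_mono mult_mono power_mono) auto
      finally show ?thesis .
    qed
    then have "norm (integral {0..T} (\<lambda>s. c y s - c x s)) \<le>
        integral {0..T} (\<lambda>s. 3 * B * (E * \<bar>y - x\<bar>) + (E * \<bar>y - x\<bar>)\<^sup>2)"
      by (intro integral_norm_bound_integral cadlag_on_integrable cadlag_on_intros cc) auto
    then show ?thesis
      using T cadlag_on_integrable[OF cc, of 0]
      by (simp add: r_def Henstock_Kurzweil_Integration.integral_diff)
  qed
  have "(r \<longlongrightarrow> r x) (at x)"
    unfolding r_def by (intro tendsto_intros)
  then have "(r \<longlongrightarrow> 0) (at x)" by (simp add: r_def)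
  then have "((\<lambda>y. integral {0..T} (c y) - integral {0..T} (c x)) \<longlongrightarrow> 0) (at x)"
    by (rule Lim_null_comparison[rotated]) (use bound in auto)
  then have "((\<lambda>y. integral {0..T} (c y)) \<longlongrightarrow> integral {0..T} (c x)) (at x)"
    by (simp add: LIM_zero_iff)
  then have lim: "((\<lambda>y. exp (integral {0..T} (c y))) \<longlongrightarrow> exp (integral {0..T} (c x))) (at x)"
    by (intro tendsto_intros)
  have "((\<lambda>y. (F T y - F T x) / (y - x)) \<longlongrightarrow> exp (integral {0..T} (c x))) (at x)"
  proof (rule Lim_transform_eventually[OF lim])
    show "\<forall>\<^sub>F y in at x. exp (integral {0..T} (c y)) = (F T y - F T x) / (y - x)"
      using cubic_sde_difference[OF sol sol refl T, of _ x]
      by (auto simp: eventually_at_filter c_def[abs_def])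
  qed
  moreover have "c x = (\<lambda>s. \<beta> - 3 * (F s x)\<^sup>2)"
    by (auto simp: c_def power2_eq_square)
  ultimately show ?thesis by (simp add: has_field_derivative_iff)
qed

text \<open>In the application \<open>Y\<close> is the solution minus the noise, and the left side
  is the derivative of its square. The dissipative term \<open>- 2 * X ^ 4\<close> absorbs the mixed
  term \<open>2 * (n * X ^ 3)\<close> up to \<open>2 * n ^ 4\<close>, so no power of
  \<open>X\<close> is left. The constant collects \<open>2 * \<bar>\<beta>\<bar>\<close> and
  \<open>\<bar>\<beta>\<bar>\<close> from the linear part and 2 from \<open>n ^ 4\<close>.\<close>

lemma cubic_energy_inequality:
  fixes X Y \<epsilon> :: real
  assumes "\<bar>X - Y\<bar> \<le> \<epsilon>" "\<epsilon> \<le> 1"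
  shows "2 * Y * (\<beta> * X - X ^ 3) \<le> (3 * \<bar>\<beta>\<bar> + 2) * (Y\<^sup>2 + \<epsilon>\<^sup>2)"
proof -
  define n where "n = X - Y"
  have n: "\<bar>n\<bar> \<le> \<epsilon>" using assms by (simp add: n_def)
  have n1: "n\<^sup>2 \<le> 1" using n assms(2) by (simp add: abs_square_le_1)
  have X: "X = Y + n" by (simp add: n_def)
  have n2: "n\<^sup>2 \<le> \<epsilon>\<^sup>2" using power_mono[OF n abs_ge_zero, of 2] by simp
  have n4: "n ^ 4 \<le> \<epsilon>\<^sup>2"
  proof -
    have "n ^ 4 = n\<^sup>2 * n\<^sup>2" by (simp flip: power_add)
    also have "\<dots> \<le> \<epsilon>\<^sup>2 * 1"
      using n1 n2 by (intro mult_mono) auto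
    finally show ?thesis by simp
  qed
  have cub: "n * X ^ 3 \<le> X ^ 4 + n ^ 4"
  proof -
    have "n * X ^ 3 \<le> \<bar>n\<bar> * \<bar>X\<bar> ^ 3" by (metis abs_ge_self abs_mult power_abs)
    also have "\<dots> \<le> max \<bar>n\<bar> \<bar>X\<bar> * max \<bar>n\<bar> \<bar>X\<bar> ^ 3" by (intro mult_mono power_mono) auto
    also have "\<dots> = max \<bar>n\<bar> \<bar>X\<bar> ^ 4" by (simp flip: power_Suc)
    also have "\<dots> \<le> \<bar>X\<bar> ^ 4 + \<bar>n\<bar> ^ 4" by (cases "\<bar>n\<bar> \<le> \<bar>X\<bar>") (auto simp: max_def)
    finally show ?thesis by simp
  qed
  have "2 * Y * (\<beta> * X - X ^ 3) = 2 * \<beta> * Y\<^sup>2 + \<beta> * (2 * Y * n) - 2 * X ^ 4 + 2 * (n * X ^ 3)"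
    unfolding n_def by (simp add: algebra_simps power2_eq_square power3_eq_cube power4_eq_xxxx)
  also have "\<dots> \<le> 2 * \<beta> * Y\<^sup>2 + \<beta> * (2 * Y * n) + 2 * n ^ 4" using cub by simp
  also have "\<dots> \<le> 2 * \<bar>\<beta>\<bar> * Y\<^sup>2 + \<bar>\<beta>\<bar> * (Y\<^sup>2 + n\<^sup>2) + 2 * n ^ 4"
  proof -
    have "\<bar>2 * Y * n\<bar> \<le> Y\<^sup>2 + n\<^sup>2"
      using sum_squares_bound[of Y n] sum_squares_bound[of Y "-n"] by (simp add: abs_le_iff)
    then have "\<bar>\<beta>\<bar> * \<bar>2 * Y * n\<bar> \<le> \<bar>\<beta>\<bar> * (Y\<^sup>2 + n\<^sup>2)" by (intro mult_left_mono) auto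
    moreover have "\<beta> * (2 * Y * n) \<le> \<bar>\<beta>\<bar> * \<bar>2 * Y * n\<bar>" by (metis abs_ge_self abs_mult)
    moreover have "2 * \<beta> * Y\<^sup>2 \<le> 2 * \<bar>\<beta>\<bar> * Y\<^sup>2" by (intro mult_right_mono) auto
    ultimately show ?thesis by linarith
  qed
  also have "\<dots> \<le> 3 * \<bar>\<beta>\<bar> * Y\<^sup>2 + \<bar>\<beta>\<bar> * \<epsilon>\<^sup>2 + 2 * \<epsilon>\<^sup>2"
    using mult_left_mono[OF n2, of "\<bar>\<beta>\<bar>"] n4 by (simp add: algebra_simps)
  also have "\<dots> \<le> (3 * \<bar>\<beta>\<bar> + 2) * (Y\<^sup>2 + \<epsilon>\<^sup>2)"
    by (simp add: algebra_simps)
  finally show ?thesis .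
qed

text \<open>Gronwall for the square of the continuous part \<open>Y\<close>, from which
  \<open>X\<close> differs by the small noise. Starting energy and correction give
  \<open>2 * \<epsilon>\<^sup>2\<close>; passing from \<open>Y\<close> to \<open>X\<close> doubles
  this and adds \<open>2 * \<epsilon>\<^sup>2\<close>.\<close>

lemma cubic_sde_small:
  assumes X: "solves_sde (\<lambda>x. \<beta> * x - x ^ 3) \<sigma> \<omega> x X"
    and x: "\<bar>x\<bar> \<le> \<epsilon>" and \<omega>: "\<And>t. 0 \<le> t \<Longrightarrow> t \<le> T \<Longrightarrow> \<bar>\<sigma> * \<omega> t\<bar> \<le> \<epsilon>" and \<epsilon>: "\<epsilon> \<le> 1"
    and t: "0 \<le> t" "t \<le> T"
  shows "(X t)\<^sup>2 \<le> (4 * exp ((3 * \<bar>\<beta>\<bar> + 2) * T) + 2) * \<epsilon>\<^sup>2"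
proof -
  define L where "L = 3 * \<bar>\<beta>\<bar> + 2"
  define f where "f s = \<beta> * X s - X s ^ 3" for s
  have fc: "cadlag_on {0..} f"
    unfolding f_def using solves_sde_cadlag[OF X] by (intro cadlag_on_intros)
  define Y where "Y s = x + integral {0..s} f" for s
  have XY: "X s = Y s + \<sigma> * \<omega> s" if "0 \<le> s" for s
    using solves_sde_eq[OF X that] by (simp add: Y_def f_def[abs_def])
  \<comment> \<open>Adding \<open>\<epsilon>\<^sup>2\<close> to the energy makes the differential
    inequality homogeneous, so the exponentially discounted sum cannot grow.\<close>
  define G where "G s = exp (- L * s) * ((Y s)\<^sup>2 + \<epsilon>\<^sup>2)" for s
  have "G t \<le> G 0"
  proof (rule right_derivative_nonpos_imp_le[OF t(1)])
    show "continuous_on {0..t} G"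
      unfolding G_def Y_def by (intro continuous_intros cadlag_on_integral_continuous fc)
    fix s assume s: "0 \<le> s" "s < t"
    have Y': "(Y has_real_derivative f s) (at s within {s..})"
      unfolding Y_def
      by (auto intro!: derivative_eq_intros cadlag_on_integral_right_derivative[OF fc s(1)])
    have "(G has_real_derivative exp (- L * s) * (2 * Y s * f s - L * ((Y s)\<^sup>2 + \<epsilon>\<^sup>2)))
        (at s within {s..})"
      unfolding G_def
      by (auto intro!: derivative_eq_intros Y' simp: algebra_simps)
    moreover have "2 * Y s * f s \<le> L * ((Y s)\<^sup>2 + \<epsilon>\<^sup>2)"
      unfolding L_def f_def
      by (rule cubic_energy_inequality) (use XY[OF s(1)] \<omega>[of s] s t \<epsilon> in auto)
    ultimately show "\<exists>D\<le>0. (G has_real_derivative D) (at s within {s..})"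
      by (intro exI[of _ "exp (- L * s) * (2 * Y s * f s - L * ((Y s)\<^sup>2 + \<epsilon>\<^sup>2))"])
        (simp add: mult_nonneg_nonpos)
  qed
  then have "(Y t)\<^sup>2 + \<epsilon>\<^sup>2 \<le> exp (L * t) * (x\<^sup>2 + \<epsilon>\<^sup>2)"
    by (simp add: G_def Y_def exp_minus field_simps)
  also have "\<dots> \<le> exp (L * T) * (\<epsilon>\<^sup>2 + \<epsilon>\<^sup>2)"
    using x t by (intro mult_mono add_mono) (auto simp: L_def abs_le_square_iff intro!: mult_left_mono power2_le_iff_abs_le[THEN iffD2])
  finally have Y: "(Y t)\<^sup>2 \<le> 2 * exp (L * T) * \<epsilon>\<^sup>2" by (simp add: algebra_simps)
      (smt (verit) zero_le_power2)
  have n: "(\<sigma> * \<omega> t)\<^sup>2 \<le> \<epsilon>\<^sup>2"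
    using \<omega>[OF t] by (metis abs_ge_zero power2_abs power_mono)
  have "(X t)\<^sup>2 \<le> 2 * (Y t)\<^sup>2 + 2 * (\<sigma> * \<omega> t)\<^sup>2"
    using XY[OF t(1)] sum_squares_bound[of "Y t" "\<sigma> * \<omega> t"] by (simp add: power2_sum)
  also have "\<dots> \<le> (4 * exp (L * T) + 2) * \<epsilon>\<^sup>2"
    using Y n by (simp add: algebra_simps)
  finally show ?thesis unfolding L_def .
qed

text \<open>The difference to the solution started at \<open>0\<close> shrinks at most by a factor controlled by the
  energy \<open>\<integral> X\<^sup>2\<close>, so a far away start cannot have small energy.\<close>

lemma cubic_sde_large_energy:
  fixes \<beta> \<sigma> C m :: real
  assumes C: "0 \<le> C"
  obtains R where "\<And>\<omega> x X X0. solves_sde (\<lambda>x. \<beta> * x - x ^ 3) \<sigma> \<omega> x X \<Longrightarrow>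
    solves_sde (\<lambda>x. \<beta> * x - x ^ 3) \<sigma> \<omega> 0 X0 \<Longrightarrow>
    (\<And>t. 0 \<le> t \<Longrightarrow> t \<le> 1 \<Longrightarrow> \<bar>X0 t\<bar> \<le> m) \<Longrightarrow> R < \<bar>x\<bar> \<Longrightarrow> C < integral {0..1} (\<lambda>s. (X s)\<^sup>2)"
proof
  \<comment> \<open>If the energy of \<open>X\<close> is at most \<open>C\<close>, then up to time 1
    the distance to the solution from 0 keeps at least the fraction \<open>q\<close> of its initial
    value. The \<open>3 / 2\<close> comes from bounding \<open>X s * X0 s\<close> by half the sum of
    the squares.\<close>
  define q where "q = exp (- \<bar>\<beta>\<bar> - 3 / 2 * (C + m\<^sup>2))"
  fix \<omega> x X X0
  assume X: "solves_sde (\<lambda>x. \<beta> * x - x ^ 3) \<sigma> \<omega> x X"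
    and X0: "solves_sde (\<lambda>x. \<beta> * x - x ^ 3) \<sigma> \<omega> 0 X0"
    and m: "\<And>t. 0 \<le> t \<Longrightarrow> t \<le> 1 \<Longrightarrow> \<bar>X0 t\<bar> \<le> m" and x: "(m + sqrt C + 1) / q < \<bar>x\<bar>"
  note [intro] = solves_sde_cadlag[OF X] solves_sde_cadlag[OF X0]
  \<comment> \<open>The threshold for \<open>\<bar>x\<bar>\<close> is chosen such that, under the
    contrary assumption, \<open>\<bar>X t\<bar>\<close> stays above \<open>sqrt C + 1\<close>
    throughout \<open>{0..1}\<close>, whose energy would exceed \<open>C\<close>.\<close>
  show "C < integral {0..1} (\<lambda>s. (X s)\<^sup>2)"
  proof (rule ccontr)
    assume "\<not> C < integral {0..1} (\<lambda>s. (X s)\<^sup>2)"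
    then have XC: "integral {0..1} (\<lambda>s. (X s)\<^sup>2) \<le> C" by simp
    have Xi: "(\<lambda>s. (X s)\<^sup>2) integrable_on {0..t}" for t
      by (intro cadlag_on_integrable cadlag_on_intros; blast)
    have "(sqrt C + 1)\<^sup>2 \<le> (X t)\<^sup>2" if t: "t \<in> {0..1}" for t
    proof -
      define c where "c s = \<beta> - ((X s)\<^sup>2 + X s * X0 s + (X0 s)\<^sup>2)" for s
      have cc: "cadlag_on {0..} c" unfolding c_def by (intro cadlag_on_intros; blast)
      have Xt: "integral {0..t} (\<lambda>s. (X s)\<^sup>2) \<le> C"
        using XC integral_subset_le[of "{0..t}" "{0..1}" "\<lambda>s. (X s)\<^sup>2"] t Xi by auto
      have "- \<bar>\<beta>\<bar> - 3 / 2 * (C + m\<^sup>2) \<le>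
          (- \<bar>\<beta>\<bar> - 3 / 2 * m\<^sup>2) * t - 3 / 2 * integral {0..t} (\<lambda>s. (X s)\<^sup>2)"
      proof -
        define w where "w = \<bar>\<beta>\<bar> + 3 / 2 * m\<^sup>2"
        have "w * t \<le> w" using t by (intro mult_left_le) (auto simp: w_def)
        then have "- w - 3 / 2 * C \<le> - (w * t) - 3 / 2 * integral {0..t} (\<lambda>s. (X s)\<^sup>2)"
          using Xt by linarith
        then show ?thesis by (simp add: w_def algebra_simps add_divide_distrib)
      qed
      also have "\<dots> = integral {0..t} (\<lambda>s. (- \<bar>\<beta>\<bar> - 3 / 2 * m\<^sup>2) - 3 / 2 * (X s)\<^sup>2)"
        using t by (subst Henstock_Kurzweil_Integration.integral_diff)
          (auto intro!: integrable_on_mult_right Xi)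
      also have "\<dots> \<le> integral {0..t} c"
      proof (rule integral_le)
        fix s assume s: "s \<in> {0..t}"
        have "(X0 s)\<^sup>2 \<le> m\<^sup>2" using m[of s] s t by (metis abs_ge_zero atLeastAtMost_iff order_trans power2_abs power_mono)
        then show "(- \<bar>\<beta>\<bar> - 3 / 2 * m\<^sup>2) - 3 / 2 * (X s)\<^sup>2 \<le> c s"
          using sum_squares_bound[of "X s" "X0 s"] by (simp add: c_def)
      qed (intro cadlag_on_integrable cadlag_on_intros cc; blast)+
      finally have "q \<le> exp (integral {0..t} c)" by (simp add: q_def)
      then have "\<bar>x\<bar> * q \<le> \<bar>x\<bar> * exp (integral {0..t} c)" by (intro mult_left_mono) auto
      also have "\<dots> = \<bar>X t - X0 t\<bar>"
        using cubic_sde_difference[OF X X0 refl, of t] t by (simp add: c_def[abs_def] abs_mult)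
      also have "\<dots> \<le> \<bar>X t\<bar> + m" using m[of t] t by auto
      finally have "m + sqrt C + 1 < \<bar>X t\<bar> + m"
        using x by (simp add: q_def field_simps)
      then have "sqrt C + 1 \<le> \<bar>X t\<bar>" by simp
      then show ?thesis by (metis C abs_ge_zero add_increasing2 power2_abs power_mono real_sqrt_ge_zero zero_le_one)
    qed
    note energy = this
    have "integral {0..1::real} (\<lambda>s. (sqrt C + 1)\<^sup>2) \<le> integral {0..1} (\<lambda>s. (X s)\<^sup>2)"
      by (rule integral_le) (use energy Xi in auto)
    moreover have "C < (sqrt C + 1)\<^sup>2" using C by (simp add: power2_sum add_pos_nonneg)
    ultimately show False using XC by simp
  qed
qed

text \<open>While the trajectory stays in \<open>{-R..R}\<close>, the drift costs at most
  \<open>\<eta>\<close>, half of what the noise gains. The sign \<open>s\<close> treats both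
  directions at once.\<close>

lemma cubic_sde_step_up:
  fixes s :: real
  assumes X: "solves_sde (\<lambda>x. \<beta> * x - x ^ 3) \<sigma> \<omega> x X" and s: "\<bar>s\<bar> = 1" and h: "0 \<le> h"
    and R: "\<And>t. 0 \<le> t \<Longrightarrow> t \<le> h \<Longrightarrow> \<bar>X t\<bar> \<le> R"
    and hR: "(\<bar>\<beta>\<bar> * R + R ^ 3) * h \<le> \<eta>" and up: "2 * \<eta> \<le> s * (\<sigma> * \<omega> h)"
  shows "s * x + \<eta> \<le> s * X h"
proof -
  define f where "f u = \<beta> * X u - X u ^ 3" for u
  have fc: "cadlag_on {0..} f"
    unfolding f_def using solves_sde_cadlag[OF X] by (intro cadlag_on_intros)
  have "norm (integral {0..h} f) \<le> integral {0..h} (\<lambda>u. \<bar>\<beta>\<bar> * R + R ^ 3)"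
  proof (rule integral_norm_bound_integral)
    fix u assume u: "u \<in> {0..h}"
    have "\<bar>\<beta> * X u\<bar> \<le> \<bar>\<beta>\<bar> * R" "\<bar>X u ^ 3\<bar> \<le> R ^ 3"
      using R[of u] u by (auto simp: abs_mult power_abs intro!: mult_left_mono power_mono)
    then show "norm (f u) \<le> \<bar>\<beta>\<bar> * R + R ^ 3"
      unfolding f_def real_norm_def by linarith
  qed (intro cadlag_on_integrable fc cadlag_on_const; simp)+
  then have "\<bar>s * integral {0..h} f\<bar> \<le> \<eta>" using hR h s by (simp add: abs_mult algebra_simps)
  moreover have "s * X h = s * x + s * integral {0..h} f + s * (\<sigma> * \<omega> h)"
    using solves_sde_eq[OF X h] by (simp add: f_def[abs_def] algebra_simps)
  ultimately show ?thesis using up by linarith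
qed

text \<open>A trajectory avoiding the gap around 0 cannot jump over it with small noise, so it keeps
  its sign. On one side of 0 the drift away from 0 has an absolute upper bound, because the cube
  points inwards; hence no bound on \<open>X\<close> enters the step length.\<close>

lemma cubic_sde_step_down:
  fixes s :: real
  assumes X: "solves_sde (\<lambda>x. \<beta> * x - x ^ 3) \<sigma> \<omega> x X" and s: "\<bar>s\<bar> = 1" and h: "0 \<le> h"
    and away: "\<And>t. 0 \<le> t \<Longrightarrow> t \<le> h \<Longrightarrow> \<epsilon> \<le> \<bar>X t\<bar>"
    and small: "\<And>t. 0 \<le> t \<Longrightarrow> t \<le> h \<Longrightarrow> 2 * \<bar>\<sigma> * \<omega> t\<bar> \<le> \<epsilon>" and \<epsilon>: "0 < \<epsilon>"
    and x: "0 < s * X 0"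
    and hC: "\<bar>\<beta>\<bar> * (1 + \<bar>\<beta>\<bar>) * h \<le> \<eta>" and down: "s * (\<sigma> * \<omega> h) \<le> - 2 * \<eta>"
  shows "0 < s * X h" "s * X h \<le> s * x - \<eta>"
proof -
  define f where "f u = \<beta> * X u - X u ^ 3" for u
  have fc: "cadlag_on {0..} f"
    unfolding f_def using solves_sde_cadlag[OF X] by (intro cadlag_on_intros)
  obtain B where B: "\<And>t. 0 \<le> t \<Longrightarrow> t \<le> h \<Longrightarrow> \<bar>f t\<bar> \<le> B"
    using cadlag_on_bounded[OF fc] by blast
  have B0: "0 \<le> B" using B[of 0] h by simp
  \<comment> \<open>Within time \<open>d\<close> the drift changes \<open>X\<close> by less than
    \<open>\<epsilon>\<close> and the noise by at most \<open>\<epsilon>\<close>, while a change of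
    sign across the gap needs \<open>2 * \<epsilon>\<close>.\<close>
  define d where "d = \<epsilon> / (B + 1)"
  have d: "0 < d" using \<epsilon> B0 by (simp add: d_def)
  have pos: "0 < s * X b" if ab: "0 \<le> a" "a \<le> b" "b \<le> h" "b - a < d" and a: "0 < s * X a" for a b
  proof -
    have "X b - X a = integral {a..b} f + \<sigma> * \<omega> b - \<sigma> * \<omega> a"
      using solves_sde_eq[OF X, of a] solves_sde_eq[OF X, of b] ab
        Henstock_Kurzweil_Integration.integral_combine[OF ab(1,2) cadlag_on_integrable[OF fc order_refl]]
      by (simp add: f_def[abs_def])
    moreover have "norm (integral {a..b} f) \<le> integral {a..b} (\<lambda>u. B)"
      by (rule integral_norm_bound_integral)
        (use ab B in \<open>auto intro!: cadlag_on_integrable fc cadlag_on_const\<close>)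
    moreover have "integral {a..b} (\<lambda>u. B) < \<epsilon>"
    proof -
      have "integral {a..b} (\<lambda>u. B) \<le> (b - a) * (B + 1)" using ab by (simp add: algebra_simps)
      also have "\<dots> < d * (B + 1)" using ab B0 by (intro mult_strict_right_mono) auto
      finally show ?thesis using B0 by (simp add: d_def)
    qed
    ultimately have "\<bar>X b - X a\<bar> < 2 * \<epsilon>"
      using small[of a] small[of b] ab by (simp add: abs_le_iff abs_less_iff) linarith
    then have "\<bar>s * X b - s * X a\<bar> < 2 * \<epsilon>" using s by (simp add: abs_mult flip: right_diff_distrib)
    moreover have "\<epsilon> \<le> \<bar>s * X b\<bar>" "\<epsilon> \<le> \<bar>s * X a\<bar>" using away[of a] away[of b] ab s by (auto simp: abs_mult)
    ultimately show ?thesis using a by linarith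
  qed
  have all: "0 < s * X t" if t: "0 \<le> t" "t \<le> h" for t
  proof -
    \<comment> \<open>The bounds on \<open>a\<close> and \<open>b\<close> are premises inside
      \<open>P\<close>, so that \<open>P\<close> holds trivially on the intervals outside
      \<open>{0..h}\<close> that \<open>Bolzano\<close> also tests.\<close>
    define P where "P a b \<longleftrightarrow> (0 \<le> a \<and> a \<le> b \<and> b \<le> h \<and> 0 < s * X a \<longrightarrow> 0 < s * X b)" for a b
    have "P 0 t"
    proof (rule Bolzano[OF t(1)])
      fix u v w assume "P u v" "P v w" "u \<le> v" "v \<le> w"
      then show "P u w" by (auto simp: P_def)
    next
      fix u
      show "\<exists>d>0. \<forall>a b. a \<le> u \<and> u \<le> b \<and> b - a < d \<longrightarrow> P a b"
        using d pos unfolding P_def by blast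
    qed
    then show ?thesis using t x by (simp add: P_def)
  qed
  then show "0 < s * X h" using h by simp
  have "integral {0..h} (\<lambda>u. s * f u) \<le> integral {0..h} (\<lambda>u. \<bar>\<beta>\<bar> * (1 + \<bar>\<beta>\<bar>))"
  proof (rule integral_le)
    fix u assume u: "u \<in> {0..h}"
    define y where "y = s * X u"
    have y: "0 < y" using all u by (simp add: y_def)
    have "s\<^sup>2 = 1" using s by (metis power2_abs one_power2)
    then have s3: "s ^ 3 = s" by (simp add: power3_eq_cube power2_eq_square)
    have "s * f u = \<beta> * y - y ^ 3"
      by (simp add: f_def y_def power_mult_distrib s3 algebra_simps)
    also have "\<dots> \<le> \<bar>\<beta>\<bar> * (1 + \<bar>\<beta>\<bar>)"
    \<comment> \<open>Beyond \<open>1 + \<bar>\<beta>\<bar>\<close> the square of \<open>y\<close>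
      exceeds \<open>\<beta>\<close>, so the drift is not positive; below, the linear term is
      bounded.\<close>
    proof (cases "y \<le> 1 + \<bar>\<beta>\<bar>")
      case True
      have "\<beta> * y \<le> \<bar>\<beta>\<bar> * (1 + \<bar>\<beta>\<bar>)" using True y by (intro mult_mono) auto
      then show ?thesis using y by (smt (verit) zero_less_power)
    next
      case False
      then have "(1 + \<bar>\<beta>\<bar>) * 1 \<le> y * y" using y by (intro mult_mono) auto
      then have "\<beta> * y \<le> y * y * y" using y by (intro mult_right_mono) auto
      then show ?thesis by (smt (verit) abs_ge_zero mult_nonneg_nonneg power3_eq_cube)
    qed
    finally show "s * f u \<le> \<bar>\<beta>\<bar> * (1 + \<bar>\<beta>\<bar>)" .
  qed (intro cadlag_on_integrable cadlag_on_intros fc; simp)+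
  then have "s * integral {0..h} f \<le> \<eta>" using hC h by (simp add: algebra_simps)
  moreover have "s * X h = s * x + s * integral {0..h} f + s * (\<sigma> * \<omega> h)"
    using solves_sde_eq[OF X h] by (simp add: f_def[abs_def] algebra_simps)
  ultimately show "s * X h \<le> s * x - \<eta>" using down by linarith
qed

section \<open>Independence of past and future\<close>

text \<open>What independence and ergodicity need from the noise. Measurability and invariance of
  the shift are taken from the metric dynamical system instead of being rederived from stationary
  increments.\<close>

locale stationary_paths = prob_space M for M :: "(real \<Rightarrow> real) measure" +
  assumes space_M: "space M = cadlag_paths"
    and sets_M: "sets M = sets path_space"
    and indep_increments: "\<And>n t. (\<And>i. i < n \<Longrightarrow> t i \<le> t (Suc i)) \<Longrightarrow>
      indep_vars (\<lambda>_. borel) (\<lambda>i \<omega>. \<omega> (t (Suc i)) - \<omega> (t i)) {..<n}"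
    and shift_measurable: "\<And>t. path_shift t \<in> M \<rightarrow>\<^sub>M M"
    and distr_shift: "\<And>t. distr M M (path_shift t) = M"

text \<open>A pathwise stand-in for measurability with respect to the evaluations at times in
  \<open>I\<close>: it can be checked by inspecting paths, and
  \<open>determined_sigma_cylinders\<close> converts it back.\<close>

definition determined_on :: "real set \<Rightarrow> (real \<Rightarrow> real) set \<Rightarrow> bool" where
  "determined_on I A \<longleftrightarrow> (\<forall>\<omega>\<in>cadlag_paths. \<forall>\<omega>'\<in>cadlag_paths.
     (\<forall>t\<in>I. \<omega> t = \<omega>' t) \<longrightarrow> (\<omega> \<in> A \<longleftrightarrow> \<omega>' \<in> A))"

lemma determined_onD:
  "determined_on I A \<Longrightarrow> \<omega> \<in> cadlag_paths \<Longrightarrow> \<omega>' \<in> cadlag_paths \<Longrightarrow>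
    (\<And>t. t \<in> I \<Longrightarrow> \<omega> t = \<omega>' t) \<Longrightarrow> \<omega> \<in> A \<longleftrightarrow> \<omega>' \<in> A"
  unfolding determined_on_def by blast

lemma determined_on_mono: "determined_on I A \<Longrightarrow> I \<subseteq> J \<Longrightarrow> determined_on J A"
  unfolding determined_on_def by blast

lemma path_shift_shift: "path_shift s (path_shift t \<omega>) = path_shift (s + t) \<omega>"
  by (auto simp: path_shift_def algebra_simps)

lemma path_shift_0: "\<omega> \<in> cadlag_paths \<Longrightarrow> path_shift 0 \<omega> = \<omega>"
  by (auto simp: path_shift_def cadlag_paths_def)

lemma cadlag_pathsD: "\<omega> \<in> cadlag_paths \<Longrightarrow> \<omega> 0 = 0" "\<omega> \<in> cadlag_paths \<Longrightarrow> cadlag_on {0..} \<omega>"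
  by (auto simp: cadlag_paths_def intro: cadlag_on_mono)

text \<open>\<open>past_path\<close> and \<open>future_path\<close> are retractions that stay in the
  canonical space because paths vanish at 0. An event determined on a half line is its own preimage
  under the matching retraction.\<close>

definition past_path :: "(real \<Rightarrow> real) \<Rightarrow> real \<Rightarrow> real" where
  "past_path \<omega> t = (if t \<le> 0 then \<omega> t else 0)"

definition future_path :: "(real \<Rightarrow> real) \<Rightarrow> real \<Rightarrow> real" where
  "future_path \<omega> t = (if 0 \<le> t then \<omega> t else 0)"

lemma past_path_cadlag: assumes "\<omega> \<in> cadlag_paths" shows "past_path \<omega> \<in> cadlag_paths"
proof -
  have 0: "\<omega> 0 = 0" and \<omega>: "\<And>t. continuous (at t within {t..}) \<omega>"
     "\<And>t. \<exists>l. (\<omega> \<longlongrightarrow> l) (at t within {..<t})"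
    using assms by (auto simp: cadlag_paths_def cadlag_on_def)
  have "continuous (at t within {t..}) (past_path \<omega>)" for t
  proof (cases "t < 0")
    case True
    then show ?thesis
      by (intro continuous_transform_within[OF \<omega>(1), where \<delta> = "- t"])
        (auto simp: past_path_def dist_real_def)
  next
    case False
    have "continuous (at t within {t..}) (\<lambda>t. 0::real)" by simp
    then show ?thesis
      by (rule continuous_transform_within[where \<delta> = 1])
        (use False 0 in \<open>auto simp: past_path_def intro: arg_cong[of _ 0 \<omega>, THEN trans] order.antisym\<close>)
  qed
  moreover have "\<exists>l. (past_path \<omega> \<longlongrightarrow> l) (at t within {..<t})" for t
  proof (cases "t \<le> 0")
    case True
    obtain l where l: "(\<omega> \<longlongrightarrow> l) (at t within {..<t})" using \<omega> by blast
    have "(past_path \<omega> \<longlongrightarrow> l) (at t within {..<t})"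
      by (rule Lim_transform_within[OF l zero_less_one]) (use True in \<open>auto simp: past_path_def\<close>)
    then show ?thesis by blast
  next
    case False
    have "(past_path \<omega> \<longlongrightarrow> 0) (at t within {..<t})"
      by (rule Lim_transform_within[OF tendsto_const, where d = t])
        (use False in \<open>auto simp: past_path_def dist_real_def\<close>)
    then show ?thesis by blast
  qed
  ultimately show ?thesis using 0 by (auto simp: cadlag_paths_def cadlag_on_def past_path_def)
qed

lemma future_path_cadlag: assumes "\<omega> \<in> cadlag_paths" shows "future_path \<omega> \<in> cadlag_paths"
proof -
  have 0: "\<omega> 0 = 0" and \<omega>: "\<And>t. continuous (at t within {t..}) \<omega>"
     "\<And>t. \<exists>l. (\<omega> \<longlongrightarrow> l) (at t within {..<t})"
    using assms by (auto simp: cadlag_paths_def cadlag_on_def)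
  have "continuous (at t within {t..}) (future_path \<omega>)" for t
  proof (cases "t < 0")
    case True
    have "continuous (at t within {t..}) (\<lambda>t. 0::real)" by simp
    then show ?thesis
      by (rule continuous_transform_within[where \<delta> = "- t"])
        (use True in \<open>auto simp: future_path_def dist_real_def\<close>)
  next
    case False
    then show ?thesis
      by (intro continuous_transform_within[OF \<omega>(1), where \<delta> = 1]) (auto simp: future_path_def)
  qed
  moreover have "\<exists>l. (future_path \<omega> \<longlongrightarrow> l) (at t within {..<t})" for t
  proof (cases "t \<le> 0")
    case True
    have "(future_path \<omega> \<longlongrightarrow> 0) (at t within {..<t})"
      by (rule Lim_transform_within[OF tendsto_const zero_less_one])
        (use True in \<open>auto simp: future_path_def\<close>)
    then show ?thesis by blast
  next
    case False
    obtain l where l: "(\<omega> \<longlongrightarrow> l) (at t within {..<t})" using \<omega> by blast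
    have "(future_path \<omega> \<longlongrightarrow> l) (at t within {..<t})"
      by (rule Lim_transform_within[OF l, where d = t])
        (use False in \<open>auto simp: future_path_def dist_real_def\<close>)
    then show ?thesis by blast
  qed
  ultimately show ?thesis using 0 by (auto simp: cadlag_paths_def cadlag_on_def future_path_def)
qed

context stationary_paths
begin

section \<open>Measurability and shift invariance on the path space\<close>

lemma shift_in_space: "\<omega> \<in> cadlag_paths \<Longrightarrow> path_shift t \<omega> \<in> cadlag_paths"
  using measurable_space[OF shift_measurable] by (simp add: space_M)

lemma evaluation_measurable [measurable]: "(\<lambda>\<omega>. \<omega> t) \<in> borel_measurable M"
proof -
  have "(\<lambda>\<omega>. \<omega> t) \<in> borel_measurable path_space"
    unfolding path_space_def by (intro measurable_restrict_space1) simp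
  then show ?thesis by (simp add: measurable_cong_sets[OF sets_M refl])
qed

lemma measurable_into_M:
  assumes "\<And>\<omega>. \<omega> \<in> space N \<Longrightarrow> g \<omega> \<in> cadlag_paths" "\<And>t. (\<lambda>\<omega>. g \<omega> t) \<in> borel_measurable N"
  shows "g \<in> N \<rightarrow>\<^sub>M M"
proof -
  have "(\<lambda>\<omega> t. g \<omega> t) \<in> N \<rightarrow>\<^sub>M (\<Pi>\<^sub>M t\<in>UNIV. borel)"
    by (rule measurable_PiM_single') (use assms in auto)
  then have "g \<in> N \<rightarrow>\<^sub>M path_space"
    unfolding path_space_def by (intro measurable_restrict_space2) (use assms in auto)
  then show ?thesis by (simp add: measurable_cong_sets[OF refl sets_M])
qed

lemma prob_shift: "A \<in> events \<Longrightarrow> prob (path_shift t -` A \<inter> space M) = prob A"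
  using measure_distr[OF shift_measurable, of A t] distr_shift[of t] by simp

lemma shift_events: "A \<in> events \<Longrightarrow> path_shift t -` A \<inter> space M \<in> events"
  using shift_measurable by (rule measurable_sets)

lemma AE_shift:
  assumes "AE \<omega> in M. P \<omega>" shows "AE \<omega> in M. P (path_shift t \<omega>)"
  by (rule AE_distrD[OF shift_measurable]) (use assms in \<open>simp only: distr_shift\<close>)

text \<open>The time \<open>s\<close> joins the translated window because
  \<open>path_shift s\<close> subtracts the value at \<open>s\<close>.\<close>

lemma determined_on_shift:
  assumes "determined_on I A" "A \<subseteq> cadlag_paths"
  shows "determined_on ((+) s ` I \<union> {s}) (path_shift s -` A \<inter> space M)"
  unfolding determined_on_def
proof (intro ballI impI)
  fix \<omega> \<omega>' assume *: "\<omega> \<in> cadlag_paths" "\<omega>' \<in> cadlag_paths" "\<forall>t\<in>(+) s ` I \<union> {s}. \<omega> t = \<omega>' t"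
  then have "path_shift s \<omega> \<in> A \<longleftrightarrow> path_shift s \<omega>' \<in> A"
    by (intro determined_onD[OF assms(1)] shift_in_space) (auto simp: path_shift_def)
  then show "\<omega> \<in> path_shift s -` A \<inter> space M \<longleftrightarrow> \<omega>' \<in> path_shift s -` A \<inter> space M"
    using * by (auto simp: space_M)
qed

section \<open>Cylinder events and the independence of past and future\<close>

definition cylinders :: "real set \<Rightarrow> (real \<Rightarrow> real) set set" where
  "cylinders I = {{\<omega>\<in>cadlag_paths. \<forall>t\<in>J. \<omega> t \<in> B t} |J B.
     finite J \<and> J \<subseteq> I \<and> (\<forall>t. B t \<in> sets (borel :: real measure))}"

lemma cylinders_events: "cylinders I \<subseteq> events"
proof
  fix a assume "a \<in> cylinders I"
  then obtain J B where a: "a = {\<omega>\<in>space M. \<forall>t\<in>J. \<omega> t \<in> B t}" "finite J"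
    "\<And>t. B t \<in> sets (borel :: real measure)"
    unfolding cylinders_def space_M by blast
  show "a \<in> events"
    unfolding a(1)
  proof (rule sets.sets_Collect_finite_All[OF _ a(2)])
    show "{\<omega>\<in>space M. \<omega> t \<in> B t} \<in> events" for t
      using measurable_sets[OF evaluation_measurable a(3), of t t] by (simp add: vimage_def Int_def conj_commute)
  qed
qed

lemma Int_stable_cylinders: "Int_stable (cylinders I)"
proof (rule Int_stableI)
  fix a b assume "a \<in> cylinders I" "b \<in> cylinders I"
  then obtain J B K C where a: "a = {\<omega>\<in>cadlag_paths. \<forall>t\<in>J. \<omega> t \<in> B t}" "finite J" "J \<subseteq> I" "\<forall>t. B t \<in> sets borel"
    and b: "b = {\<omega>\<in>cadlag_paths. \<forall>t\<in>K. \<omega> t \<in> C t}" "finite K" "K \<subseteq> I" "\<forall>t. C t \<in> sets borel"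
    unfolding cylinders_def by blast
  have "a \<inter> b = {\<omega>\<in>cadlag_paths. \<forall>t\<in>J \<union> K. \<omega> t \<in>
      (if t \<in> J then B t else UNIV) \<inter> (if t \<in> K then C t else UNIV)}"
    unfolding a b by auto
  then show "a \<inter> b \<in> cylinders I"
    unfolding cylinders_def using a b
    by (auto intro!: exI[of _ "J \<union> K"]
      exI[of _ "\<lambda>t. (if t \<in> J then B t else UNIV) \<inter> (if t \<in> K then C t else UNIV)"])
qed

text \<open>Since paths vanish at 0, values at negative times are minus sums of increments up to 0,
  and values at positive times are sums of increments from 0. In a partition through 0 these are two
  disjoint blocks of independent increments.\<close>

lemma indep_cylinders:
  assumes "a \<in> cylinders {..0}" "b \<in> cylinders {0..}"
  shows "prob (a \<inter> b) = prob a * prob b"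
proof -
  obtain J B K C where a: "a = {\<omega>\<in>cadlag_paths. \<forall>t\<in>J. \<omega> t \<in> B t}" "finite J" "J \<subseteq> {..0}" "\<And>t. B t \<in> sets borel"
    and b: "b = {\<omega>\<in>cadlag_paths. \<forall>t\<in>K. \<omega> t \<in> C t}" "finite K" "K \<subseteq> {0..}" "\<And>t. C t \<in> sets borel"
    using assms unfolding cylinders_def by blast
  \<comment> \<open>The point 0, at index \<open>k\<close>, separates the sorted times of
    \<open>J\<close> and \<open>K\<close>. It may occur repeatedly, which only produces zero
    increments.\<close>
  define xs where "xs = sorted_list_of_set J @ [0] @ sorted_list_of_set K"
  define k where "k = card J"
  define n where "n = k + card K"
  \<comment> \<open>Capping the index keeps \<open>\<tau>\<close> monotone on all of the natural
    numbers.\<close>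
  define \<tau> where "\<tau> i = xs ! min i n" for i
  have len: "length xs = Suc n" by (simp add: xs_def n_def k_def)
  have "x \<le> y" if "x \<in> J" "y \<in> K" for x y
    using a(3) b(3) that by (meson atMost_iff atLeast_iff order_trans subsetD)
  then have "sorted xs" using a(2,3) b(2,3) by (auto simp: xs_def sorted_append)
  then have mono: "\<tau> i \<le> \<tau> j" if "i \<le> j" for i j
    unfolding \<tau>_def using that len by (intro sorted_nth_mono) auto
  have \<tau>k: "\<tau> k = 0" by (simp add: \<tau>_def xs_def n_def k_def nth_append)
  have J: "J = \<tau> ` {..<k}"
  proof -
    have "\<tau> i = sorted_list_of_set J ! i" if "i < k" for i
      using that by (simp add: \<tau>_def xs_def n_def k_def nth_append)
    then have "\<tau> ` {..<k} = (!) (sorted_list_of_set J) ` {..<k}" by simp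
    also have "\<dots> = set (sorted_list_of_set J)"
      by (auto simp: k_def set_conv_nth image_iff)
    finally show ?thesis using a by simp
  qed
  have K: "K = \<tau> ` {k<..n}"
  proof -
    have "\<tau> (Suc (k + i)) = sorted_list_of_set K ! i" if "i < card K" for i
      using that by (simp add: \<tau>_def xs_def n_def k_def nth_append)
    then have "(\<lambda>i. \<tau> (Suc (k + i))) ` {..<card K} = (!) (sorted_list_of_set K) ` {..<card K}" by simp
    also have "\<dots> = set (sorted_list_of_set K)"
      by (auto simp: set_conv_nth image_iff)
    also have "\<dots> = K" using b by simp
    finally have "K = (\<lambda>i. \<tau> (Suc (k + i))) ` {..<card K}" by simp
    also have "\<dots> = \<tau> ` (\<lambda>i. Suc (k + i)) ` {..<card K}" by (simp add: image_image)
    also have "(\<lambda>i. Suc (k + i)) ` {..<card K} = {k<..n}"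
    proof (intro set_eqI iffI)
      fix j assume "j \<in> {k<..n}"
      then have "j = Suc (k + (j - Suc k))" "j - Suc k < card K" by (auto simp: n_def)
      then show "j \<in> (\<lambda>i. Suc (k + i)) ` {..<card K}" by blast
    qed (auto simp: n_def)
    finally show ?thesis .
  qed
  define X where "X i \<omega> = \<omega> (\<tau> (Suc i)) - \<omega> (\<tau> i)" for i and \<omega> :: "real \<Rightarrow> real"
  have ind: "indep_vars (\<lambda>_. borel) X {..<n}"
    unfolding X_def using mono by (intro indep_increments) auto
  let ?P1 = "\<Pi>\<^sub>M i\<in>{..<k}. (borel :: real measure)"
  let ?P2 = "\<Pi>\<^sub>M i\<in>{k..<n}. (borel :: real measure)"
  have iv: "indep_var ?P1 (\<lambda>\<omega>. restrict (\<lambda>i. X i \<omega>) {..<k}) ?P2 (\<lambda>\<omega>. restrict (\<lambda>i. X i \<omega>) {k..<n})"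
    by (rule indep_var_restrict[OF ind]) (auto simp: n_def)
  \<comment> \<open>\<open>A1\<close> and \<open>A2\<close> rewrite the cylinder conditions in terms
    of increments: sums ending at index \<open>k\<close> with a minus sign for the past, sums
    starting there for the future.\<close>
  define A1 where "A1 = {x\<in>space ?P1. \<forall>i\<in>{..<k}. - (\<Sum>j\<in>{i..<k}. x j) \<in> B (\<tau> i)}"
  define A2 where "A2 = {x\<in>space ?P2. \<forall>i\<in>{k<..n}. (\<Sum>j\<in>{k..<i}. x j) \<in> C (\<tau> i)}"
  have A1: "A1 \<in> sets ?P1"
    unfolding A1_def
  proof (rule sets.sets_Collect_finite_All)
    fix i assume "i \<in> {..<k}"
    then have [measurable]: "(\<lambda>x. - (\<Sum>j\<in>{i..<k}. x j)) \<in> borel_measurable ?P1"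
      by (intro borel_measurable_uminus borel_measurable_sum measurable_component_singleton) auto
    show "{x \<in> space ?P1. - (\<Sum>j\<in>{i..<k}. x j) \<in> B (\<tau> i)} \<in> sets ?P1"
      using a(4)[of "\<tau> i"] by measurable
  qed auto
  have A2: "A2 \<in> sets ?P2"
    unfolding A2_def
  proof (rule sets.sets_Collect_finite_All)
    fix i assume "i \<in> {k<..n}"
    then have [measurable]: "(\<lambda>x. (\<Sum>j\<in>{k..<i}. x j)) \<in> borel_measurable ?P2"
      by (intro borel_measurable_sum measurable_component_singleton) auto
    show "{x \<in> space ?P2. (\<Sum>j\<in>{k..<i}. x j) \<in> C (\<tau> i)} \<in> sets ?P2"
      using b(4)[of "\<tau> i"] by measurable
  qed auto
  have tel: "(\<Sum>j\<in>{i..<m}. X j \<omega>) = \<omega> (\<tau> m) - \<omega> (\<tau> i)" if "i \<le> m" for i m \<omega>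
    using that unfolding X_def by (rule sum_Suc_diff')
  have e1: "(\<lambda>\<omega>. restrict (\<lambda>i. X i \<omega>) {..<k}) -` A1 \<inter> space M = a"
  proof -
    have "(\<lambda>i\<in>{..<k}. X i \<omega>) \<in> A1 \<longleftrightarrow> (\<forall>t\<in>J. \<omega> t \<in> B t)" if "\<omega> \<in> cadlag_paths" for \<omega>
    proof -
      have "- (\<Sum>j\<in>{i..<k}. (\<lambda>i\<in>{..<k}. X i \<omega>) j) = \<omega> (\<tau> i)" if "i < k" for i
      proof -
        have "(\<Sum>j\<in>{i..<k}. (\<lambda>i\<in>{..<k}. X i \<omega>) j) = (\<Sum>j\<in>{i..<k}. X j \<omega>)" by (intro sum.cong) auto
        then show ?thesis using tel[of i k \<omega>] \<tau>k that cadlag_pathsD(1)[OF \<open>\<omega> \<in> cadlag_paths\<close>] by simp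
      qed
      then show ?thesis by (auto simp: A1_def J space_PiM)
    qed
    then show ?thesis by (auto simp: a(1) space_M)
  qed
  have e2: "(\<lambda>\<omega>. restrict (\<lambda>i. X i \<omega>) {k..<n}) -` A2 \<inter> space M = b"
  proof -
    have "(\<lambda>i\<in>{k..<n}. X i \<omega>) \<in> A2 \<longleftrightarrow> (\<forall>t\<in>K. \<omega> t \<in> C t)" if "\<omega> \<in> cadlag_paths" for \<omega>
    proof -
      have "(\<Sum>j\<in>{k..<i}. (\<lambda>i\<in>{k..<n}. X i \<omega>) j) = \<omega> (\<tau> i)" if "k < i" "i \<le> n" for i
      proof -
        have "(\<Sum>j\<in>{k..<i}. (\<lambda>i\<in>{k..<n}. X i \<omega>) j) = (\<Sum>j\<in>{k..<i}. X j \<omega>)"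
          using that by (intro sum.cong) auto
        then show ?thesis using tel[of k i \<omega>] \<tau>k that cadlag_pathsD(1)[OF \<open>\<omega> \<in> cadlag_paths\<close>] by simp
      qed
      then show ?thesis by (auto simp: A2_def K space_PiM)
    qed
    then show ?thesis by (auto simp: b(1) space_M)
  qed
  have "prob (a \<inter> b) = prob ((\<lambda>\<omega>. (restrict (\<lambda>i. X i \<omega>) {..<k}, restrict (\<lambda>i. X i \<omega>) {k..<n})) -` (A1 \<times> A2) \<inter> space M)"
    by (intro arg_cong[where f = prob]) (auto simp flip: e1 e2)
  also have "\<dots> = prob a * prob b"
    using indep_varD[OF iv A1 A2] unfolding e1 e2 .
  finally show ?thesis .
qed

text \<open>Freezing a path to 0 outside \<open>I\<close> is measurable from the cylinder algebra
  over \<open>I\<close> into \<open>M\<close>, and \<open>A\<close> is its own preimage under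
  \<open>g\<close> because \<open>A\<close> sees times in \<open>I\<close> only.\<close>

lemma determined_sigma_cylinders:
  assumes A: "A \<in> events" and det: "determined_on I A"
    and g: "\<And>\<omega>. \<omega> \<in> cadlag_paths \<Longrightarrow> g \<omega> \<in> cadlag_paths"
      "\<And>\<omega> t. t \<in> I \<Longrightarrow> g \<omega> t = \<omega> t" "\<And>\<omega> t. t \<notin> I \<Longrightarrow> g \<omega> t = 0"
  shows "A \<in> sigma_sets (space M) (cylinders I)"
proof -
  let ?S = "sigma (space M) (cylinders I)"
  have cyl: "cylinders I \<subseteq> Pow (space M)" using cylinders_events sets.space_closed by blast
  have "g \<in> ?S \<rightarrow>\<^sub>M M"
  proof (rule measurable_into_M)
    fix \<omega> assume "\<omega> \<in> space ?S" then show "g \<omega> \<in> cadlag_paths" using g(1) cyl by (simp add: space_M)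
  next
    fix t
    show "(\<lambda>\<omega>. g \<omega> t) \<in> borel_measurable ?S"
    proof (cases "t \<in> I")
      case True
      have "(\<lambda>\<omega>. \<omega> t) \<in> borel_measurable ?S"
      proof (rule measurableI)
        fix B :: "real set" assume B: "B \<in> sets borel"
        have "(\<lambda>\<omega>. \<omega> t) -` B \<inter> space ?S = {\<omega>\<in>cadlag_paths. \<forall>s\<in>{t}. \<omega> s \<in> (\<lambda>_. B) s}"
          using cyl by (auto simp: space_M)
        also have "\<dots> \<in> cylinders I"
          unfolding cylinders_def using True B by (intro CollectI exI[of _ "{t}"] exI[of _ "\<lambda>_. B"]) simp
        finally show "(\<lambda>\<omega>. \<omega> t) -` B \<inter> space ?S \<in> sets ?S" using cyl by auto
      qed simp
      then show ?thesis using g(2)[OF True] by simp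
    qed (simp add: g(3))
  qed
  then have "g -` A \<inter> space ?S \<in> sets ?S" using A by (rule measurable_sets)
  moreover have "g -` A \<inter> space ?S = A"
  proof -
    have "g \<omega> \<in> A \<longleftrightarrow> \<omega> \<in> A" if "\<omega> \<in> cadlag_paths" for \<omega>
      by (rule determined_onD[OF det]) (use that g in auto)
    then show ?thesis using cyl sets.sets_into_space[OF A] by (auto simp: space_M)
  qed
  ultimately show ?thesis using cyl by (simp add: sets_measure_of)
qed

lemma past_future_indep:
  assumes A: "A \<in> events" "determined_on {..0} A" and B: "B \<in> events" "determined_on {0..} B"
  shows "prob (A \<inter> B) = prob A * prob B"
proof -
  have "indep_set (cylinders {..0}) (cylinders {0..})"
    by (rule indep_setI) (use cylinders_events indep_cylinders in auto)
  then have "indep_set (sigma_sets (space M) (cylinders {..0})) (sigma_sets (space M) (cylinders {0..}))"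
    by (rule indep_set_sigma_sets) (rule Int_stable_cylinders)+
  moreover have "A \<in> sigma_sets (space M) (cylinders {..0})"
    by (rule determined_sigma_cylinders[OF A, of past_path])
      (auto simp: past_path_cadlag, auto simp: past_path_def)
  moreover have "B \<in> sigma_sets (space M) (cylinders {0..})"
    by (rule determined_sigma_cylinders[OF B, of future_path])
      (auto simp: future_path_cadlag, auto simp: future_path_def)
  ultimately show ?thesis by (rule indep_setD)
qed

text \<open>Shifting by \<open>- s\<close> moves an event known at time \<open>s\<close> into the
  past of 0, where \<open>past_future_indep\<close> applies; invariance moves the probabilities
  back.\<close>

lemma indep_at:
  assumes A: "A \<in> events" "determined_on {..s} A" and s: "0 \<le> s"
    and B: "B \<in> events" "determined_on {0..} B"
  shows "prob (A \<inter> (path_shift s -` B \<inter> space M)) = prob A * prob B"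
proof -
  define A0 where "A0 = path_shift (- s) -` A \<inter> space M"
  have A0: "A0 \<in> events" unfolding A0_def by (rule shift_events[OF A(1)])
  have "determined_on ((+) (- s) ` {..s} \<union> {- s}) A0"
    unfolding A0_def using determined_on_shift[OF A(2)] sets.sets_into_space[OF A(1)] space_M by blast
  then have A0d: "determined_on {..0} A0"
    by (rule determined_on_mono) (use s in auto)
  have "path_shift s -` (A0 \<inter> B) \<inter> space M = A \<inter> (path_shift s -` B \<inter> space M)"
    using sets.sets_into_space[OF A(1)]
    by (auto simp: A0_def space_M path_shift_shift path_shift_0 shift_in_space)
  then have "prob (A \<inter> (path_shift s -` B \<inter> space M)) = prob (A0 \<inter> B)"
    using prob_shift[of "A0 \<inter> B" s] A0 B(1) by auto
  also have "\<dots> = prob A0 * prob B" by (rule past_future_indep[OF A0 A0d B])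
  also have "prob A0 = prob A" unfolding A0_def by (rule prob_shift[OF A(1)])
  finally show ?thesis .
qed

end

section \<open>Ergodicity and small moves of the noise\<close>

text \<open>Values at rationals to the right of \<open>u\<close> converge to \<open>f u\<close>. It
  turns conditions on all times into countably many; the approach from the right is why
  \<open>u < h\<close> is strict and an end point needs separate care.\<close>

lemma cadlag_closed_from_rationals:
  assumes f: "cadlag_on {0..} f" and u: "0 \<le> u" "u < h" and S: "closed S"
    and rat: "\<And>q. q \<in> \<rat> \<Longrightarrow> u < q \<Longrightarrow> q < h \<Longrightarrow> f q \<in> S"
  shows "f u \<in> S"
proof (rule ccontr)
  assume "f u \<notin> S"
  moreover have "(f \<longlongrightarrow> f u) (at u within {u..})"
    using cadlag_onD_right[OF f u(1)] by (simp add: continuous_within)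
  ultimately have "\<forall>\<^sub>F v in at u within {u..}. f v \<in> - S"
    using S by (intro topological_tendstoD) auto
  then obtain d where "d > 0" and d: "\<And>v. u \<le> v \<Longrightarrow> v \<noteq> u \<Longrightarrow> dist v u < d \<Longrightarrow> f v \<notin> S"
    unfolding eventually_at by auto
  then obtain q where "q \<in> \<rat>" "u < q" "q < min h (u + d)"
    using Rats_dense_in_real[of u "min h (u + d)"] u by auto
  then show False using rat[of q] d[of q] by (auto simp: dist_real_def)
qed

context stationary_paths
begin

section \<open>Ergodicity of the shift\<close>

lemma prob_diff_le_sym_diff:
  assumes "A \<in> events" "B \<in> events"
  shows "\<bar>prob A - prob B\<bar> \<le> prob ((A - B) \<union> (B - A))"
proof -
  have "prob A \<le> prob (B \<union> ((A - B) \<union> (B - A)))" "prob B \<le> prob (A \<union> ((A - B) \<union> (B - A)))"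
    by (rule finite_measure_mono; use assms in auto)+
  moreover have "prob (B \<union> ((A - B) \<union> (B - A))) \<le> prob B + prob ((A - B) \<union> (B - A))"
    "prob (A \<union> ((A - B) \<union> (B - A))) \<le> prob A + prob ((A - B) \<union> (B - A))"
    by (rule measure_Un_le; use assms in auto)+
  ultimately show ?thesis by linarith
qed

text \<open>A cylinder involves finitely many times, and the events approximable in this sense are
  closed under complements and countable unions.\<close>

lemma window_approximation:
  assumes "A \<in> events" "0 < e"
  shows "\<exists>m\<ge>0. \<exists>C\<in>events. determined_on {- m..m} C \<and> prob ((A - C) \<union> (C - A)) < e"
proof -
  have "A \<in> sigma_sets (space M) (cylinders UNIV)"
    by (rule determined_sigma_cylinders[OF assms(1), of _ "\<lambda>\<omega>. \<omega>"]) (auto simp: determined_on_def simp flip: fun_eq_iff)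
  then show ?thesis using assms(2)
  proof (induction arbitrary: e rule: sigma_sets.induct)
    case (Basic a)
    then obtain J B where a: "a = {\<omega>\<in>cadlag_paths. \<forall>t\<in>J. \<omega> t \<in> B t}" "finite J"
      unfolding cylinders_def by blast
    obtain m where "0 < m" and m: "\<forall>t\<in>J. norm t \<le> m"
      using finite_imp_bounded[OF a(2)] bounded_pos by blast
    have "determined_on {-m..m} a"
      unfolding determined_on_def
    proof (intro ballI impI)
      fix \<omega> \<omega>' assume *: "\<omega> \<in> cadlag_paths" "\<omega>' \<in> cadlag_paths" "\<forall>t\<in>{-m..m}. \<omega> t = \<omega>' t"
      then have "\<omega> t = \<omega>' t" if "t \<in> J" for t using m that by (auto simp: abs_le_iff)
      then show "\<omega> \<in> a \<longleftrightarrow> \<omega>' \<in> a" using * by (auto simp: a)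
    qed
    then show ?case using \<open>0 < m\<close> Basic cylinders_events by (intro exI[of _ m] conjI bexI[of _ a]) auto
  next
    case Empty
    then show ?case by (intro exI[of _ 0] conjI bexI[of _ "{}"]) (auto simp: determined_on_def)
  next
    case (Compl a)
    then obtain m C where C: "0 \<le> m" "C \<in> events" "determined_on {-m..m} C" "prob ((a - C) \<union> (C - a)) < e"
      by blast
    have "a \<subseteq> space M" using Compl.hyps cylinders_events sets.space_closed
      by (meson order_trans sigma_sets_into_sp)
    then have "((space M - a) - (space M - C)) \<union> ((space M - C) - (space M - a)) = (a - C) \<union> (C - a)"
      using sets.sets_into_space[OF C(2)] by blast
    moreover have "determined_on {-m..m} (space M - C)"
      using C(3) unfolding determined_on_def space_M by blast
    ultimately show ?case using C by (intro exI[of _ m] conjI bexI[of _ "space M - C"]) auto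
  next
    case (Union a)
    have ev: "a i \<in> events" for i
      using Union.hyps sets.sigma_sets_subset[OF cylinders_events] by blast
    have "(\<lambda>n. prob (\<Union>i<n. a i)) \<longlonglongrightarrow> prob (\<Union>n. \<Union>i<n. a i)"
      by (rule finite_Lim_measure_incseq) (use ev in \<open>auto simp: incseq_def intro: bexI less_le_trans\<close>)
    moreover have "(\<Union>n. \<Union>i<n. a i) = (\<Union>i. a i)" by blast
    ultimately have "\<forall>\<^sub>F n in sequentially. prob (\<Union>i. a i) - e / 2 < prob (\<Union>i<n. a i)"
      using Union.prems by (intro order_tendstoD) auto
    then obtain n where n: "prob (\<Union>i. a i) - e / 2 < prob (\<Union>i<n. a i)"
      by (auto simp: eventually_sequentially)
    \<comment> \<open>Half of \<open>e\<close> was spent on cutting off the union; the other half is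
      shared among the first \<open>n\<close> sets. \<open>Suc n\<close> avoids division by
      0.\<close>
    have "0 < e / (2 * real (Suc n))" using Union.prems by simp
    then have "\<forall>i. \<exists>m C. 0 \<le> m \<and> C \<in> events \<and> determined_on {-m..m} C \<and>
        prob ((a i - C) \<union> (C - a i)) < e / (2 * real (Suc n))"
      using Union.IH by blast
    then obtain m C where C: "\<And>i. 0 \<le> (m i :: real)" "\<And>i. C i \<in> events" "\<And>i. determined_on {-m i..m i} (C i)"
      "\<And>i. prob ((a i - C i) \<union> (C i - a i)) < e / (2 * real (Suc n))"
      by metis
    define D where "D = (\<Union>i<n. C i)"
    \<comment> \<open>The sum is a convenient common radius, since it dominates every
      \<open>m i\<close>.\<close>
    define S where "S = (\<Sum>i<n. m i)"
    have mS: "m i \<le> S" if "i < n" for i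
      unfolding S_def using that C(1) by (intro member_le_sum) auto
    have "determined_on {-S..S} D"
      unfolding determined_on_def
    proof (intro ballI impI)
      fix \<omega> \<omega>' assume *: "\<omega> \<in> cadlag_paths" "\<omega>' \<in> cadlag_paths" "\<forall>t\<in>{-S..S}. \<omega> t = \<omega>' t"
      have "\<omega> \<in> C i \<longleftrightarrow> \<omega>' \<in> C i" if "i < n" for i
        by (rule determined_onD[OF C(3)]) (use * mS[OF that] in auto)
      then show "\<omega> \<in> D \<longleftrightarrow> \<omega>' \<in> D" by (auto simp: D_def)
    qed
    moreover have "prob ((\<Union>(range a) - D) \<union> (D - \<Union>(range a))) < e"
    proof -
      have "(\<Union>(range a) - D) \<union> (D - \<Union>(range a)) \<subseteq>
          (\<Union>(range a) - (\<Union>i<n. a i)) \<union> (\<Union>i<n. (a i - C i) \<union> (C i - a i))"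
        unfolding D_def by blast
      then have "prob ((\<Union>(range a) - D) \<union> (D - \<Union>(range a))) \<le>
          prob ((\<Union>(range a) - (\<Union>i<n. a i)) \<union> (\<Union>i<n. (a i - C i) \<union> (C i - a i)))"
        by (rule finite_measure_mono) (use ev C in auto)
      also have "\<dots> \<le> prob (\<Union>(range a) - (\<Union>i<n. a i)) + prob (\<Union>i<n. (a i - C i) \<union> (C i - a i))"
        by (rule measure_Un_le) (use ev C in auto)
      also have "prob (\<Union>(range a) - (\<Union>i<n. a i)) = prob (\<Union>(range a)) - prob (\<Union>i<n. a i)"
        by (rule finite_measure_Diff) (use ev in auto)
      also have "prob (\<Union>i<n. (a i - C i) \<union> (C i - a i)) \<le> (\<Sum>i<n. prob ((a i - C i) \<union> (C i - a i)))"
        by (rule measure_UNION_le) (use ev C in auto)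
      also have "\<dots> \<le> (\<Sum>i<n. e / (2 * real (Suc n)))"
        by (intro sum_mono less_imp_le C)
      also have "\<dots> \<le> e / 2" using Union.prems by (simp add: field_simps)
      finally show ?thesis using n by simp
    qed
    ultimately show ?case
      using C(1,2) by (intro exI[of _ S] conjI bexI[of _ D]) (auto simp: S_def D_def intro!: sum_nonneg)
  qed
qed

text \<open>The shift is mixing on events depending on a bounded window, since shifting such an event to
  the left and to the right makes it depend on the past resp. the future.\<close>

lemma shift_ergodic:
  assumes A: "A \<in> events" and inv: "\<And>t. path_shift t -` A \<inter> space M = A"
  shows "prob A = 0 \<or> prob A = 1"
proof -
  have close: "\<bar>prob A - prob A * prob A\<bar> \<le> 4 * e" if "0 < e" for e
  proof -
    obtain m C where C: "0 \<le> m" "C \<in> events" "determined_on {-m..m} C" "prob ((A - C) \<union> (C - A)) < e"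
      using window_approximation[OF A \<open>0 < e\<close>] by blast
    have Cs: "C \<subseteq> cadlag_paths" using sets.sets_into_space[OF C(2)] by (simp add: space_M)
    define S where "S = (A - C) \<union> (C - A)"
    have S: "S \<in> events" using A C by (auto simp: S_def)
    \<comment> \<open>The shifts by \<open>- m\<close> and \<open>m\<close> carry the window
      \<open>{-m..m}\<close> to \<open>{- 2 * m..0}\<close> and \<open>{0..2 * m}\<close>.\<close>
    define C1 where "C1 = path_shift (- m) -` C \<inter> space M"
    define C2 where "C2 = path_shift m -` C \<inter> space M"
    have C12: "C1 \<in> events" "C2 \<in> events" unfolding C1_def C2_def by (intro shift_events C(2))+
    have "determined_on {..0} C1" unfolding C1_def
      by (rule determined_on_mono[OF determined_on_shift[OF C(3) Cs]]) (use C(1) in auto)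
    moreover have "determined_on {0..} C2" unfolding C2_def
      by (rule determined_on_mono[OF determined_on_shift[OF C(3) Cs]]) (use C(1) in auto)
    ultimately have "prob (C1 \<inter> C2) = prob C1 * prob C2"
      using C12 by (intro past_future_indep) auto
    also have "\<dots> = prob C * prob C"
      unfolding C1_def C2_def by (simp add: prob_shift C(2))
    finally have pC: "prob (C1 \<inter> C2) = prob C * prob C" .
    \<comment> \<open>By invariance \<open>A\<close> can be compared with \<open>C1\<close> and
      \<open>C2\<close> separately, each error being a shift of \<open>S\<close> and hence of the
      same probability.\<close>
    have "A = (path_shift (- m) -` A \<inter> space M) \<inter> (path_shift m -` A \<inter> space M)"
      using inv by simp
    then have "(A - C1 \<inter> C2) \<union> (C1 \<inter> C2 - A) \<subseteq>
        (path_shift (- m) -` S \<inter> space M) \<union> (path_shift m -` S \<inter> space M)"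
      unfolding C1_def C2_def S_def by blast
    then have "prob ((A - C1 \<inter> C2) \<union> (C1 \<inter> C2 - A)) \<le>
        prob ((path_shift (- m) -` S \<inter> space M) \<union> (path_shift m -` S \<inter> space M))"
      by (rule finite_measure_mono) (intro sets.Un shift_events S)
    also have "\<dots> \<le> prob S + prob S"
      using measure_Un_le[of "path_shift (- m) -` S \<inter> space M" M "path_shift m -` S \<inter> space M"]
      by (simp add: prob_shift S shift_events)
    finally have "\<bar>prob A - prob C * prob C\<bar> \<le> 2 * prob S"
      using prob_diff_le_sym_diff[OF A, of "C1 \<inter> C2"] C12 pC by simp
    moreover have AC: "\<bar>prob A - prob C\<bar> \<le> prob S"
      unfolding S_def by (rule prob_diff_le_sym_diff[OF A C(2)])
    moreover have "\<bar>prob C * prob C - prob A * prob A\<bar> \<le> 2 * prob S"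
    proof -
      have "\<bar>prob C * prob C - prob A * prob A\<bar> = \<bar>prob A - prob C\<bar> * \<bar>prob A + prob C\<bar>"
      proof -
        have "prob C * prob C - prob A * prob A = - ((prob A - prob C) * (prob A + prob C))"
          by (simp add: algebra_simps)
        then show ?thesis by (simp only: abs_minus_cancel abs_mult)
      qed
      also have "\<dots> \<le> prob S * 2"
      proof (rule mult_mono[OF AC])
        show "\<bar>prob A + prob C\<bar> \<le> 2"
          using prob_le_1[of A] prob_le_1[of C] measure_nonneg[of M A] measure_nonneg[of M C] by linarith
      qed auto
      finally show ?thesis by simp
    qed
    ultimately show ?thesis using C(4) unfolding S_def[symmetric] by linarith
  qed
  have "\<bar>prob A - prob A * prob A\<bar> \<le> 0"
  proof (rule field_le_epsilon)
    fix e :: real assume "0 < e"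
    then show "\<bar>prob A - prob A * prob A\<bar> \<le> 0 + e" using close[of "e / 4"] by simp
  qed
  then have "prob A * (1 - prob A) = 0" by (simp add: algebra_simps)
  then show ?thesis by auto
qed

lemma tube_event: "{\<omega>\<in>space M. \<forall>u\<in>{0..h}. \<bar>x + \<omega> u\<bar> \<le> c} \<in> events"
proof -
  \<comment> \<open>The end point \<open>h\<close> is added to the rationals because
    right-continuity inside \<open>{0..h}\<close> does not reach it.\<close>
  define Q where "Q = insert h \<rat> \<inter> {0..h}"
  have "countable Q" unfolding Q_def using countable_rat by auto
  have "{\<omega>\<in>space M. \<forall>u\<in>{0..h}. \<bar>x + \<omega> u\<bar> \<le> c} = {\<omega>\<in>space M. \<forall>u\<in>Q. \<bar>x + \<omega> u\<bar> \<le> c}"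
  proof (intro Collect_cong conj_cong refl iffI ballI)
    fix \<omega> u assume \<omega>: "\<omega> \<in> space M" "\<forall>u\<in>Q. \<bar>x + \<omega> u\<bar> \<le> c" and u: "u \<in> {0..h}"
    have cad: "cadlag_on {0..} (\<lambda>u. x + \<omega> u)"
      using \<omega>(1) by (intro cadlag_on_intros cadlag_pathsD(2)) (simp add: space_M)
    show "\<bar>x + \<omega> u\<bar> \<le> c"
    proof (cases "u = h")
      case True
      then show ?thesis using \<omega>(2) u by (auto simp: Q_def)
    next
      case False
      have "x + \<omega> u \<in> {-c..c}"
      proof (rule cadlag_closed_from_rationals[OF cad])
        fix q :: real assume "q \<in> \<rat>" "u < q" "q < h"
        then have "\<bar>x + \<omega> q\<bar> \<le> c" using \<omega>(2) u by (auto simp: Q_def)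
        then show "x + \<omega> q \<in> {-c..c}" by auto
      qed (use u False in auto)
      then show ?thesis by auto
    qed
  qed (auto simp: Q_def)
  also have "\<dots> \<in> events"
    using \<open>countable Q\<close> by measurable
  finally show ?thesis .
qed

text \<open>The elementary control: a definite net displacement without a large excursion. The
  factor 4 leaves room for one jump of size up to \<open>3 * \<delta>\<close> and small oscillations
  on either side of it.\<close>

definition move :: "real \<Rightarrow> real \<Rightarrow> real \<Rightarrow> (real \<Rightarrow> real) set" where
  "move h \<delta> s = {\<omega>\<in>space M. (\<forall>u\<in>{0..h}. \<bar>\<omega> u\<bar> \<le> 4 * \<delta>) \<and> \<delta> \<le> s * \<omega> h}"

lemma move_event: "move h \<delta> s \<in> events"
proof -
  have "move h \<delta> s = {\<omega>\<in>space M. \<forall>u\<in>{0..h}. \<bar>0 + \<omega> u\<bar> \<le> 4 * \<delta>} \<inter> {\<omega>\<in>space M. \<delta> \<le> s * \<omega> h}"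
    by (auto simp: move_def)
  also have "\<dots> \<in> events" by (rule sets.Int[OF tube_event]) measurable
  finally show ?thesis .
qed

lemma move_determined: "0 \<le> h \<Longrightarrow> determined_on {0..h} (move h \<delta> s)"
  by (auto simp: determined_on_def move_def space_M)

end

text \<open>Jump sizes below 1 are those common to the truncated and the non-truncated
  process.\<close>

locale jumping_paths = stationary_paths +
  assumes jumps_occur: "\<And>u v s. 0 < u \<Longrightarrow> u < v \<Longrightarrow> v < 1 \<Longrightarrow> \<bar>s\<bar> = 1 \<Longrightarrow>
    \<not> (AE \<omega> in M. \<forall>t\<in>{0<..1}. s * jump \<omega> t \<notin> {u..v})"
begin

text \<open>A jump of size about \<open>2 \<delta>\<close> is surrounded by rational times between which the path does little
  else; one of the countably many pairs of times has positive probability.\<close>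

lemma move_positive:
  assumes \<delta>: "0 < \<delta>" "3 * \<delta> < 1" and s: "\<bar>s\<bar> = 1" and h0: "0 < h0"
  shows "\<exists>h>0. h < h0 \<and> 0 < prob (move h \<delta> s)"
proof (rule ccontr)
  assume "\<not> ?thesis"
  then have null: "prob (move h \<delta> s) = 0" if "0 < h" "h < h0" for h
    using that by (metis measure_nonneg less_eq_real_def)
  \<comment> \<open>By stationarity a null move starting at 0 is null from every rational time, so
    all rational intervals shorter than \<open>h0\<close> are excluded at once.\<close>
  have "AE \<omega> in M. path_shift (of_rat q) \<omega> \<notin> move (of_rat r - of_rat q) \<delta> s"
    if "q < r" "of_rat r - of_rat q < h0" for q r :: rat
  proof (rule AE_shift)
    have "prob (move (of_rat r - of_rat q) \<delta> s) = 0" using that by (intro null) (auto simp: of_rat_less)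
    then show "AE \<omega> in M. \<omega> \<notin> move (of_rat r - of_rat q) \<delta> s"
      using move_event by (intro AE_not_in) (auto simp: null_sets_def emeasure_eq_measure)
  qed
  then have ae: "AE \<omega> in M. \<forall>q r :: rat. q < r \<and> of_rat r - of_rat q < h0 \<longrightarrow>
      path_shift (of_rat q) \<omega> \<notin> move (of_rat r - of_rat q) \<delta> s"
    by (simp add: AE_all_countable)
  have "AE \<omega> in M. \<forall>t\<in>{0<..1}. s * jump \<omega> t \<notin> {2 * \<delta>..3 * \<delta>}"
    using ae AE_space
  proof eventually_elim
    case (elim \<omega>)
    then have no: "path_shift (of_rat q) \<omega> \<notin> move (of_rat r - of_rat q) \<delta> s"
      if "q < r" "of_rat r - of_rat q < h0" for q r :: rat
      using that by blast
    have \<omega>: "\<omega> \<in> cadlag_paths" using elim by (simp add: space_M)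
    show ?case
    proof (intro ballI notI)
      fix t :: real assume t: "t \<in> {0<..1}" and j: "s * jump \<omega> t \<in> {2 * \<delta>..3 * \<delta>}"
      obtain l where l: "(\<omega> \<longlongrightarrow> l) (at_left t)"
        using \<omega> by (auto simp: cadlag_paths_def cadlag_on_def)
      have r: "(\<omega> \<longlongrightarrow> \<omega> t) (at t within {t..})"
        using \<omega> by (auto simp: cadlag_paths_def cadlag_on_def continuous_within)
      have jl: "jump \<omega> t = \<omega> t - l"
        unfolding jump_def using tendsto_Lim[OF trivial_limit_at_left_real l] by simp
      \<comment> \<open>Oscillations of at most \<open>e\<close> before and after the jump leave a
        net displacement of at least \<open>2 * \<delta> - 2 * e\<close> and an excursion of at most
        \<open>3 * \<delta> + 2 * e\<close>, within the bounds \<open>\<delta>\<close> and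
        \<open>4 * \<delta>\<close>.\<close>
      define e where "e = \<delta> / 4"
      have e: "0 < e" using \<delta> by (simp add: e_def)
      obtain d1 where "0 < d1" and d1: "\<And>u. u < t \<Longrightarrow> dist u t < d1 \<Longrightarrow> dist (\<omega> u) l < e"
        using tendstoD[OF l e] unfolding eventually_at by auto
      obtain d2 where "0 < d2" and d2: "\<And>u. t \<le> u \<Longrightarrow> u \<noteq> t \<Longrightarrow> dist u t < d2 \<Longrightarrow> dist (\<omega> u) (\<omega> t) < e"
        using tendstoD[OF r e] unfolding eventually_at by auto
      \<comment> \<open>Staying within \<open>h0 / 2\<close> of \<open>t\<close> on each side makes
        the interval from \<open>q\<close> to \<open>p\<close> shorter than
        \<open>h0\<close>.\<close>
      obtain q where q: "t - min d1 (h0 / 2) < of_rat q" "of_rat q < t"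
        using of_rat_dense[of "t - min d1 (h0 / 2)" t] \<open>0 < d1\<close> h0 by auto
      obtain p where p: "t < of_rat p" "of_rat p < t + min d2 (h0 / 2)"
        using of_rat_dense[of t "t + min d2 (h0 / 2)"] \<open>0 < d2\<close> h0 by auto
      define q' p' :: real where "q' = of_rat q" and "p' = of_rat p"
      note q = q[folded q'_def] and p = p[folded p'_def]
      have left: "\<bar>\<omega> u - l\<bar> < e" if "q' \<le> u" "u < t" for u
        using d1[of u] that q by (auto simp: dist_real_def)
      have right: "\<bar>\<omega> u - \<omega> t\<bar> < e" if "t \<le> u" "u \<le> p'" for u
        using d2[of u] that p e by (cases "u = t") (auto simp: dist_real_def)
      have sj: "2 * \<delta> \<le> s * (\<omega> t - l)" "\<bar>\<omega> t - l\<bar> \<le> 3 * \<delta>"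
      proof -
        show *: "2 * \<delta> \<le> s * (\<omega> t - l)" using j jl by simp
        have "\<bar>s * (\<omega> t - l)\<bar> \<le> 3 * \<delta>" using * j jl \<delta> by simp
        then show "\<bar>\<omega> t - l\<bar> \<le> 3 * \<delta>" using s by (simp add: abs_mult)
      qed
      have lq: "\<bar>\<omega> q' - l\<bar> < e" using left[of q'] q by simp
      have small: "\<bar>\<omega> u - \<omega> q'\<bar> \<le> 4 * \<delta>" if "q' \<le> u" "u \<le> p'" for u
      proof (cases "u < t")
        case True
        then show ?thesis using left[of u] lq that e unfolding e_def by linarith
      next
        case False
        then show ?thesis using right[of u] lq that sj(2) e unfolding e_def by linarith
      qed
      have "\<delta> \<le> s * (\<omega> p' - \<omega> q')"
      proof -
        have "\<bar>s * ((\<omega> p' - \<omega> t) - (\<omega> q' - l))\<bar> \<le> 2 * e"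
          using right[of p'] lq p s by (simp add: abs_mult)
        moreover have "s * (\<omega> p' - \<omega> q') = s * (\<omega> t - l) + s * ((\<omega> p' - \<omega> t) - (\<omega> q' - l))"
          by (simp add: algebra_simps)
        ultimately show ?thesis using sj(1) by (simp add: e_def)
      qed
      then have "path_shift q' \<omega> \<in> move (p' - q') \<delta> s"
        using small shift_in_space[OF \<omega>] q p
        by (auto simp: move_def space_M path_shift_def)
      moreover have "q < p" using q p unfolding q'_def p'_def by (metis less_trans of_rat_less)
      ultimately show False using no[of q p] q p unfolding q'_def p'_def by auto
    qed
  qed
  then show False using jumps_occur[of "2 * \<delta>" "3 * \<delta>" s] \<delta> s by auto
qed

text \<open>Closed-loop control: move towards \<open>0\<close> as long as possible, and round the position to a grid of
  mesh \<open>\<eta>\<close> after each move, in order to condition on events of positive probability only.\<close>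

lemma tube_positive:
  assumes \<epsilon>: "0 < \<epsilon>"
  shows "0 < prob {\<omega>\<in>space M. \<forall>u\<in>{0..T}. \<bar>\<omega> u\<bar> \<le> \<epsilon>}"
proof -
  \<comment> \<open>The budget of \<open>10 * \<delta>\<close>: \<open>5 * \<delta>\<close> for the
    position before a move, \<open>4 * \<delta>\<close> for the excursion during it, and
    \<open>\<delta>\<close> for all rounding errors together.\<close>
  define \<delta> where "\<delta> = min (1 / 4) (\<epsilon> / 10)"
  have \<delta>: "0 < \<delta>" "3 * \<delta> < 1" "10 * \<delta> \<le> \<epsilon>" using \<epsilon> by (auto simp: \<delta>_def)
  obtain hU hD where hU: "0 < hU" "0 < prob (move hU \<delta> 1)" and hD: "0 < hD" "0 < prob (move hD \<delta> (- 1))"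
    using move_positive[OF \<delta>(1,2), of 1 1] move_positive[OF \<delta>(1,2), of "-1" 1] by auto
  \<comment> \<open>The two moves have different durations; the shorter one counts as the time
    guaranteed per move.\<close>
  define h where "h = min hU hD"
  have h: "0 < h" using hU hD by (simp add: h_def)
  \<comment> \<open>The start \<open>x\<close> is general because each induction step restarts from
    a grid point; every rounding widens the tube by \<open>\<eta>\<close>.\<close>
  have claim: "0 < prob {\<omega>\<in>space M. \<forall>u\<in>{0..real n * h}. \<bar>x + \<omega> u\<bar> \<le> 9 * \<delta> + real n * \<eta>}"
    if "\<bar>x\<bar> \<le> 5 * \<delta>" "0 < \<eta>" "\<eta> \<le> \<delta>" for n x \<eta>
    using that
  proof (induction n arbitrary: x)
    case 0
    have "{\<omega>\<in>space M. \<forall>u\<in>{0..real 0 * h}. \<bar>x + \<omega> u\<bar> \<le> 9 * \<delta> + real 0 * \<eta>} = space M"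
      using 0 \<delta> by (auto simp: space_M cadlag_pathsD(1))
    then show ?case by (simp add: prob_space)
  next
    case (Suc n)
    define s :: real where "s = (if 0 \<le> x then - 1 else 1)"
    define k where "k = (if 0 \<le> x then hD else hU)"
    have k: "0 < k" "h \<le> k" "0 < prob (move k \<delta> s)"
      using hU hD by (auto simp: k_def s_def h_def)
    define y where "y j = \<eta> * real_of_int j" for j :: int
    define A where "A j = move k \<delta> s \<inter> {\<omega>\<in>space M. \<lfloor>(x + \<omega> k) / \<eta>\<rfloor> = j}" for j
    have Aev: "A j \<in> events" for j
      unfolding A_def by (rule sets.Int[OF move_event]) measurable
    have "move k \<delta> s \<subseteq> (\<Union>j. A j)" by (auto simp: A_def move_def)
    then have "prob (move k \<delta> s) \<le> prob (\<Union>j. A j)"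
      by (rule finite_measure_mono) (use Aev in auto)
    then have "prob (\<Union>j. A j) \<noteq> 0" using k by simp
    moreover have "prob (\<Union>j. A j) = 0" if "\<And>j. prob (A j) = 0"
    proof -
      have "A j \<in> null_sets M" for j
        using Aev that by (auto simp: null_sets_def emeasure_eq_measure)
      then have "(\<Union>j. A j) \<in> null_sets M" by (intro null_sets_UN) auto
      then show ?thesis by (simp add: measure_eq_0_null_sets)
    qed
    ultimately have "\<exists>j. prob (A j) \<noteq> 0" by blast
    then obtain j where j: "0 < prob (A j)" by (metis measure_nonneg less_eq_real_def)
    have near: "\<bar>x + \<omega> k - y j\<bar> \<le> \<eta>" if "\<omega> \<in> A j" for \<omega>
    proof -
      have "y j \<le> x + \<omega> k" "x + \<omega> k \<le> y j + \<eta>"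
        using that Suc.prems(2) floor_correct[of "(x + \<omega> k) / \<eta>"]
        by (auto simp: A_def y_def field_simps)
      then show ?thesis by simp
    qed
    \<comment> \<open>A move towards 0 by between \<open>\<delta>\<close> and
      \<open>4 * \<delta>\<close> brings \<open>5 * \<delta>\<close> down to
      \<open>4 * \<delta>\<close>, and rounding by at most \<open>\<delta>\<close> restores the
      invariant of the induction.\<close>
    have final: "\<bar>x + \<omega> k\<bar> \<le> 4 * \<delta>" if "\<omega> \<in> move k \<delta> s" for \<omega>
    proof -
      have "\<bar>\<omega> k\<bar> \<le> 4 * \<delta>" "\<delta> \<le> s * \<omega> k" using that k by (auto simp: move_def)
      then show ?thesis using Suc.prems(1) by (auto simp: s_def split: if_splits)
    qed
    have "A j \<noteq> {}" using j by auto
    then obtain \<omega>0 where \<omega>0: "\<omega>0 \<in> A j" by blast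
    then have yj: "\<bar>y j\<bar> \<le> 5 * \<delta>"
      using near[OF \<omega>0] final[of \<omega>0] Suc.prems(3) by (auto simp: A_def)
    define B where "B = {\<omega>\<in>space M. \<forall>u\<in>{0..real n * h}. \<bar>y j + \<omega> u\<bar> \<le> 9 * \<delta> + real n * \<eta>}"
    have B: "B \<in> events" unfolding B_def by (rule tube_event)
    have "determined_on {..k} (A j)"
      using k by (auto simp: determined_on_def A_def move_def space_M)
    moreover have "determined_on {0..} B"
      by (auto simp: determined_on_def B_def space_M)
    ultimately have "prob (A j \<inter> (path_shift k -` B \<inter> space M)) = prob (A j) * prob B"
      using k by (intro indep_at Aev B) auto
    also have "\<dots> > 0" using j Suc.IH[OF yj Suc.prems(2,3)] by (simp add: B_def)
    also have "A j \<inter> (path_shift k -` B \<inter> space M) \<subseteq>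
        {\<omega>\<in>space M. \<forall>u\<in>{0..real (Suc n) * h}. \<bar>x + \<omega> u\<bar> \<le> 9 * \<delta> + real (Suc n) * \<eta>}"
    proof (intro subsetI CollectI conjI ballI)
      fix \<omega> u assume \<omega>: "\<omega> \<in> A j \<inter> (path_shift k -` B \<inter> space M)" and u: "u \<in> {0..real (Suc n) * h}"
      have n\<eta>: "0 \<le> real n * \<eta>" using Suc.prems by simp
      show "\<bar>x + \<omega> u\<bar> \<le> 9 * \<delta> + real (Suc n) * \<eta>"
      proof (cases "u \<le> k")
        case True
        then have "\<bar>\<omega> u\<bar> \<le> 4 * \<delta>" using \<omega> u by (auto simp: A_def move_def)
        then show ?thesis using Suc.prems n\<eta> unfolding of_nat_Suc distrib_right by linarith
      next
        case False
        then have "u - k \<in> {0..real n * h}" using u k by (auto simp: algebra_simps)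
        then have "\<bar>y j + path_shift k \<omega> (u - k)\<bar> \<le> 9 * \<delta> + real n * \<eta>"
          using \<omega> by (auto simp: B_def)
        then have "\<bar>y j + (\<omega> u - \<omega> k)\<bar> \<le> 9 * \<delta> + real n * \<eta>"
          by (simp add: path_shift_def)
        then show ?thesis using near[of \<omega>] \<omega> by (simp add: distrib_right)
      qed
    qed auto
    ultimately show ?case
      using finite_measure_mono[OF _ tube_event] by (meson less_le_trans)
  qed
  define n where "n = nat \<lceil>T / h\<rceil>"
  have n: "T \<le> real n * h" using h by (simp add: n_def pos_divide_le_eq[symmetric]) linarith
  \<comment> \<open>The mesh is chosen after the number \<open>n\<close> of moves, so that
    \<open>n\<close> rounding errors add up to at most \<open>\<delta>\<close>.\<close>
  define \<eta> where "\<eta> = \<delta> / (real n + 1)"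
  have \<eta>: "0 < \<eta>" "\<eta> \<le> \<delta>" "real n * \<eta> \<le> \<delta>" using \<delta> by (auto simp: \<eta>_def field_simps)
  have "0 < prob {\<omega>\<in>space M. \<forall>u\<in>{0..real n * h}. \<bar>0 + \<omega> u\<bar> \<le> 9 * \<delta> + real n * \<eta>}"
    using claim[OF _ \<eta>(1,2), of 0 n] \<delta> by simp
  also have "\<dots> \<le> prob {\<omega>\<in>space M. \<forall>u\<in>{0..T}. \<bar>0 + \<omega> u\<bar> \<le> \<epsilon>}"
  proof (rule finite_measure_mono[OF _ tube_event], intro subsetI CollectI conjI ballI)
    fix \<omega> u assume *: "\<omega> \<in> {\<omega>\<in>space M. \<forall>u\<in>{0..real n * h}. \<bar>0 + \<omega> u\<bar> \<le> 9 * \<delta> + real n * \<eta>}"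
      and "u \<in> {0..T}"
    then have "u \<in> {0..real n * h}" using n by auto
    then have "\<bar>0 + \<omega> u\<bar> \<le> 9 * \<delta> + real n * \<eta>" using * by blast
    then show "\<bar>0 + \<omega> u\<bar> \<le> \<epsilon>" using \<eta>(3) \<delta>(3) by linarith
  qed auto
  finally show ?thesis by simp
qed

end

section \<open>Jumps of stable processes\<close>

text \<open>The number of jumps with size in \<open>B\<close> during \<open>{0<..1}\<close> is
  Poisson with the positive finite parameter given by the mass of \<open>B\<close>, so it is 0 with
  probability less than 1.\<close>

lemma levy_measure_jumps_occur:
  assumes M: "levy_process_with_measure \<nu> M" and \<nu>: "sets \<nu> = sets borel" "sigma_finite_measure \<nu>"
    and B: "B \<in> sets borel" "0 < emeasure \<nu> B" "emeasure \<nu> B < \<infinity>"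
  shows "\<not> (AE \<omega> in M. \<forall>t\<in>{0<..1}. jump \<omega> t \<notin> B)"
proof
  assume ae: "AE \<omega> in M. \<forall>t\<in>{0<..1}. jump \<omega> t \<notin> B"
  interpret prob_space M
    using M by (simp add: levy_process_with_measure_def two_sided_levy_process_def)
  interpret \<nu>: sigma_finite_measure \<nu> by (rule \<nu>)
  have prm: "poisson_random_measure M jump_measure (lborel \<Otimes>\<^sub>M \<nu>)"
    using M by (simp add: levy_process_with_measure_def)
  define A where "A = {0<..1::real} \<times> B"
  have A: "A \<in> sets (lborel \<Otimes>\<^sub>M \<nu>)"
    unfolding A_def using B(1) \<nu>(1) by (intro pair_measureI) auto
  have Ab: "A \<in> sets (borel \<Otimes>\<^sub>M borel)"
    unfolding A_def using B(1) by (intro pair_measureI) auto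
  have eA: "emeasure (lborel \<Otimes>\<^sub>M \<nu>) A = emeasure \<nu> B"
    unfolding A_def using B(1) \<nu>(1) by (subst \<nu>.emeasure_pair_measure_Times) auto
  have "measure M {\<omega>\<in>space M. emeasure (jump_measure \<omega>) A = of_nat 0} =
      measure (lborel \<Otimes>\<^sub>M \<nu>) A ^ 0 / fact 0 * exp (- measure (lborel \<Otimes>\<^sub>M \<nu>) A)"
  proof -
    have "\<forall>A\<in>sets (lborel \<Otimes>\<^sub>M \<nu>). emeasure (lborel \<Otimes>\<^sub>M \<nu>) A < \<infinity> \<longrightarrow>
        (\<forall>k::nat. prob {\<omega>\<in>space M. emeasure (jump_measure \<omega>) A = of_nat k} =
          measure (lborel \<Otimes>\<^sub>M \<nu>) A ^ k / fact k * exp (- measure (lborel \<Otimes>\<^sub>M \<nu>) A))"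
      using prm unfolding poisson_random_measure_def by (elim conjE)
    then show ?thesis using A B(3) eA by (simp only:)
  qed
  moreover have "0 < measure (lborel \<Otimes>\<^sub>M \<nu>) A"
    using eA B(2,3) by (simp add: measure_def enn2real_positive_iff)
  ultimately have less: "prob {\<omega>\<in>space M. emeasure (jump_measure \<omega>) A = 0} < 1" by simp
  have "AE \<omega> in M. emeasure (jump_measure \<omega>) A = 0"
    using ae
  proof eventually_elim
    case (elim \<omega>)
    have "emeasure (jump_measure \<omega>) A =
        emeasure (count_space {s. jump \<omega> s \<noteq> 0}) ((\<lambda>s. (s, jump \<omega> s)) -` A \<inter> {s. jump \<omega> s \<noteq> 0})"
      unfolding jump_measure_def by (subst emeasure_distr[OF _ Ab]) (auto simp: space_pair_measure)
    also have "(\<lambda>s. (s, jump \<omega> s)) -` A \<inter> {s. jump \<omega> s \<noteq> 0} = {}"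
      using elim by (auto simp: A_def)
    finally show ?case by simp
  qed
  moreover have "{\<omega>\<in>space M. emeasure (jump_measure \<omega>) A = 0} \<in> events"
  proof -
    have [measurable]: "(\<lambda>\<omega>. emeasure (jump_measure \<omega>) A) \<in> borel_measurable M"
      using prm A by (simp add: poisson_random_measure_def)
    show ?thesis by measurable
  qed
  ultimately have "prob {\<omega>\<in>space M. emeasure (jump_measure \<omega>) A = 0} = 1"
    by (simp add: prob_Collect_eq_1)
  then show False using less by simp
qed

section \<open>Stable Levy measures of intervals\<close>

lemma stable_const_pos: "0 < \<alpha> \<Longrightarrow> \<alpha> < 2 \<Longrightarrow> 0 < stable_const \<alpha>"
  unfolding stable_const_def by (intro mult_pos_pos divide_pos_pos Gamma_real_pos) auto

lemma stable_levy_measure_sets: "sets (stable_levy_measure \<alpha>) = sets borel"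
  by (simp add: stable_levy_measure_def)

lemma truncated_levy_measure_sets: "sets (truncated_levy_measure \<alpha>) = sets borel"
  by (simp add: truncated_levy_measure_def stable_levy_measure_sets)

lemma sigma_finite_stable_levy_measure: "sigma_finite_measure (stable_levy_measure \<alpha>)"
  unfolding stable_levy_measure_def by (subst sigma_finite_measure.sigma_finite_iff_density_finite[OF sigma_finite_lborel]) auto

lemma sigma_finite_truncated_levy_measure: "sigma_finite_measure (truncated_levy_measure \<alpha>)"
  unfolding truncated_levy_measure_def
  by (subst sigma_finite_measure.sigma_finite_iff_density_finite[OF sigma_finite_stable_levy_measure])
    (auto simp: stable_levy_measure_sets measurable_cong_sets[OF stable_levy_measure_sets refl] indicator_def)

text \<open>The density decreases in \<open>\<bar>z\<bar>\<close>, so the mass lies between the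
  length of the interval times the density at \<open>v\<close> and at \<open>u\<close>.\<close>

lemma stable_levy_measure_interval:
  fixes s u v :: real
  assumes \<alpha>: "0 < \<alpha>" "\<alpha> < 2" and uv: "0 < u" "u < v" and s: "\<bar>s\<bar> = 1"
  shows "0 < emeasure (stable_levy_measure \<alpha>) {z. s * z \<in> {u..v}}"
    "emeasure (stable_levy_measure \<alpha>) {z. s * z \<in> {u..v}} < \<infinity>"
proof -
  define B where "B = {z. s * z \<in> {u..v}}"
  have "s = 1 \<or> s = - 1" using s by auto
  then have "B = {u..v} \<or> B = {- v..- u}" by (auto simp: B_def)
  then have lB: "emeasure lborel B = ennreal (v - u)" and B [measurable]: "B \<in> sets borel"
    using uv by auto
  have Bz: "u \<le> \<bar>z\<bar>" "\<bar>z\<bar> \<le> v" if "z \<in> B" for z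
    using that \<open>s = 1 \<or> s = - 1\<close> uv by (auto simp: B_def)
  define c where "c = stable_const \<alpha>"
  have c: "0 < c" unfolding c_def by (rule stable_const_pos[OF \<alpha>])
  have em: "emeasure (stable_levy_measure \<alpha>) B =
      (\<integral>\<^sup>+z. ennreal (c * \<bar>z\<bar> powr (- 1 - \<alpha>)) * indicator B z \<partial>lborel)"
    unfolding stable_levy_measure_def c_def by (subst emeasure_density) auto
  have "ennreal (c * v powr (- 1 - \<alpha>)) * emeasure lborel B =
      (\<integral>\<^sup>+z. ennreal (c * v powr (- 1 - \<alpha>)) * indicator B z \<partial>lborel)"
    by (simp add: nn_integral_cmult_indicator)
  also have "\<dots> \<le> emeasure (stable_levy_measure \<alpha>) B"
    unfolding em
  proof (rule nn_integral_mono)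
    fix z show "ennreal (c * v powr (- 1 - \<alpha>)) * indicator B z \<le> ennreal (c * \<bar>z\<bar> powr (- 1 - \<alpha>)) * indicator B z"
      using Bz[of z] c \<alpha> uv by (auto simp: indicator_def intro!: ennreal_leI mult_left_mono powr_mono2')
  qed
  finally have "ennreal (c * v powr (- 1 - \<alpha>)) * ennreal (v - u) \<le> emeasure (stable_levy_measure \<alpha>) B"
    by (simp add: lB)
  moreover have "0 < ennreal (c * v powr (- 1 - \<alpha>)) * ennreal (v - u)"
    using c uv by (simp add: ennreal_zero_less_mult_iff)
  ultimately show "0 < emeasure (stable_levy_measure \<alpha>) {z. s * z \<in> {u..v}}"
    unfolding B_def by (rule less_le_trans[rotated])
  have "emeasure (stable_levy_measure \<alpha>) B \<le>
      (\<integral>\<^sup>+z. ennreal (c * u powr (- 1 - \<alpha>)) * indicator B z \<partial>lborel)"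
    unfolding em
  proof (rule nn_integral_mono)
    fix z show "ennreal (c * \<bar>z\<bar> powr (- 1 - \<alpha>)) * indicator B z \<le> ennreal (c * u powr (- 1 - \<alpha>)) * indicator B z"
      using Bz[of z] c \<alpha> uv by (auto simp: indicator_def intro!: ennreal_leI mult_left_mono powr_mono2')
  qed
  also have "\<dots> = ennreal (c * u powr (- 1 - \<alpha>)) * emeasure lborel B"
    by (simp add: nn_integral_cmult_indicator)
  also have "\<dots> < \<infinity>" by (simp add: lB ennreal_mult_less_top)
  finally show "emeasure (stable_levy_measure \<alpha>) {z. s * z \<in> {u..v}} < \<infinity>" unfolding B_def .
qed

lemma truncated_levy_measure_interval:
  assumes "v < 1" "\<bar>s\<bar> = 1" "0 < u"
  shows "emeasure (truncated_levy_measure \<alpha>) {z. s * z \<in> {u..v}} =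
    emeasure (stable_levy_measure \<alpha>) {z. s * z \<in> {u..v}}"
proof -
  define B where "B = {z. s * z \<in> {u..v}}"
  have s: "s = 1 \<or> s = - 1" using assms by auto
  then have "B = {u..v} \<or> B = {- v..- u}" by (auto simp: B_def)
  then have B: "B \<in> sets (stable_levy_measure \<alpha>)" by (auto simp: stable_levy_measure_sets)
  have [simp]: "indicator {z::real. \<bar>z\<bar> < 1} z * indicator B z = (indicator B z :: ennreal)" for z
    using s assms by (auto simp: indicator_def B_def)
  have "{z::real. \<bar>z\<bar> < 1} \<in> sets borel" by measurable
  then have "emeasure (truncated_levy_measure \<alpha>) B =
      (\<integral>\<^sup>+z. indicator {z. \<bar>z\<bar> < 1} z * indicator B z \<partial>stable_levy_measure \<alpha>)"
    unfolding truncated_levy_measure_def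
    by (intro emeasure_density B borel_measurable_indicator) (simp add: stable_levy_measure_sets)
  also have "\<dots> = emeasure (stable_levy_measure \<alpha>) B" using B by simp
  finally show ?thesis unfolding B_def .
qed

lemma jumping_paths_stable_law:
  assumes \<alpha>: "0 < \<alpha>" "\<alpha> < 2"
    and law: "stable_process_law \<alpha> M \<or> truncated_stable_process_law \<alpha> M"
    and mds: "metric_dynamical_system M path_shift"
  shows "jumping_paths M"
proof -
  obtain \<nu> where M: "levy_process_with_measure \<nu> M"
    and \<nu>: "\<nu> = stable_levy_measure \<alpha> \<or> \<nu> = truncated_levy_measure \<alpha>"
    using law unfolding stable_process_law_def truncated_stable_process_law_def by blast
  have levy: "two_sided_levy_process M" using M by (simp add: levy_process_with_measure_def)
  then interpret prob_space M by (simp add: two_sided_levy_process_def)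
  have shift: "(\<lambda>(t, \<omega>). path_shift t \<omega>) \<in> borel \<Otimes>\<^sub>M M \<rightarrow>\<^sub>M M"
    using mds by (simp add: metric_dynamical_system_def)
  show ?thesis
  proof unfold_locales
    show "space M = cadlag_paths" "sets M = sets path_space"
      using levy by (auto simp: two_sided_levy_process_def)
    show "indep_vars (\<lambda>_. borel) (\<lambda>i \<omega>. \<omega> (t (Suc i)) - \<omega> (t i)) {..<n}"
      if "\<And>i. i < n \<Longrightarrow> t i \<le> t (Suc i)" for n and t :: "nat \<Rightarrow> real"
      using levy that by (simp add: two_sided_levy_process_def)
    show "path_shift t \<in> M \<rightarrow>\<^sub>M M" for t
      using measurable_compose[OF measurable_Pair1'[of t borel M] shift] by simp
    show "distr M M (path_shift t) = M" for t
      using mds by (simp add: metric_dynamical_system_def)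
    fix u v s :: real assume uv: "0 < u" "u < v" "v < 1" and s: "\<bar>s\<bar> = 1"
    have em: "emeasure \<nu> {z. s * z \<in> {u..v}} = emeasure (stable_levy_measure \<alpha>) {z. s * z \<in> {u..v}}"
      using \<nu> truncated_levy_measure_interval[OF uv(3) s uv(1)] by auto
    have "\<not> (AE \<omega> in M. \<forall>t\<in>{0<..1}. jump \<omega> t \<notin> {z. s * z \<in> {u..v}})"
    proof (rule levy_measure_jumps_occur[OF M])
      show "sets \<nu> = sets borel" "sigma_finite_measure \<nu>"
        using \<nu> stable_levy_measure_sets truncated_levy_measure_sets
          sigma_finite_stable_levy_measure sigma_finite_truncated_levy_measure by auto
      show "{z. s * z \<in> {u..v}} \<in> sets borel" by measurable
    qed (use em stable_levy_measure_interval[OF \<alpha> uv(1,2) s] in auto)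
    then show "\<not> (AE \<omega> in M. \<forall>t\<in>{0<..1}. s * jump \<omega> t \<notin> {u..v})" by simp
  qed
qed

section \<open>The random equilibrium\<close>

locale random_equilibrium = jumping_paths +
  fixes \<phi> :: "real \<Rightarrow> (real \<Rightarrow> real) \<Rightarrow> real \<Rightarrow> real" and \<sigma> \<beta> :: real and a :: "(real \<Rightarrow> real) \<Rightarrow> real"
  assumes \<sigma>: "\<sigma> \<noteq> 0"
    and generated: "rds_generated_by M (\<lambda>x. \<beta> * x - x ^ 3) \<sigma> \<phi>"
    and attracting: "attracting_random_equilibrium M path_shift \<phi> a"
begin

section \<open>Flow and linearization\<close>

lemma flow_solves: "\<omega> \<in> cadlag_paths \<Longrightarrow> solves_sde (\<lambda>x. \<beta> * x - x ^ 3) \<sigma> \<omega> x (\<lambda>t. \<phi> t \<omega> x)"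
  using generated by (simp add: rds_generated_by_def space_M)

lemma flow_cadlag: "\<omega> \<in> cadlag_paths \<Longrightarrow> cadlag_on {0..} (\<lambda>t. \<phi> t \<omega> x)"
  by (rule solves_sde_cadlag[OF flow_solves])

lemma flow_0: "\<omega> \<in> cadlag_paths \<Longrightarrow> \<phi> 0 \<omega> x = x"
  using generated by (simp add: rds_generated_by_def random_dynamical_system_def space_M)

lemma flow_measurable: assumes "0 \<le> t" shows "(\<lambda>\<omega>. \<phi> t \<omega> x) \<in> borel_measurable M"
proof -
  have joint: "(\<lambda>(t, \<omega>, x). \<phi> t \<omega> x) \<in> borel_measurable (restrict_space borel {0..} \<Otimes>\<^sub>M M \<Otimes>\<^sub>M borel)"
    using generated by (simp add: rds_generated_by_def random_dynamical_system_def)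
  have "(\<lambda>\<omega>. (t, \<omega>, x)) \<in> M \<rightarrow>\<^sub>M restrict_space borel {0..} \<Otimes>\<^sub>M M \<Otimes>\<^sub>M borel"
    using assms by (intro measurable_Pair measurable_const) (auto simp: space_restrict_space)
  from measurable_compose[OF this joint] show ?thesis by simp
qed

text \<open>The difference formula with equal starting points has a vanishing factor.\<close>

lemma flow_determined:
  assumes "\<omega> \<in> cadlag_paths" "\<omega>' \<in> cadlag_paths" "0 \<le> T" "\<And>t. 0 \<le> t \<Longrightarrow> t \<le> T \<Longrightarrow> \<omega> t = \<omega>' t"
  shows "\<phi> T \<omega> x = \<phi> T \<omega>' x"
  using cubic_sde_difference[OF flow_solves[OF assms(1), of x] flow_solves[OF assms(2), of x] assms(4,3)]
  by simp

lemma linearization_nonneg: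
  assumes "\<omega> \<in> cadlag_paths" "0 \<le> t"
  shows "linearization path_shift \<phi> a t \<omega> = exp (integral {0..t} (\<lambda>s. \<beta> - 3 * (\<phi> s \<omega> (a \<omega>))\<^sup>2))"
  unfolding linearization_def using assms
  by (simp add: DERIV_imp_deriv[OF cubic_flow_has_derivative[OF flow_solves]])

text \<open>Based at the shifted path, the backward linearization is an integral along the forward
  solution from \<open>a \<omega>\<close>; it holds for every path, with no appeal to equivariance
  of \<open>a\<close>.\<close>

lemma linearization_neg:
  assumes "\<omega> \<in> cadlag_paths" "0 < t"
  shows "linearization path_shift \<phi> a (- t) (path_shift t \<omega>) =
    inverse (exp (integral {0..t} (\<lambda>s. \<beta> - 3 * (\<phi> s \<omega> (a \<omega>))\<^sup>2)))"
  unfolding linearization_def using assms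
  by (simp add: DERIV_imp_deriv[OF cubic_flow_has_derivative[OF flow_solves]] path_shift_shift path_shift_0)

lemma linearization_nonzero:
  assumes "\<omega> \<in> cadlag_paths" shows "linearization path_shift \<phi> a t \<omega> \<noteq> 0"
proof (cases "0 \<le> t")
  case False
  then show ?thesis
    using linearization_neg[OF shift_in_space[OF assms, of t], of "- t"]
    by (simp add: path_shift_shift path_shift_0 assms)
qed (simp add: linearization_nonneg assms)

lemma integral_rate:
  assumes "\<omega> \<in> cadlag_paths" "0 \<le> t"
  shows "integral {0..t} (\<lambda>s. \<beta> - 3 * (\<phi> s \<omega> x)\<^sup>2) = \<beta> * t - 3 * integral {0..t} (\<lambda>s. (\<phi> s \<omega> x)\<^sup>2)"
proof -
  have "(\<lambda>s. (\<phi> s \<omega> x)\<^sup>2) integrable_on {0..t}"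
    by (intro cadlag_on_integrable cadlag_on_intros flow_cadlag assms(1)) simp
  then show ?thesis using assms(2)
    by (subst Henstock_Kurzweil_Integration.integral_diff) (auto intro!: integrable_on_mult_right)
qed

section \<open>The equilibrium as a pullback limit\<close>

lemma equilibrium_measurable [measurable]: "a \<in> borel_measurable M"
  using attracting by (simp add: attracting_random_equilibrium_def)

lemma equilibrium_equivariant: "AE \<omega> in M. \<forall>t\<ge>0. \<phi> t \<omega> (a \<omega>) = a (path_shift t \<omega>)"
  using attracting by (auto simp: attracting_random_equilibrium_def)

lemma equilibrium_event:
  assumes [measurable]: "S \<in> sets borel" shows "{\<omega>\<in>space M. a \<omega> \<in> S} \<in> events"
  by measurable

text \<open>Attraction of the bounded set \<open>{0}\<close> along integer times. Both sides being
  functions on the whole space, the right side can serve as a version of \<open>a\<close>.\<close>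

lemma equilibrium_pullback:
  "AE \<omega> in M. a \<omega> = lim (\<lambda>n. \<phi> (real n) (path_shift (- real n) \<omega>) 0)"
proof -
  have "AE \<omega> in M. \<forall>B. bounded B \<longrightarrow>
      ((\<lambda>t. SUP x\<in>B. ennreal \<bar>\<phi> t (path_shift (- t) \<omega>) x - a \<omega>\<bar>) \<longlongrightarrow> 0) at_top"
    using attracting by (auto simp: attracting_random_equilibrium_def)
  then show ?thesis
  proof eventually_elim
    case (elim \<omega>)
    have "((\<lambda>t. ennreal \<bar>\<phi> t (path_shift (- t) \<omega>) 0 - a \<omega>\<bar>) \<longlongrightarrow> ennreal 0) at_top"
      using elim[rule_format, of "{0}"] by simp
    then have "((\<lambda>t. \<bar>\<phi> t (path_shift (- t) \<omega>) 0 - a \<omega>\<bar>) \<longlongrightarrow> 0) at_top"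
      by (subst (asm) tendsto_ennreal_iff) auto
    then have "((\<lambda>t. \<phi> t (path_shift (- t) \<omega>) 0) \<longlongrightarrow> a \<omega>) at_top"
      by (simp add: tendsto_rabs_zero_iff LIM_zero_iff)
    then have "(\<lambda>n. \<phi> (real n) (path_shift (- real n) \<omega>) 0) \<longlonglongrightarrow> a \<omega>"
      by (rule filterlim_compose[OF _ filterlim_real_sequentially])
    then show ?case by (simp add: limI)
  qed
qed

text \<open>As a pullback limit, \<open>a\<close> depends on the past of the noise only.\<close>

lemma equilibrium_indep_future:
  assumes S: "S \<in> sets borel" and B: "B \<in> events" "determined_on {0..} B"
  shows "prob ({\<omega>\<in>space M. a \<omega> \<in> S} \<inter> B) = prob {\<omega>\<in>space M. a \<omega> \<in> S} * prob B"
proof -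
  \<comment> \<open>\<open>a\<close> depends on the past only up to a null set; the version
    \<open>b\<close> does so for every path.\<close>
  define b where "b \<omega> = lim (\<lambda>n. \<phi> (real n) (path_shift (- real n) \<omega>) 0)" for \<omega>
  have ab: "AE \<omega> in M. a \<omega> = b \<omega>" unfolding b_def by (rule equilibrium_pullback)
  have [measurable]: "b \<in> borel_measurable M"
    unfolding b_def
    by (intro borel_measurable_lim_metric measurable_compose[OF shift_measurable] flow_measurable) simp
  have Sb: "{\<omega>\<in>space M. b \<omega> \<in> S} \<in> events" using S by measurable
  have "determined_on {..0} {\<omega>\<in>space M. b \<omega> \<in> S}"
    unfolding determined_on_def
  proof (intro ballI impI)
    fix \<omega> \<omega>' assume *: "\<omega> \<in> cadlag_paths" "\<omega>' \<in> cadlag_paths" "\<forall>t\<in>{..0}. \<omega> t = \<omega>' t"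
    have "\<phi> (real n) (path_shift (- real n) \<omega>) 0 = \<phi> (real n) (path_shift (- real n) \<omega>') 0" for n
      by (rule flow_determined[OF shift_in_space shift_in_space])
        (use * in \<open>auto simp: path_shift_def\<close>)
    then show "\<omega> \<in> {\<omega>\<in>space M. b \<omega> \<in> S} \<longleftrightarrow> \<omega>' \<in> {\<omega>\<in>space M. b \<omega> \<in> S}"
      using * by (simp add: b_def space_M)
  qed
  then have "prob ({\<omega>\<in>space M. b \<omega> \<in> S} \<inter> B) = prob {\<omega>\<in>space M. b \<omega> \<in> S} * prob B"
    by (intro past_future_indep Sb B)
  moreover have "prob ({\<omega>\<in>space M. b \<omega> \<in> S} \<inter> B) = prob ({\<omega>\<in>space M. a \<omega> \<in> S} \<inter> B)"
    by (rule finite_measure_eq_AE) (use ab Sb B equilibrium_event[OF S] in auto)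
  moreover have "prob {\<omega>\<in>space M. b \<omega> \<in> S} = prob {\<omega>\<in>space M. a \<omega> \<in> S}"
    by (rule finite_measure_eq_AE) (use ab Sb equilibrium_event[OF S] in auto)
  ultimately show ?thesis by simp
qed

section \<open>Support of the law of the equilibrium\<close>

lemma prob_eq_0_AE: "A \<in> events \<Longrightarrow> AE \<omega> in M. \<omega> \<notin> A \<Longrightarrow> prob A = 0"
  by (simp add: prob_eq_0)

text \<open>Invariance transfers the property to all rational shifts at once, equivariance
  identifies these values with the trajectory, and right-continuity fills in the other
  times.\<close>

lemma equilibrium_stays_closed:
  assumes "AE \<omega> in M. a \<omega> \<in> S" "closed S"
  shows "AE \<omega> in M. \<forall>t\<ge>0. \<phi> t \<omega> (a \<omega>) \<in> S"
proof -
  have "AE \<omega> in M. \<forall>q\<in>\<rat>. a (path_shift q \<omega>) \<in> S"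
    by (intro AE_ball_countable[THEN iffD2] ballI countable_rat AE_shift assms(1))
  then show ?thesis using equilibrium_equivariant AE_space
  proof eventually_elim
    case (elim \<omega>)
    show ?case
    proof (intro allI impI)
      fix t :: real assume t: "0 \<le> t"
      show "\<phi> t \<omega> (a \<omega>) \<in> S"
        by (rule cadlag_closed_from_rationals[where f = "\<lambda>t. \<phi> t \<omega> (a \<omega>)" and h = "t + 1", OF flow_cadlag t _ assms(2)])
          (use elim t in \<open>auto simp: space_M\<close>)
    qed
  qed
qed

text \<open>The move is independent of \<open>a\<close>, and the equilibrium after time
  \<open>h\<close> has the law of \<open>a\<close> again. Thus moves are iterated on the law of
  \<open>a\<close> alone, without following one trajectory.\<close>

lemma equilibrium_push:
  assumes S: "S \<in> sets borel" "S' \<in> sets borel" and h: "0 \<le> h"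
    and pos: "0 < prob {\<omega>\<in>space M. a \<omega> \<in> S}" "0 < prob (move h \<delta> s)"
    and push: "AE \<omega> in M. \<omega> \<in> move h \<delta> s \<longrightarrow> a \<omega> \<in> S \<longrightarrow> \<phi> h \<omega> (a \<omega>) \<in> S'"
  shows "0 < prob {\<omega>\<in>space M. a \<omega> \<in> S'}"
proof -
  have "0 < prob {\<omega>\<in>space M. a \<omega> \<in> S} * prob (move h \<delta> s)" using pos by simp
  also have "\<dots> = prob ({\<omega>\<in>space M. a \<omega> \<in> S} \<inter> move h \<delta> s)"
    by (rule equilibrium_indep_future[symmetric, OF S(1) move_event determined_on_mono[OF move_determined]])
      (use h in auto)
  also have "\<dots> \<le> prob (path_shift h -` {\<omega>\<in>space M. a \<omega> \<in> S'} \<inter> space M)"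
  proof (rule finite_measure_mono_AE)
    show "AE \<omega> in M. \<omega> \<in> {\<omega>\<in>space M. a \<omega> \<in> S} \<inter> move h \<delta> s \<longrightarrow>
        \<omega> \<in> path_shift h -` {\<omega>\<in>space M. a \<omega> \<in> S'} \<inter> space M"
      using push equilibrium_equivariant
      by eventually_elim (use h in \<open>auto simp: space_M shift_in_space\<close>)
  qed (intro shift_events equilibrium_event S(2))
  also have "\<dots> = prob {\<omega>\<in>space M. a \<omega> \<in> S'}"
    by (rule prob_shift[OF equilibrium_event[OF S(2)]])
  finally show ?thesis .
qed

text \<open>If \<open>\<bar>a\<bar> \<le> R\<close> almost surely, the drift along the trajectory is
  bounded by one constant, and repeated upward moves lift \<open>s * a\<close> above
  \<open>R\<close> with positive probability.\<close>

lemma equilibrium_unbounded: "0 < prob {\<omega>\<in>space M. R < \<bar>a \<omega>\<bar>}"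
proof (rule ccontr)
  assume "\<not> ?thesis"
  then have "prob {\<omega>\<in>space M. R < \<bar>a \<omega>\<bar>} = 0" by (metis measure_nonneg less_eq_real_def)
  then have "AE \<omega> in M. \<not> R < \<bar>a \<omega>\<bar>"
    by (subst (asm) prob_Collect_eq_0) auto
  then have bnd: "AE \<omega> in M. a \<omega> \<in> {-R..R}" by eventually_elim auto
  have "0 \<le> R"
  proof (rule ccontr)
    assume "\<not> 0 \<le> R"
    then have "AE \<omega> in M. False" by (intro eventually_mono[OF bnd]) auto
    then show False by simp
  qed
  have stay: "AE \<omega> in M. \<forall>t\<ge>0. \<phi> t \<omega> (a \<omega>) \<in> {-R..R}"
    by (rule equilibrium_stays_closed[OF bnd]) simp
  \<comment> \<open>A move with \<open>\<delta> = 1 / 4\<close> displaces the noise term by at least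
    \<open>\<bar>\<sigma>\<bar> / 4 = 2 * \<eta>\<close>, of which the drift may consume
    \<open>\<eta>\<close>.\<close>
  define \<eta> where "\<eta> = \<bar>\<sigma>\<bar> / 8"
  have \<eta>: "0 < \<eta>" using \<sigma> by (simp add: \<eta>_def)
  define C where "C = \<bar>\<beta>\<bar> * R + R ^ 3"
  have C: "0 \<le> C" using \<open>0 \<le> R\<close> by (simp add: C_def)
  obtain h where h: "0 < h" "h < \<eta> / (C + 1)" "0 < prob (move h (1 / 4) 1)"
    using move_positive[of "1 / 4" 1 "\<eta> / (C + 1)"] \<eta> C by auto
  have Ch: "C * h \<le> \<eta>" using h C by (simp add: pos_less_divide_eq algebra_simps)
  define s where "s = sgn \<sigma>"
  have s: "\<bar>s\<bar> = 1" "s * \<sigma> = \<bar>\<sigma>\<bar>" using \<sigma> by (auto simp: s_def abs_sgn mult.commute sgn_if)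
  have claim: "0 < prob {\<omega>\<in>space M. a \<omega> \<in> {x. - R + real n * \<eta> \<le> s * x}}" for n
  proof (induction n)
    case 0
    have "AE \<omega> in M. a \<omega> \<in> {x. - R + real 0 * \<eta> \<le> s * x}"
      using bnd
    proof eventually_elim
      case (elim \<omega>)
      then have "\<bar>s * a \<omega>\<bar> \<le> R" using s by (auto simp: abs_mult abs_le_iff)
      then show ?case by auto
    qed
    then have "prob {\<omega>\<in>space M. a \<omega> \<in> {x. - R + real 0 * \<eta> \<le> s * x}} = 1"
      by (subst prob_Collect_eq_1) measurable
    then show ?case by simp
  next
    case (Suc n)
    show ?case
    proof (rule equilibrium_push[OF _ _ _ Suc.IH h(3)])
      show "AE \<omega> in M. \<omega> \<in> move h (1 / 4) 1 \<longrightarrow> a \<omega> \<in> {x. - R + real n * \<eta> \<le> s * x} \<longrightarrow>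
          \<phi> h \<omega> (a \<omega>) \<in> {x. - R + real (Suc n) * \<eta> \<le> s * x}"
        using stay AE_space
      proof (eventually_elim, intro impI)
        fix \<omega> assume \<omega>: "\<forall>t\<ge>0. \<phi> t \<omega> (a \<omega>) \<in> {-R..R}" "\<omega> \<in> space M" "\<omega> \<in> move h (1 / 4) 1"
          "a \<omega> \<in> {x. - R + real n * \<eta> \<le> s * x}"
        have "s * a \<omega> + \<eta> \<le> s * \<phi> h \<omega> (a \<omega>)"
        proof (rule cubic_sde_step_up[OF flow_solves s(1)])
          show "\<bar>\<phi> t \<omega> (a \<omega>)\<bar> \<le> R" if "0 \<le> t" for t
            using \<omega>(1) that by (auto simp: abs_le_iff)
          have "\<bar>\<sigma>\<bar> * (1 / 4) \<le> \<bar>\<sigma>\<bar> * \<omega> h"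
            using \<omega>(3) by (intro mult_left_mono) (auto simp: move_def)
          then show "2 * \<eta> \<le> s * (\<sigma> * \<omega> h)" using s by (simp add: \<eta>_def mult.assoc[symmetric])
        qed (use \<omega> h Ch in \<open>auto simp: space_M C_def\<close>)
        then show "\<phi> h \<omega> (a \<omega>) \<in> {x. - R + real (Suc n) * \<eta> \<le> s * x}"
          using \<omega>(4) by (auto simp: algebra_simps)
      qed
    qed (use h in \<open>auto\<close>)
  qed
  obtain n where n: "2 * R / \<eta> < real n" using reals_Archimedean2 by blast
  have "AE \<omega> in M. \<omega> \<notin> {\<omega>\<in>space M. a \<omega> \<in> {x. - R + real n * \<eta> \<le> s * x}}"
    using bnd
  proof eventually_elim
    case (elim \<omega>)
    then have "\<bar>s * a \<omega>\<bar> \<le> R" using s by (auto simp: abs_mult abs_le_iff)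
    moreover have "2 * R < real n * \<eta>" using n \<eta> by (simp add: pos_divide_less_eq)
    ultimately show ?case by auto
  qed
  then have "prob {\<omega>\<in>space M. a \<omega> \<in> {x. - R + real n * \<eta> \<le> s * x}} = 0"
    by (intro prob_eq_0_AE equilibrium_event) measurable
  then show False using claim[of n] by simp
qed

text \<open>If \<open>a\<close> avoided a neighbourhood of 0, its trajectory would keep its sign
  under small moves, and repeated moves towards 0 would lower \<open>s * a\<close> below 0.\<close>

lemma equilibrium_small:
  assumes \<epsilon>: "0 < \<epsilon>"
  shows "0 < prob {\<omega>\<in>space M. a \<omega> \<in> {-\<epsilon>..\<epsilon>}}"
proof (rule ccontr)
  assume "\<not> ?thesis"
  then have "prob {\<omega>\<in>space M. a \<omega> \<in> {-\<epsilon>..\<epsilon>}} = 0" by (metis measure_nonneg less_eq_real_def)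
  then have "AE \<omega> in M. a \<omega> \<notin> {-\<epsilon>..\<epsilon>}"
    by (subst (asm) prob_Collect_eq_0) auto
  then have away: "AE \<omega> in M. a \<omega> \<in> {x. \<epsilon> \<le> \<bar>x\<bar>}" by eventually_elim auto
  have stay: "AE \<omega> in M. \<forall>t\<ge>0. \<phi> t \<omega> (a \<omega>) \<in> {x. \<epsilon> \<le> \<bar>x\<bar>}"
    by (rule equilibrium_stays_closed[OF away]) (intro closed_Collect_le continuous_intros)
  define I where "I s n = {x. 0 < s * x \<and> s * x \<le> real n}" for s :: real and n
  have I: "I s n \<in> sets borel" for s n unfolding I_def by measurable
  \<comment> \<open>\<open>a\<close> is almost surely nonzero, so the countably many sets
    \<open>I s n\<close> with \<open>s = 1\<close> or \<open>s = - 1\<close> catch almost every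
    value. This fixes a sign and a finite starting height.\<close>
  have "\<exists>s n. \<bar>s\<bar> = 1 \<and> 0 < prob {\<omega>\<in>space M. a \<omega> \<in> I s n}"
  proof (rule ccontr)
    assume "\<not> ?thesis"
    then have null: "prob {\<omega>\<in>space M. a \<omega> \<in> I s n} = 0" if "\<bar>s\<bar> = 1" for s n
      using that by (metis measure_nonneg less_eq_real_def)
    have ae: "AE \<omega> in M. \<forall>n. a \<omega> \<notin> I s n" if "\<bar>s\<bar> = 1" for s
    proof (subst AE_all_countable, intro allI)
      fix n
      show "AE \<omega> in M. a \<omega> \<notin> I s n"
        using null[OF that, of n] equilibrium_event[OF I, of s n] by (subst (asm) prob_Collect_eq_0) auto
    qed
    have "AE \<omega> in M. \<forall>n. a \<omega> \<notin> I 1 n" "AE \<omega> in M. \<forall>n. a \<omega> \<notin> I (- 1) n"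
      by (intro ae; simp)+
    then have "AE \<omega> in M. False"
      using away
    proof eventually_elim
      case (elim \<omega>)
      obtain n where "\<bar>a \<omega>\<bar> \<le> real n" using real_arch_simple by blast
      then show ?case using elim(1)[simplified] elim(2)[simplified] elim(3) \<epsilon>
        by (auto simp: I_def dest!: spec[of _ n])
    qed
    then show False by simp
  qed
  then obtain s N where s: "\<bar>s\<bar> = 1" and N: "0 < prob {\<omega>\<in>space M. a \<omega> \<in> I s N}" by blast
  \<comment> \<open>A move makes excursions of at most \<open>4 * \<delta>\<close>;
    \<open>8 * (\<bar>\<sigma>\<bar> * \<delta>) \<le> \<epsilon>\<close> is then the smallness of
    noise that \<open>cubic_sde_step_down\<close> asks for.\<close>
  define \<delta> where "\<delta> = min (1 / 4) (\<epsilon> / (8 * \<bar>\<sigma>\<bar>))"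
  have \<delta>: "0 < \<delta>" "3 * \<delta> < 1" "8 * (\<bar>\<sigma>\<bar> * \<delta>) \<le> \<epsilon>"
  proof -
    show "0 < \<delta>" "3 * \<delta> < 1" using \<epsilon> \<sigma> by (auto simp: \<delta>_def)
    have "\<delta> \<le> \<epsilon> / (8 * \<bar>\<sigma>\<bar>)" by (simp add: \<delta>_def)
    then show "8 * (\<bar>\<sigma>\<bar> * \<delta>) \<le> \<epsilon>" using \<sigma> by (simp add: field_simps)
  qed
  define \<eta> where "\<eta> = \<bar>\<sigma>\<bar> * \<delta> / 2"
  have \<eta>: "0 < \<eta>" using \<delta> \<sigma> by (simp add: \<eta>_def)
  define C where "C = \<bar>\<beta>\<bar> * (1 + \<bar>\<beta>\<bar>)"
  have C: "0 \<le> C" by (simp add: C_def)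
  \<comment> \<open>\<open>r\<close> is the direction of the noise that drives \<open>X\<close>
    towards 0, because \<open>s * \<sigma> * r = - \<bar>\<sigma>\<bar>\<close>.\<close>
  define r where "r = - s * sgn \<sigma>"
  have r: "\<bar>r\<bar> = 1" using s \<sigma> by (simp add: r_def abs_mult abs_sgn_eq)
  have sr: "s * \<sigma> = - (\<bar>\<sigma>\<bar> * r)" by (simp add: r_def sgn_if)
  obtain h where h: "0 < h" "h < \<eta> / (C + 1)" "0 < prob (move h \<delta> r)"
    using move_positive[OF \<delta>(1,2) r, of "\<eta> / (C + 1)"] \<eta> C by auto
  have Ch: "C * h \<le> \<eta>" using h C by (simp add: pos_less_divide_eq algebra_simps)
  have claim: "0 < prob {\<omega>\<in>space M. a \<omega> \<in> {x. 0 < s * x \<and> s * x \<le> real N - real n * \<eta>}}" for n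
  proof (induction n)
    case 0
    then show ?case using N by (simp add: I_def)
  next
    case (Suc n)
    show ?case
    proof (rule equilibrium_push[OF _ _ _ Suc.IH h(3)])
      show "AE \<omega> in M. \<omega> \<in> move h \<delta> r \<longrightarrow> a \<omega> \<in> {x. 0 < s * x \<and> s * x \<le> real N - real n * \<eta>} \<longrightarrow>
          \<phi> h \<omega> (a \<omega>) \<in> {x. 0 < s * x \<and> s * x \<le> real N - real (Suc n) * \<eta>}"
        using stay AE_space
      proof (eventually_elim, intro impI)
        fix \<omega> assume \<omega>: "\<forall>t\<ge>0. \<phi> t \<omega> (a \<omega>) \<in> {x. \<epsilon> \<le> \<bar>x\<bar>}" "\<omega> \<in> space M" "\<omega> \<in> move h \<delta> r"
          "a \<omega> \<in> {x. 0 < s * x \<and> s * x \<le> real N - real n * \<eta>}"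
        have small: "2 * \<bar>\<sigma> * \<omega> t\<bar> \<le> \<epsilon>" if "0 \<le> t" "t \<le> h" for t
        proof -
          have "\<bar>\<sigma>\<bar> * \<bar>\<omega> t\<bar> \<le> \<bar>\<sigma>\<bar> * (4 * \<delta>)"
            using \<omega>(3) that by (intro mult_left_mono) (auto simp: move_def)
          then show ?thesis using \<delta>(3) by (simp add: abs_mult)
        qed
        have down: "s * (\<sigma> * \<omega> h) \<le> - 2 * \<eta>"
        proof -
          have "\<bar>\<sigma>\<bar> * \<delta> \<le> \<bar>\<sigma>\<bar> * (r * \<omega> h)"
            using \<omega>(3) by (intro mult_left_mono) (auto simp: move_def)
          then show ?thesis by (simp add: \<eta>_def sr mult.assoc[symmetric])
        qed
        have \<omega>c: "\<omega> \<in> cadlag_paths" using \<omega>(2) by (simp add: space_M)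
        have start: "0 < s * \<phi> 0 \<omega> (a \<omega>)" using \<omega>(4) by (simp add: flow_0 \<omega>c)
        have far: "\<epsilon> \<le> \<bar>\<phi> t \<omega> (a \<omega>)\<bar>" if "0 \<le> t" "t \<le> h" for t using \<omega>(1) that by auto
        note step = cubic_sde_step_down[where X = "\<lambda>t. \<phi> t \<omega> (a \<omega>)", OF flow_solves[OF \<omega>c] s
            less_imp_le[OF h(1)] far small \<epsilon> start Ch[unfolded C_def] down]
        have "0 < s * \<phi> h \<omega> (a \<omega>)" "s * \<phi> h \<omega> (a \<omega>) \<le> s * a \<omega> - \<eta>"
          using step by blast+
        then show "\<phi> h \<omega> (a \<omega>) \<in> {x. 0 < s * x \<and> s * x \<le> real N - real (Suc n) * \<eta>}"
          using \<omega>(4) by (auto simp: algebra_simps)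
      qed
    qed (use h in \<open>auto\<close>)
  qed
  obtain n where n: "real N / \<eta> < real n" using reals_Archimedean2 by blast
  then have "real N < real n * \<eta>" using \<eta> by (simp add: pos_divide_less_eq)
  then have "{\<omega>\<in>space M. a \<omega> \<in> {x. 0 < s * x \<and> s * x \<le> real N - real n * \<eta>}} = {}" by auto
  then have "prob {\<omega>\<in>space M. a \<omega> \<in> {x. 0 < s * x \<and> s * x \<le> real N - real n * \<eta>}} = 0"
    by (simp only: measure_empty)
  then show False using claim[of n] by simp
qed

text \<open>Rational times make the event measurable. They run up to 2 because the bound is wanted
  for all times up to and including 1, each approached from the right.\<close>

lemma flow_tube_event: "{\<omega>\<in>space M. \<forall>q\<in>\<rat> \<inter> {0..2}. \<bar>\<phi> q \<omega> 0\<bar> \<le> m} \<in> events"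
proof (rule sets.sets_Collect_countable_All')
  fix q :: real assume "q \<in> \<rat> \<inter> {0..2}"
  then have [measurable]: "(\<lambda>\<omega>. \<phi> q \<omega> 0) \<in> borel_measurable M" by (intro flow_measurable) auto
  show "{\<omega>\<in>space M. \<bar>\<phi> q \<omega> 0\<bar> \<le> m} \<in> events" by measurable
qed (simp add: countable_rat)

text \<open>Each trajectory is bounded on \<open>{0..2}\<close>, so the events for integer
  \<open>m\<close> exhaust the space. Bounding the flow from 0 supplies the reference solution of
  \<open>cubic_sde_large_energy\<close>.\<close>

lemma flow_tube_positive:
  obtains m where "0 < prob {\<omega>\<in>space M. \<forall>q\<in>\<rat> \<inter> {0..2}. \<bar>\<phi> q \<omega> 0\<bar> \<le> m}"
proof -
  define G where "G n = {\<omega>\<in>space M. \<forall>q\<in>\<rat> \<inter> {0..2}. \<bar>\<phi> q \<omega> 0\<bar> \<le> real n}" for n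
  have "\<exists>n. prob (G n) \<noteq> 0"
  proof (rule ccontr)
    assume *: "\<nexists>n. prob (G n) \<noteq> 0"
    have "AE \<omega> in M. \<forall>n. \<omega> \<notin> G n"
    proof (subst AE_all_countable, intro allI AE_not_in)
      show "G n \<in> null_sets M" for n
        using * flow_tube_event[of "real n"] by (auto simp: null_sets_def emeasure_eq_measure G_def)
    qed
    then have "AE \<omega> in M. False" using AE_space
    proof eventually_elim
      case (elim \<omega>)
      then have "\<omega> \<in> cadlag_paths" by (simp add: space_M)
      then obtain B where B: "\<And>t. 0 \<le> t \<Longrightarrow> t \<le> 2 \<Longrightarrow> \<bar>\<phi> t \<omega> 0\<bar> \<le> B"
        using cadlag_on_bounded[OF flow_cadlag] by blast
      obtain n where "B \<le> real n" using real_arch_simple by blast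
      then have "\<bar>\<phi> q \<omega> 0\<bar> \<le> real n" if "0 \<le> q" "q \<le> 2" for q
        using B[OF that] by linarith
      then have "\<omega> \<in> G n" using elim(2) by (auto simp: G_def)
      then show False using elim(1) by blast
    qed
    then show False by simp
  qed
  then obtain n where "0 < prob (G n)" using zero_less_measure_iff by blast
  then show ?thesis using that unfolding G_def by blast
qed

section \<open>Dichotomies for growth rates above and below \<open>\<beta>\<close>\<close>

lemma dichotomy_above:
  assumes "\<beta> < \<gamma>"
  shows "exponential_dichotomy M path_shift (linearization path_shift \<phi> a) \<gamma>"
  unfolding exponential_dichotomy_def
proof (intro exI conjI)
  show "0 < \<gamma> - \<beta>" using assms by simp
  show "invariant_projector M path_shift (linearization path_shift \<phi> a) (\<lambda>_. 1)"
    by (simp add: invariant_projector_def)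
  show "AE \<omega> in M.
      (\<forall>t\<ge>0. norm (linearization path_shift \<phi> a t \<omega> * 1) \<le> 1 * exp ((\<gamma> - (\<gamma> - \<beta>)) * t)) \<and>
      (\<forall>t\<le>0. norm (linearization path_shift \<phi> a t \<omega> * (1 - 1)) \<le> 1 * exp ((\<gamma> + (\<gamma> - \<beta>)) * t))"
  proof (rule AE_I2, intro conjI allI impI)
    fix \<omega> and t :: real assume \<omega>: "\<omega> \<in> space M" and t: "0 \<le> t"
    have "0 \<le> integral {0..t} (\<lambda>s. (\<phi> s \<omega> (a \<omega>))\<^sup>2)"
      using \<omega> by (intro integral_nonneg cadlag_on_integrable cadlag_on_intros flow_cadlag) (auto simp: space_M)
    then show "norm (linearization path_shift \<phi> a t \<omega> * 1) \<le> 1 * exp ((\<gamma> - (\<gamma> - \<beta>)) * t)"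
      using \<omega> t by (simp add: linearization_nonneg integral_rate space_M)
  qed simp
qed simp

text \<open>Near 0 the linearization grows almost like \<open>exp (\<beta> * t)\<close>. Since
  \<open>K\<close> does not depend on the path, it is enough to stay near 0 up to one time
  \<open>T\<close> with positive probability.\<close>

lemma no_uniform_contraction:
  assumes "0 < \<kappa>" "1 \<le> K" "\<gamma> \<le> \<beta>"
  shows "\<not> (AE \<omega> in M. \<forall>t\<ge>0. norm (linearization path_shift \<phi> a t \<omega>) \<le> K * exp ((\<gamma> - \<kappa>) * t))"
proof
  assume ae: "AE \<omega> in M. \<forall>t\<ge>0. norm (linearization path_shift \<phi> a t \<omega>) \<le> K * exp ((\<gamma> - \<kappa>) * t)"
  \<comment> \<open>\<open>\<kappa> * T = ln K + 1\<close>, so for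
    \<open>\<gamma> \<le> \<beta>\<close> the assumed bound at time \<open>T\<close> is at most
    \<open>exp (\<beta> * T - 1)\<close>.\<close>
  define T where "T = (ln K + 1) / \<kappa>"
  have T: "0 < T" using assms by (simp add: T_def add_nonneg_pos)
  define C where "C = 4 * exp ((3 * \<bar>\<beta>\<bar> + 2) * T) + 2"
  have C: "1 \<le> C" by (simp add: C_def)
  \<comment> \<open>With \<open>C\<close> from \<open>cubic_sde_small\<close>, this keeps three
    times the energy up to \<open>T\<close> below 1, the margin left by the choice of
    \<open>T\<close>.\<close>
  define \<epsilon> where "\<epsilon> = min 1 (1 / (3 * C * T + 1))"
  have CT: "0 < 3 * C * T" using C T by simp
  have \<epsilon>: "0 < \<epsilon>" "\<epsilon> \<le> 1" using CT by (auto simp: \<epsilon>_def)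
  have small: "3 * (C * \<epsilon>\<^sup>2 * T) < 1"
  proof -
    have "\<epsilon>\<^sup>2 \<le> \<epsilon>" using \<epsilon> by (simp add: power2_eq_square mult_left_le)
    then have "3 * C * T * \<epsilon>\<^sup>2 \<le> 3 * C * T * \<epsilon>" using CT by (intro mult_left_mono) auto
    also have "\<dots> \<le> 3 * C * T * (1 / (3 * C * T + 1))"
      using CT by (intro mult_left_mono) (auto simp: \<epsilon>_def)
    also have "\<dots> < 1" using CT by simp
    finally show ?thesis by (simp add: algebra_simps)
  qed
  define B where "B = {\<omega>\<in>space M. \<forall>u\<in>{0..T}. \<bar>0 + \<omega> u\<bar> \<le> \<epsilon> / \<bar>\<sigma>\<bar>}"
  have B: "B \<in> events" unfolding B_def by (rule tube_event)
  have Bd: "determined_on {0..} B" by (auto simp: determined_on_def B_def space_M)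
  have "0 < prob B" unfolding B_def using tube_positive[of "\<epsilon> / \<bar>\<sigma>\<bar>" T] \<epsilon> \<sigma> by simp
  then have "0 < prob ({\<omega>\<in>space M. a \<omega> \<in> {-\<epsilon>..\<epsilon>}} \<inter> B)"
    using equilibrium_small[OF \<epsilon>(1)] equilibrium_indep_future[OF _ B Bd, of "{-\<epsilon>..\<epsilon>}"] by simp
  moreover have "prob ({\<omega>\<in>space M. a \<omega> \<in> {-\<epsilon>..\<epsilon>}} \<inter> B) = 0"
  proof (rule prob_eq_0_AE)
    show "AE \<omega> in M. \<omega> \<notin> {\<omega>\<in>space M. a \<omega> \<in> {-\<epsilon>..\<epsilon>}} \<inter> B"
      using ae
    proof (eventually_elim, intro notI)
      fix \<omega> assume bound: "\<forall>t\<ge>0. norm (linearization path_shift \<phi> a t \<omega>) \<le> K * exp ((\<gamma> - \<kappa>) * t)"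
        and "\<omega> \<in> {\<omega>\<in>space M. a \<omega> \<in> {-\<epsilon>..\<epsilon>}} \<inter> B"
      then have \<omega>: "\<omega> \<in> cadlag_paths" "\<bar>a \<omega>\<bar> \<le> \<epsilon>" "\<And>u. 0 \<le> u \<Longrightarrow> u \<le> T \<Longrightarrow> \<bar>\<omega> u\<bar> \<le> \<epsilon> / \<bar>\<sigma>\<bar>"
        by (auto simp: B_def space_M)
      have noise: "\<bar>\<sigma> * \<omega> t\<bar> \<le> \<epsilon>" if "0 \<le> t" "t \<le> T" for t
        using \<omega>(3)[OF that] \<sigma> by (simp add: abs_mult field_simps)
      have "integral {0..T} (\<lambda>s. (\<phi> s \<omega> (a \<omega>))\<^sup>2) \<le> integral {0..T} (\<lambda>s. C * \<epsilon>\<^sup>2)"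
      proof (rule integral_le)
        show "(\<lambda>s. (\<phi> s \<omega> (a \<omega>))\<^sup>2) integrable_on {0..T}"
          by (intro cadlag_on_integrable cadlag_on_intros flow_cadlag \<omega>) simp
        show "(\<phi> t \<omega> (a \<omega>))\<^sup>2 \<le> C * \<epsilon>\<^sup>2" if "t \<in> {0..T}" for t
          unfolding C_def using that
          by (intro cubic_sde_small[OF flow_solves[OF \<omega>(1)] \<omega>(2) noise \<epsilon>(2)]) auto
      qed (intro cadlag_on_integrable cadlag_on_const; simp)
      then have I: "3 * integral {0..T} (\<lambda>s. (\<phi> s \<omega> (a \<omega>))\<^sup>2) < 1" using T small by (simp add: mult_ac)
      have "exp (\<beta> * T - 3 * integral {0..T} (\<lambda>s. (\<phi> s \<omega> (a \<omega>))\<^sup>2)) \<le> K * exp ((\<gamma> - \<kappa>) * T)"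
        using bound[rule_format, of T] T \<omega>(1) by (simp add: linearization_nonneg integral_rate)
      also have "\<dots> \<le> exp (ln K) * exp ((\<beta> - \<kappa>) * T)"
        using assms T by (intro mult_mono) auto
      also have "\<dots> = exp (ln K + (\<beta> - \<kappa>) * T)" by (simp add: exp_add)
      finally have "\<beta> * T - 3 * integral {0..T} (\<lambda>s. (\<phi> s \<omega> (a \<omega>))\<^sup>2) \<le> ln K + (\<beta> - \<kappa>) * T" by simp
      moreover have "\<kappa> * T = ln K + 1" using assms by (simp add: T_def)
      ultimately show False using I by (simp add: algebra_simps)
    qed
    show "{\<omega>\<in>space M. a \<omega> \<in> {-\<epsilon>..\<epsilon>}} \<inter> B \<in> events"
      using B equilibrium_event by auto
  qed
  ultimately show False by simp
qed

text \<open>Already the bound at \<open>t = - 1\<close> fails: it would limit the energy over unit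
  time, whereas a far start under moderate noise makes that energy arbitrarily large. No restriction
  on the rate \<open>\<rho>\<close> is involved.\<close>

lemma no_uniform_expansion:
  assumes K: "1 \<le> K"
  shows "\<not> (AE \<omega> in M. \<forall>t\<le>0. norm (linearization path_shift \<phi> a t \<omega>) \<le> K * exp (\<rho> * t))"
proof
  assume ae: "AE \<omega> in M. \<forall>t\<le>0. norm (linearization path_shift \<phi> a t \<omega>) \<le> K * exp (\<rho> * t)"
  \<comment> \<open>The bound at \<open>- 1\<close> says that three times the energy is at most
    \<open>ln K + \<beta> - \<rho>\<close>; the maximum with 0 serves
    \<open>cubic_sde_large_energy\<close>.\<close>
  define C where "C = max 0 ((ln K + \<beta> - \<rho>) / 3)"
  obtain m where m: "0 < prob {\<omega>\<in>space M. \<forall>q\<in>\<rat> \<inter> {0..2}. \<bar>\<phi> q \<omega> 0\<bar> \<le> m}"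
    using flow_tube_positive by blast
  obtain R where R: "\<And>\<omega> x X X0. solves_sde (\<lambda>x. \<beta> * x - x ^ 3) \<sigma> \<omega> x X \<Longrightarrow>
    solves_sde (\<lambda>x. \<beta> * x - x ^ 3) \<sigma> \<omega> 0 X0 \<Longrightarrow>
    (\<And>t. 0 \<le> t \<Longrightarrow> t \<le> 1 \<Longrightarrow> \<bar>X0 t\<bar> \<le> m) \<Longrightarrow> R < \<bar>x\<bar> \<Longrightarrow> C < integral {0..1} (\<lambda>s. (X s)\<^sup>2)"
    using cubic_sde_large_energy[of C \<beta> \<sigma> m] by (auto simp: C_def)
  define B where "B = {\<omega>\<in>space M. \<forall>q\<in>\<rat> \<inter> {0..2}. \<bar>\<phi> q \<omega> 0\<bar> \<le> m}"
  have B: "B \<in> events" unfolding B_def by (rule flow_tube_event)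
  have Bd: "determined_on {0..} B"
    unfolding determined_on_def
  proof (intro ballI impI)
    fix \<omega> \<omega>' assume *: "\<omega> \<in> cadlag_paths" "\<omega>' \<in> cadlag_paths" "\<forall>t\<in>{0..}. \<omega> t = \<omega>' t"
    have "\<phi> q \<omega> 0 = \<phi> q \<omega>' 0" if "0 \<le> q" for q
      by (rule flow_determined) (use * that in auto)
    then show "\<omega> \<in> B \<longleftrightarrow> \<omega>' \<in> B" using * by (auto simp: B_def space_M)
  qed
  define S where "S = {x. R < \<bar>x\<bar>}"
  have S: "S \<in> sets borel" unfolding S_def by measurable
  have "0 < prob ({\<omega>\<in>space M. a \<omega> \<in> S} \<inter> B)"
    using equilibrium_unbounded[of R] m equilibrium_indep_future[OF S B Bd] by (simp add: S_def B_def)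
  moreover have "prob ({\<omega>\<in>space M. a \<omega> \<in> S} \<inter> B) = 0"
  proof (rule prob_eq_0_AE)
    show "AE \<omega> in M. \<omega> \<notin> {\<omega>\<in>space M. a \<omega> \<in> S} \<inter> B"
      \<comment> \<open>Seen from the path shifted by 1, time \<open>- 1\<close> leads back to
        \<open>\<omega>\<close>, where \<open>a \<omega>\<close> is the start of the unit interval
        and the noise on it is future.\<close>
      using AE_shift[OF ae, of 1]
    proof (eventually_elim, intro notI)
      fix \<omega> assume bound: "\<forall>t\<le>0. norm (linearization path_shift \<phi> a t (path_shift 1 \<omega>)) \<le> K * exp (\<rho> * t)"
        and "\<omega> \<in> {\<omega>\<in>space M. a \<omega> \<in> S} \<inter> B"
      then have \<omega>: "\<omega> \<in> cadlag_paths" "R < \<bar>a \<omega>\<bar>" "\<And>q. q \<in> \<rat> \<Longrightarrow> 0 \<le> q \<Longrightarrow> q \<le> 2 \<Longrightarrow> \<bar>\<phi> q \<omega> 0\<bar> \<le> m"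
        by (auto simp: B_def S_def space_M)
      have tube: "\<bar>\<phi> t \<omega> 0\<bar> \<le> m" if "0 \<le> t" "t \<le> 1" for t
      proof -
        have "\<phi> t \<omega> 0 \<in> {-m..m}"
          by (rule cadlag_closed_from_rationals[where f = "\<lambda>t. \<phi> t \<omega> 0" and h = 2, OF flow_cadlag[OF \<omega>(1)] that(1)])
            (use \<omega>(3) that in \<open>auto simp: abs_le_iff minus_le_iff\<close>)
        then show ?thesis by auto
      qed
      define J where "J = integral {0..1} (\<lambda>s. (\<phi> s \<omega> (a \<omega>))\<^sup>2)"
      have I: "C < J"
        unfolding J_def by (rule R[OF flow_solves[OF \<omega>(1)] flow_solves[OF \<omega>(1)] tube \<omega>(2)])
      have "inverse (exp (\<beta> - 3 * J)) \<le> K * exp (- \<rho>)"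
        using bound[rule_format, of "- 1"] linearization_neg[OF \<omega>(1), of 1] integral_rate[OF \<omega>(1), of 1 "a \<omega>"]
        by (simp add: J_def)
      also have "\<dots> = exp (ln K - \<rho>)" using K by (simp add: exp_diff exp_minus field_simps)
      finally have "3 * J - \<beta> \<le> ln K - \<rho>"
        by (simp flip: exp_minus)
      moreover have "(ln K + \<beta> - \<rho>) / 3 \<le> C" unfolding C_def by (rule max.cobounded2)
      then have "ln K + \<beta> - \<rho> \<le> C * 3" by (simp only: pos_divide_le_eq zero_less_numeral)
      ultimately show False using I by linarith
    qed
    show "{\<omega>\<in>space M. a \<omega> \<in> S} \<inter> B \<in> events"
      using B equilibrium_event[OF S] by auto
  qed
  ultimately show False by simp
qed

text \<open>In dimension one the nonzero linearization cancels from the commutation rule, so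
  \<open>P\<close> is invariant under every shift and for every path, in the strict form that
  \<open>shift_ergodic\<close> uses.\<close>

lemma no_dichotomy_below:
  assumes "\<gamma> \<le> \<beta>"
  shows "\<not> exponential_dichotomy M path_shift (linearization path_shift \<phi> a) \<gamma>"
proof
  assume "exponential_dichotomy M path_shift (linearization path_shift \<phi> a) \<gamma>"
  then obtain \<kappa> K P where \<kappa>: "0 < \<kappa>" and K: "1 \<le> K"
    and P: "invariant_projector M path_shift (linearization path_shift \<phi> a) P"
    and ae: "AE \<omega> in M.
      (\<forall>t\<ge>0. norm (linearization path_shift \<phi> a t \<omega> * P \<omega>) \<le> K * exp ((\<gamma> - \<kappa>) * t)) \<and>
      (\<forall>t\<le>0. norm (linearization path_shift \<phi> a t \<omega> * (1 - P \<omega>)) \<le> K * exp ((\<gamma> + \<kappa>) * t))"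
    unfolding exponential_dichotomy_def by blast
  have [measurable]: "P \<in> borel_measurable M" using P by (simp add: invariant_projector_def)
  have P01: "P \<omega> = 0 \<or> P \<omega> = 1" if "\<omega> \<in> space M" for \<omega>
    using P that by (auto simp: invariant_projector_def power2_eq_square)
  have inv: "P (path_shift t \<omega>) = P \<omega>" if "\<omega> \<in> space M" for t \<omega>
  proof -
    have "P (path_shift t \<omega>) * linearization path_shift \<phi> a t \<omega> = linearization path_shift \<phi> a t \<omega> * P \<omega>"
      using P that unfolding invariant_projector_def by blast
    then show ?thesis using linearization_nonzero[of \<omega> t] that by (simp add: space_M)
  qed
  define A where "A = {\<omega>\<in>space M. P \<omega> = 1}"
  have A: "A \<in> events" unfolding A_def by measurable
  have "path_shift t -` A \<inter> space M = A" for t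
    using inv by (auto simp: A_def space_M shift_in_space)
  then consider "prob A = 1" | "prob A = 0" using shift_ergodic[OF A] by blast
  then show False
  proof cases
    case 1
    then have "AE \<omega> in M. P \<omega> = 1"
      unfolding A_def by (subst (asm) prob_Collect_eq_1) auto
    then have "AE \<omega> in M. \<forall>t\<ge>0. norm (linearization path_shift \<phi> a t \<omega>) \<le> K * exp ((\<gamma> - \<kappa>) * t)"
      using ae by eventually_elim auto
    then show False using no_uniform_contraction[OF \<kappa> K assms] by simp
  next
    case 2
    then have "AE \<omega> in M. P \<omega> \<noteq> 1"
      unfolding A_def by (subst (asm) prob_Collect_eq_0) auto
    then have "AE \<omega> in M. \<forall>t\<le>0. norm (linearization path_shift \<phi> a t \<omega>) \<le> K * exp ((\<gamma> + \<kappa>) * t)"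
      using ae AE_space by eventually_elim (use P01 in force)
    then show False using no_uniform_expansion[OF K] by simp
  qed
qed

end

theorem theorem3p9:
  fixes \<alpha> \<sigma> \<beta> :: real
    and M :: "(real \<Rightarrow> real) measure"
    and \<phi> :: "real \<Rightarrow> (real \<Rightarrow> real) \<Rightarrow> real \<Rightarrow> real"
    and a :: "(real \<Rightarrow> real) \<Rightarrow> real"
  assumes "1 < \<alpha>" "\<alpha> < 2" and "\<sigma> \<noteq> 0"
    and "stable_process_law \<alpha> M \<or> truncated_stable_process_law \<alpha> M"
    and "rds_generated_by M (\<lambda>x. \<beta> * x - x ^ 3) \<sigma> \<phi>"
    and "attracting_random_equilibrium M path_shift \<phi> a"
  shows "dichotomy_spectrum M path_shift (linearization path_shift \<phi> a) = {..\<beta>}"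
proof -
  have "metric_dynamical_system M path_shift"
    using assms(5) by (simp add: rds_generated_by_def random_dynamical_system_def)
  then have "jumping_paths M"
    using assms(1,2) by (intro jumping_paths_stable_law[OF _ _ assms(4)]) auto
  then interpret random_equilibrium M \<phi> \<sigma> \<beta> a
    unfolding random_equilibrium_def random_equilibrium_axioms_def using assms(3,5,6) by blast
  show ?thesis
    unfolding dichotomy_spectrum_def
    using dichotomy_above no_dichotomy_below by (auto simp: not_le[symmetric])
qed

end
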